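(* Let $\Gamma\subset\mathbb{C}$ be a lattice, $\beta_0\in\Gamma^*$ with $\Gamma^*_{\beta_0}\ne\emptyset$, and $N=\#\Gamma^*_{\beta_0}$. The isomorphism $\Phi:\mathcal{S}(\Gamma,\beta_0)\to\mathbb{CP}^{N-1}$ of the context (where $\mathcal{S}(\Gamma,\beta_0)$ is regarded as the space of based weakly conformal HSL immersions $f:\mathbb{C}/\Gamma\to\mathbb{R}^4$ with Maslov class $\beta_0$, modulo dilations and $T_0$) is inverted by assigning to $[t]=[t_1,\dots,t_N]\in\mathbb{CP}^{N-1}$ the map $$f(z)=2\,\mathrm{Re}\Big[\tfrac1{p(1)}\big(\chi_1(1,z)e_{\beta_0/2}(z)-\chi_1(1,0)\big)v_1\Big]+2\,\mathrm{Im}\Big[\tfrac1{p(1)}\big(\chi_1(-1,z)e_{-\beta_0/2}(z)-\chi_1(-1,0)\big)Lv_1\Big],$$ in which $\chi_1(\lambda,z)=\lambda\varphi(\lambda,t(z))$ and $t_j(z)=t_je_{-\gamma_j}(z)$. Further, $f$ has a branch point at $z$ if and only if $[t(z)]$ lies on the intersection of hyperplanes $\Theta_0\cap\Theta_\infty$.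
   Context: **HSL tori.** $\mathbb{R}^4$ has its standard inner product and orthonormal basis $\varepsilon_1,\dots,\varepsilon_4$. $J,L\in SO(4)$ are given by $J\varepsilon_1=\varepsilon_2$, $J\varepsilon_2=-\varepsilon_1$, $J\varepsilon_3=\varepsilon_4$, $J\varepsilon_4=-\varepsilon_3$; $L\varepsilon_1=\varepsilon_3$, $L\varepsilon_3=-\varepsilon_1$, $L\varepsilon_2=-\varepsilon_4$, $L\varepsilon_4=\varepsilon_2$, extended complex linearly to $\mathbb{C}^4$. $G_0=\{g\in SO(4):gJ=Jg,\ gL=Lg\}$. On $\mathbb{C}$, $\langle z,w\rangle=\mathrm{Re}(z\bar w)$; $\Gamma^*=\{\gamma:\langle\gamma,z\rangle\in\mathbb{Z}\ \forall z\in\Gamma\}$; $e_\gamma(z)=\exp(2\pi i\langle\gamma,z\rangle)$; $\beta(z)=2\pi\langle\beta_0,z\rangle$. A based weakly conformal Hamiltonian stationary Lagrangian (HSL) immersion with Maslov class $\beta_0$ is a non-constant smooth $f:\mathbb{C}/\Gamma\to\mathbb{R}^4$ with $f(0)=0$ and $e^{J\beta}L f_z=i f_z$; a branch point is a point where $f_z=0$. Put $v_1=\frac1{\sqrt2}(\varepsilon_1-i\varepsilon_2)$, $v_2=\frac1{\sqrt2}(\varepsilon_3-i\varepsilon_4)$, $v_3=\bar v_1$, $v_4=\bar v_2$; $T_0=\{g\in G_0:g\,\mathbb{C}v_1=\mathbb{C}v_1\}\simeq S^1$. **Frequencies.** $\Gamma^*_{\beta_0}=\{\gamma\in\Gamma^*+\frac{\beta_0}{2}:|\gamma|=\frac{|\beta_0|}2,\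 \gamma\ne\pm\frac{\beta_0}2\}=\{\gamma_1,\dots,\gamma_N\}$, labelled with $\gamma_{j+N/2}=-\gamma_j$; $s_j=2\gamma_j/\beta_0$; $p(\lambda)=\prod_{j=1}^N(\lambda-s_j)$. $\Delta_f\subset\Gamma^*_{\beta_0}$ is the set of frequencies whose Fourier coefficient in $e^{-J\beta/2}f_z$ is non-zero; $\mathfrak{S}_f=\{2\gamma/\beta_0:\gamma\in\Delta_f\}$, $N_f=\#\Delta_f$, $p_f=\prod_{s\in\mathfrak{S}_f}(\lambda-s)$. **The isomorphism $\Phi$.** For such $f$ there is a unique $\mathbb{C}^4$-valued $x(\lambda,z)$, polynomial in $\lambda$ with coefficients smooth in $z\in\mathbb{C}$, satisfying $dx+\frac\pi2(\lambda^{-1}\bar\beta_0dz+\lambda\beta_0d\bar z)Jx=p_f(\lambda)e^{-J\beta/2}(f_zdz+\lambda f_{\bar z}d\bar z)$; it has degree at most $N_f$ in $\lambda$ and vanishes at $\lambda=0$. Write $x=\sum_kx^{(k)}v_k$ and let $E$ be the degree $N_f-1$ divisor of zeroes on $\hat{\mathbb{C}}=\mathbb{C}\cup\{\infty\}$ of $\lambda^{-1}x^{(1)}(\lambda,0)$, regarded as a polynomial of formal degree $N_f-1$ (so $\infty$ counts with multiplicity $N_f-1$ minus its degree). The spectral data of $f$ (a spectral curve with rational function $\lambda$ and a rank one sheaf) is equivalent to the pair $(\Delta_f,E)$, and $\mathcal{S}(\Gamma,\beta_0)$ is the set of all such spectral data, i.e. of all pairs $(\Delta,E)$ with $\emptyset\neq\Delta=-\Delta\subseteq\Gamma^*_{\beta_0}$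 and $E$ an effective divisor of degree $\#\Delta-1$ on $\hat{\mathbb{C}}$ whose support does not contain both $s$ and $-s$ for any $s\in\{2\gamma/\beta_0:\gamma\in\Delta\}$. Spectral data determines $f$ up to dilations and $T_0$. The map $\Phi$ sends $(\Delta,E)$ to $[h(s_1),\dots,h(s_N)]$, where $h$ is the polynomial (unique up to scale) of formal degree $N-1$ with zero divisor $E+\sum_{\gamma_j\notin\Delta}s_j$. **Formulae.** For $t\in\mathbb{C}^N$, $$\varphi(\lambda,t)=\Big(\prod_{j=1}^N(\lambda-s_j)\Big)\det\begin{pmatrix}1&s_1&\dots&s_1^{N-2}&t_1/(\lambda-s_1)\\ \vdots&\vdots&&\vdots&\vdots\\1&s_N&\dots&s_N^{N-2}&t_N/(\lambda-s_N)\end{pmatrix}.$$ $\Theta_\infty=\{[t]\in\mathbb{CP}^{N-1}:\sum_{j=1}^N(\prod_{m\ne j}\frac1{s_m-s_j})t_j=0\}$, $\Theta_0=\{[t]\in\mathbb{CP}^{N-1}:\sum_{j=1}^N(\prod_{m\ne j}\frac1{s_m-s_j})\frac{t_j}{s_j}=0\}$. *)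

theory Defs
  imports "HOL-Analysis.Analysis" "Jordan_Normal_Form.Determinant"
begin

text \<open>
  Vectors in \<open>\<real>\<^sup>4\<close> and \<open>\<complex>\<^sup>4\<close> are Cartesian vectors from HOL-Analysis. Vectors in \<open>\<complex>\<^sup>N\<close>, where \<open>N\<close>
  is a number computed from the lattice, are the vectors of Jordan_Normal_Form (indices
  \<open>0, \<dots>, N - 1\<close>), and so is the matrix whose determinant occurs in \<open>\<phi>\<close>. The two libraries share
  the names \<open>vec\<close>, \<open>mat\<close>, \<open>det\<close>, which are therefore qualified; \<open>$\<close> is always the HOL-Analysis one.
\<close>

no_notation vec_index (infixl "$" 100)


section \<open>Linear algebra on \<open>\<real>\<^sup>4\<close> and \<open>\<complex>\<^sup>4\<close>\<close>

definition cx_vec :: "real^4 \<Rightarrow> complex^4" where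
  "cx_vec x = (\<chi> k. complex_of_real (x $ k))"

definition Re_vec :: "complex^4 \<Rightarrow> real^4" where
  "Re_vec x = (\<chi> k. Re (x $ k))"

definition Im_vec :: "complex^4 \<Rightarrow> real^4" where
  "Im_vec x = (\<chi> k. Im (x $ k))"

definition cx_mat :: "real^4^4 \<Rightarrow> complex^4^4" where
  "cx_mat A = map_matrix complex_of_real A"

text \<open>The rows listed here are the images of the basis vectors, hence the transposition.\<close>

definition Jmat :: "real^4^4" where
  "Jmat = transpose (vector [axis 2 1, - axis 1 1, axis 4 1, - axis 3 1])"

definition Lmat :: "real^4^4" where
  "Lmat = transpose (vector [axis 3 1, - axis 4 1, - axis 1 1, axis 2 1])"

definition mat_exp :: "real^4^4 \<Rightarrow> real^4^4" where
  "mat_exp A = (\<Sum>n. (1 / fact n) *\<^sub>R (((**) A ^^ n) (Finite_Cartesian_Product.mat 1)))"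

text \<open>Here \<open>v_basis 4\<close> is \<open>v\<^sub>4\<close>; in the index type the numeral \<open>4\<close> is the same element as \<open>0\<close>.\<close>

definition v_basis :: "4 \<Rightarrow> complex^4" where
  "v_basis k =
    (if k = 1 then (1 / complex_of_real (sqrt 2)) *s (axis 1 1 - \<i> *s axis 2 1)
     else if k = 2 then (1 / complex_of_real (sqrt 2)) *s (axis 3 1 - \<i> *s axis 4 1)
     else if k = 3 then (1 / complex_of_real (sqrt 2)) *s (axis 1 1 + \<i> *s axis 2 1)
     else (1 / complex_of_real (sqrt 2)) *s (axis 3 1 + \<i> *s axis 4 1))"

definition G0 :: "(real^4^4) set" where
  "G0 = {g. orthogonal_matrix g \<and> Determinants.det g = 1 \<and>
            g ** Jmat = Jmat ** g \<and> g ** Lmat = Lmat ** g}"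

definition T0 :: "(real^4^4) set" where
  "T0 = {g \<in> G0.
     (\<lambda>x. cx_mat g *v x) ` range (\<lambda>c. c *s v_basis 1) = range (\<lambda>c. c *s v_basis 1)}"


section \<open>Lattices and frequencies\<close>

text \<open>The real inner product \<open>\<langle>z,w\<rangle> = Re (z * cnj w)\<close> on \<open>\<complex>\<close> is the library's \<open>z \<bullet> w\<close>.\<close>

definition lattice_basis :: "complex set \<Rightarrow> complex \<Rightarrow> complex \<Rightarrow> bool" where
  "lattice_basis \<Gamma> \<omega>1 \<omega>2 \<longleftrightarrow>
     \<omega>1 \<noteq> \<omega>2 \<and> Real_Vector_Spaces.independent {\<omega>1, \<omega>2} \<and>
     \<Gamma> = {of_int m * \<omega>1 + of_int n * \<omega>2 | m n. True}"

definition is_lattice :: "complex set \<Rightarrow> bool" where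
  "is_lattice \<Gamma> \<longleftrightarrow> (\<exists>\<omega>1 \<omega>2. lattice_basis \<Gamma> \<omega>1 \<omega>2)"

definition dual_lattice :: "complex set \<Rightarrow> complex set" where
  "dual_lattice \<Gamma> = {\<gamma>. \<forall>z\<in>\<Gamma>. \<gamma> \<bullet> z \<in> \<int>}"

definition e_fun :: "complex \<Rightarrow> complex \<Rightarrow> complex" where
  "e_fun \<gamma> z = exp (2 * of_real pi * \<i> * of_real (\<gamma> \<bullet> z))"

definition beta :: "complex \<Rightarrow> complex \<Rightarrow> real" where
  "beta \<beta>0 z = 2 * pi * (\<beta>0 \<bullet> z)"

definition shifted_dual :: "complex set \<Rightarrow> complex \<Rightarrow> complex set" where
  "shifted_dual \<Gamma> \<beta>0 = (\<lambda>\<delta>. \<delta> + \<beta>0 / 2) ` dual_lattice \<Gamma>"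

definition freqs :: "complex set \<Rightarrow> complex \<Rightarrow> complex set" where
  "freqs \<Gamma> \<beta>0 =
     {\<gamma> \<in> shifted_dual \<Gamma> \<beta>0. norm \<gamma> = norm \<beta>0 / 2 \<and> \<gamma> \<noteq> \<beta>0 / 2 \<and> \<gamma> \<noteq> - (\<beta>0 / 2)}"

definition slope :: "complex \<Rightarrow> complex \<Rightarrow> complex" where
  "slope \<beta>0 \<gamma> = 2 * \<gamma> / \<beta>0"


section \<open>Hamiltonian stationary Lagrangian tori\<close>

primrec k_smooth :: "nat \<Rightarrow> ('a::real_normed_vector \<Rightarrow> 'b::real_normed_vector) \<Rightarrow> bool" where
  "k_smooth 0 f \<longleftrightarrow> continuous_on UNIV f"
| "k_smooth (Suc k) f \<longleftrightarrow>
     (\<forall>x. f differentiable at x) \<and> (\<forall>w. k_smooth k (\<lambda>x. frechet_derivative f (at x) w))"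

definition smooth :: "('a::real_normed_vector \<Rightarrow> 'b::real_normed_vector) \<Rightarrow> bool" where
  "smooth f \<longleftrightarrow> (\<forall>k. k_smooth k f)"

definition d_z :: "(complex \<Rightarrow> complex^4) \<Rightarrow> complex \<Rightarrow> complex^4" where
  "d_z F z = (1/2) *s (frechet_derivative F (at z) 1 - \<i> *s frechet_derivative F (at z) \<i>)"

definition d_zbar :: "(complex \<Rightarrow> complex^4) \<Rightarrow> complex \<Rightarrow> complex^4" where
  "d_zbar F z = (1/2) *s (frechet_derivative F (at z) 1 + \<i> *s frechet_derivative F (at z) \<i>)"

definition f_z :: "(complex \<Rightarrow> real^4) \<Rightarrow> complex \<Rightarrow> complex^4" where
  "f_z f = d_z (\<lambda>z. cx_vec (f z))"

definition f_zbar :: "(complex \<Rightarrow> real^4) \<Rightarrow> complex \<Rightarrow> complex^4" where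
  "f_zbar f = d_zbar (\<lambda>z. cx_vec (f z))"

text \<open>Maps on the torus \<open>\<complex>/\<Gamma>\<close> are \<open>\<Gamma>\<close>-periodic maps on \<open>\<complex>\<close>.\<close>

definition based_HSL :: "complex set \<Rightarrow> complex \<Rightarrow> (complex \<Rightarrow> real^4) set" where
  "based_HSL \<Gamma> \<beta>0 = {f.
     (\<forall>z. \<forall>w\<in>\<Gamma>. f (z + w) = f z) \<and>
     smooth f \<and> (\<nexists>c. \<forall>z. f z = c) \<and> f 0 = 0 \<and>
     (\<forall>z. cx_mat (mat_exp (beta \<beta>0 z *\<^sub>R Jmat)) *v (cx_mat Lmat *v f_z f z) = \<i> *s f_z f z)}"

definition branch_point :: "(complex \<Rightarrow> real^4) \<Rightarrow> complex \<Rightarrow> bool" where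
  "branch_point f z \<longleftrightarrow> f_z f z = 0"

definition dilation_T0_equiv :: "(complex \<Rightarrow> real^4) \<Rightarrow> (complex \<Rightarrow> real^4) \<Rightarrow> bool" where
  "dilation_T0_equiv f f' \<longleftrightarrow> (\<exists>r>0. \<exists>g\<in>T0. \<forall>z. f' z = r *\<^sub>R (g *v f z))"


section \<open>Spectral data\<close>

text \<open>
  The integrand below is \<open>\<Gamma>\<close>-periodic whenever \<open>u (z + w) = e_fun \<gamma> w *s u z\<close> for \<open>w \<in> \<Gamma>\<close>, and then the
  mean over a period parallelogram does not depend on the basis chosen.
\<close>

definition fourier_coeff :: "complex set \<Rightarrow> (complex \<Rightarrow> complex^4) \<Rightarrow> complex \<Rightarrow> complex^4" where
  "fourier_coeff \<Gamma> u \<gamma> =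
     (let (\<omega>1, \<omega>2) = (SOME (\<omega>1, \<omega>2). lattice_basis \<Gamma> \<omega>1 \<omega>2)
      in integral {0..1} (\<lambda>a::real. integral {0..1} (\<lambda>b::real.
           (let z = of_real a * \<omega>1 + of_real b * \<omega>2 in e_fun (- \<gamma>) z *s u z))))"

definition gauged_f_z :: "complex \<Rightarrow> (complex \<Rightarrow> real^4) \<Rightarrow> complex \<Rightarrow> complex^4" where
  "gauged_f_z \<beta>0 f z = cx_mat (mat_exp ((- (beta \<beta>0 z / 2)) *\<^sub>R Jmat)) *v f_z f z"

definition gauged_f_zbar :: "complex \<Rightarrow> (complex \<Rightarrow> real^4) \<Rightarrow> complex \<Rightarrow> complex^4" where
  "gauged_f_zbar \<beta>0 f z = cx_mat (mat_exp ((- (beta \<beta>0 z / 2)) *\<^sub>R Jmat)) *v f_zbar f z"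

definition Delta :: "complex set \<Rightarrow> complex \<Rightarrow> (complex \<Rightarrow> real^4) \<Rightarrow> complex set" where
  "Delta \<Gamma> \<beta>0 f = {\<gamma> \<in> shifted_dual \<Gamma> \<beta>0. fourier_coeff \<Gamma> (gauged_f_z \<beta>0 f) \<gamma> \<noteq> 0}"

definition p_f :: "complex set \<Rightarrow> complex \<Rightarrow> (complex \<Rightarrow> real^4) \<Rightarrow> complex \<Rightarrow> complex" where
  "p_f \<Gamma> \<beta>0 f lam = (\<Prod>s \<in> slope \<beta>0 ` Delta \<Gamma> \<beta>0 f. lam - s)"

text \<open>
  A \<open>\<complex>\<^sup>4\<close>-valued \<open>x(\<lambda>,z)\<close> that is polynomial in \<open>\<lambda>\<close> is given by the polynomials \<open>x\<^sup>(\<^sup>k\<^sup>)(\<cdot>,z)\<close> with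
  \<open>x = \<Sum>k. x\<^sup>(\<^sup>k\<^sup>) v\<^sub>k\<close>. The equation of 1-forms is evaluated on tangent vectors \<open>w\<close>, on which \<open>dz\<close> and
  its conjugate take the values \<open>w\<close> and \<open>cnj w\<close>.
\<close>

definition x_val :: "(complex \<Rightarrow> complex poly ^ 4) \<Rightarrow> complex \<Rightarrow> complex \<Rightarrow> complex^4" where
  "x_val X lam z = (\<Sum>k\<in>UNIV. poly (X z $ k) lam *s v_basis k)"

definition is_x ::
  "complex set \<Rightarrow> complex \<Rightarrow> (complex \<Rightarrow> real^4) \<Rightarrow> (complex \<Rightarrow> complex poly ^ 4) \<Rightarrow> bool" where
  "is_x \<Gamma> \<beta>0 f X \<longleftrightarrow>
     (\<exists>d. \<forall>z k. degree (X z $ k) \<le> d) \<and>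
     (\<forall>k n. smooth (\<lambda>z. coeff (X z $ k) n)) \<and>
     (\<forall>lam z w. lam \<noteq> 0 \<longrightarrow>
        frechet_derivative (x_val X lam) (at z) w
          + (of_real (pi / 2) * (inverse lam * cnj \<beta>0 * w + lam * \<beta>0 * cnj w))
              *s (cx_mat Jmat *v x_val X lam z)
        = p_f \<Gamma> \<beta>0 f lam *s (w *s gauged_f_z \<beta>0 f z + (lam * cnj w) *s gauged_f_zbar \<beta>0 f z))"

definition x_of :: "complex set \<Rightarrow> complex \<Rightarrow> (complex \<Rightarrow> real^4) \<Rightarrow> complex \<Rightarrow> complex poly ^ 4" where
  "x_of \<Gamma> \<beta>0 f = (THE X. is_x \<Gamma> \<beta>0 f X)"

datatype riemann_sphere = Fin complex | Infty

text \<open>Effective divisors on the Riemann sphere are finite multisets of points.\<close>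

definition zero_divisor :: "nat \<Rightarrow> complex poly \<Rightarrow> riemann_sphere multiset" where
  "zero_divisor d q = image_mset Fin (proots q) + replicate_mset (d - degree q) Infty"

text \<open>The polynomial \<open>x\<^sup>(\<^sup>1\<^sup>)(\<lambda>,0)\<close> vanishes at \<open>\<lambda> = 0\<close>, so the division by \<open>\<lambda>\<close> is exact.\<close>

definition spectral_data ::
  "complex set \<Rightarrow> complex \<Rightarrow> (complex \<Rightarrow> real^4) \<Rightarrow> complex set \<times> riemann_sphere multiset" where
  "spectral_data \<Gamma> \<beta>0 f =
     (Delta \<Gamma> \<beta>0 f,
      zero_divisor (card (Delta \<Gamma> \<beta>0 f) - 1) ((x_of \<Gamma> \<beta>0 f 0 $ 1) div [:0, 1:]))"

definition spectral_space ::
  "complex set \<Rightarrow> complex \<Rightarrow> (complex set \<times> riemann_sphere multiset) set" where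
  "spectral_space \<Gamma> \<beta>0 = {(\<Delta>, E).
     \<Delta> \<noteq> {} \<and> \<Delta> = uminus ` \<Delta> \<and> \<Delta> \<subseteq> freqs \<Gamma> \<beta>0 \<and>
     size E = card \<Delta> - 1 \<and>
     (\<forall>s \<in> slope \<beta>0 ` \<Delta>. \<not> (Fin s \<in># E \<and> Fin (- s) \<in># E))}"


section \<open>Projective space and the map \<open>\<Phi>\<close>\<close>

definition proj_class :: "complex Matrix.vec \<Rightarrow> complex Matrix.vec set" where
  "proj_class t = {c \<cdot>\<^sub>v t | c. c \<noteq> 0}"

definition complex_proj :: "nat \<Rightarrow> complex Matrix.vec set set" where
  "complex_proj n = proj_class ` (carrier_vec (n + 1) - {0\<^sub>v (n + 1)})"

text \<open>
  A labelling of the frequencies is a function \<open>\<gamma>\<close> on \<open>{..<N}\<close>. The polynomial \<open>h\<close> is determined only up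
  to scale, which does not affect the projective point.
\<close>

definition is_labelling :: "complex set \<Rightarrow> complex \<Rightarrow> nat \<Rightarrow> (nat \<Rightarrow> complex) \<Rightarrow> bool" where
  "is_labelling \<Gamma> \<beta>0 N \<gamma> \<longleftrightarrow>
     bij_betw \<gamma> {..<N} (freqs \<Gamma> \<beta>0) \<and> (\<forall>j < N div 2. \<gamma> (j + N div 2) = - \<gamma> j)"

definition Phi ::
  "complex \<Rightarrow> nat \<Rightarrow> (nat \<Rightarrow> complex) \<Rightarrow> complex set \<times> riemann_sphere multiset
     \<Rightarrow> complex Matrix.vec set" where
  "Phi \<beta>0 N \<gamma> = (\<lambda>(\<Delta>, E).
     let h = (SOME h. h \<noteq> 0 \<and> degree h \<le> N - 1 \<and>
                zero_divisor (N - 1) h =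
                  E + image_mset (\<lambda>j. Fin (slope \<beta>0 (\<gamma> j))) (mset_set {j \<in> {..<N}. \<gamma> j \<notin> \<Delta>}))
     in proj_class (Matrix.vec N (\<lambda>j. poly h (slope \<beta>0 (\<gamma> j)))))"


section \<open>The explicit formulae\<close>

text \<open>
  In the following \<open>s\<close> is the function \<open>j \<mapsto> s\<^sub>j\<close>. The displayed formula for \<open>\<phi>\<close> gives the polynomial only
  for \<open>\<lambda> \<notin> {s\<^sub>1, \<dots>, s\<^sub>N}\<close>; it is used only at \<open>\<lambda> = 1\<close> and \<open>\<lambda> = -1\<close>, which are never among the \<open>s\<^sub>j\<close>.
\<close>

definition phi :: "nat \<Rightarrow> (nat \<Rightarrow> complex) \<Rightarrow> complex \<Rightarrow> complex Matrix.vec \<Rightarrow> complex" where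
  "phi N s lam t =
     (\<Prod>j<N. lam - s j) *
     Determinant.det (Matrix.mat N N
       (\<lambda>(i, j). if j < N - 1 then s i ^ j else vec_index t i / (lam - s i)))"

definition p_fun :: "nat \<Rightarrow> (nat \<Rightarrow> complex) \<Rightarrow> complex \<Rightarrow> complex" where
  "p_fun N s lam = (\<Prod>j<N. lam - s j)"

definition t_at :: "nat \<Rightarrow> (nat \<Rightarrow> complex) \<Rightarrow> complex Matrix.vec \<Rightarrow> complex \<Rightarrow> complex Matrix.vec" where
  "t_at N \<gamma> t z = Matrix.vec N (\<lambda>j. vec_index t j * e_fun (- \<gamma> j) z)"

definition chi1 ::
  "complex \<Rightarrow> nat \<Rightarrow> (nat \<Rightarrow> complex) \<Rightarrow> complex Matrix.vec \<Rightarrow> complex \<Rightarrow> complex \<Rightarrow> complex" where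
  "chi1 \<beta>0 N \<gamma> t lam z = lam * phi N (\<lambda>j. slope \<beta>0 (\<gamma> j)) lam (t_at N \<gamma> t z)"

definition f_of ::
  "complex \<Rightarrow> nat \<Rightarrow> (nat \<Rightarrow> complex) \<Rightarrow> complex Matrix.vec \<Rightarrow> complex \<Rightarrow> real^4" where
  "f_of \<beta>0 N \<gamma> t z =
     (let p1 = p_fun N (\<lambda>j. slope \<beta>0 (\<gamma> j)) 1; X = chi1 \<beta>0 N \<gamma> t
      in 2 *\<^sub>R Re_vec ((1 / p1 * (X 1 z * e_fun (\<beta>0 / 2) z - X 1 0)) *s v_basis 1)
       + 2 *\<^sub>R Im_vec ((1 / p1 * (X (-1) z * e_fun (- (\<beta>0 / 2)) z - X (-1) 0))
                        *s (cx_mat Lmat *v v_basis 1)))"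

definition Theta_infty :: "nat \<Rightarrow> (nat \<Rightarrow> complex) \<Rightarrow> complex Matrix.vec set set" where
  "Theta_infty N s = proj_class ` {t \<in> carrier_vec N - {0\<^sub>v N}.
     (\<Sum>j<N. (\<Prod>m \<in> {..<N} - {j}. 1 / (s m - s j)) * vec_index t j) = 0}"

definition Theta_0 :: "nat \<Rightarrow> (nat \<Rightarrow> complex) \<Rightarrow> complex Matrix.vec set set" where
  "Theta_0 N s = proj_class ` {t \<in> carrier_vec N - {0\<^sub>v N}.
     (\<Sum>j<N. (\<Prod>m \<in> {..<N} - {j}. 1 / (s m - s j)) * (vec_index t j / s j)) = 0}"

end

theory Submission
  imports Defs "HOL-Computational_Algebra.Fundamental_Theorem_Algebra"
begin

text \<open>
  Write a vector in the basis \<open>v\<^sub>1, \<dots>, v\<^sub>4\<close>. There \<open>J\<close> is diagonal with eigenvalues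
  \<open>\<i>, \<i>, -\<i>, -\<i>\<close>, and \<open>L v\<^sub>1 = v\<^sub>4\<close>, \<open>L v\<^sub>3 = v\<^sub>2\<close>. A real map \<open>f\<close> is therefore the same as a pair of
  complex functions, its coordinates \<open>F1\<close> and \<open>F4\<close> along \<open>v\<^sub>1\<close> and \<open>v\<^sub>4\<close> (the other two are conjugates),
  and the HSL equation says that the holomorphic and antiholomorphic derivatives of \<open>F4\<close> are those of \<open>F1\<close>
  multiplied by \<open>-\<i>\<close> and \<open>\<i>\<close> times \<open>e\<^sub>-\<^sub>\<beta>\<^sub>0\<close>, respectively (\<open>HSL_equation_coords\<close>). Comparing Fourier
  coefficients gives, for every dual vector \<open>\<delta>\<close>, two linear equations between the coefficient of \<open>F4\<close> at
  \<open>\<delta>\<close> and that of \<open>F1\<close> at \<open>\<delta> + \<beta>0\<close>; their determinant vanishes only for \<open>\<bar>\<delta> + \<beta>0/2\<bar> = \<bar>\<beta>0\<bar>/2\<close>. So every HSL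
  torus is a finite sum of exponentials, and it is determined by an arbitrary non-zero function \<open>A\<close> on the
  frequencies, where \<open>A \<gamma>\<close> is the Fourier coefficient at \<open>\<gamma>\<close> of the first coordinate of \<open>e\<^sup>-\<^sup>J\<^sup>\<beta>\<^sup>/\<^sup>2 f\<^sub>z\<close>
  (\<open>fam_in_HSL\<close>, \<open>HSL_is_fam\<close>). Only first derivatives of \<open>f\<close> enter, and the completeness of the
  characters on the torus comes from the Stone-Weierstrass theorem.

  For the map \<open>fam A\<close> everything is explicit. The equation for \<open>x\<close> is solved one frequency at a time by
  dividing by \<open>\<lambda> + s\<close> or \<open>\<lambda> - s\<close> (\<open>killing_is_x\<close>), and the solution is unique because the coefficients of
  the powers of \<open>\<lambda>\<close> obey a recursion starting from zero (\<open>is_x_unique\<close>). The polynomial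
  \<open>\<lambda>\<^sup>-\<^sup>1 x\<^sup>(\<^sup>1\<^sup>)(\<lambda>, 0)\<close> is a Lagrange sum whose value at \<open>s\<^sub>\<gamma>\<close> is a non-zero multiple of \<open>A (- \<gamma>)\<close>. Consequently
  its zero divisor determines \<open>A\<close> up to a scalar, every admissible divisor occurs, and
  \<open>\<Phi>\<close> sends the spectral data of \<open>fam A\<close> to \<open>[s\<^sub>j p'(s\<^sub>j) A (- \<gamma>\<^sub>j)]\<close> (\<open>Phi_fam\<close>). Multiplying \<open>A\<close> by a
  complex scalar rotates \<open>f\<close> by an element of \<open>T\<^sub>0\<close> and dilates it, and these motions do nothing else
  (\<open>equiv_scale\<close>, \<open>equiv_imp_scale\<close>). This gives the first three claims.

  The function \<open>\<phi>(\<cdot>, t)\<close> is, up to a constant that depends only on the \<open>s\<^sub>j\<close>, the polynomial of degree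
  less than \<open>N\<close> with value \<open>t\<^sub>j\<close> at \<open>s\<^sub>j\<close> (\<open>phi_partial_fractions\<close>). Inserted into the formula for \<open>f\<close>, this
  shows that \<open>f\<close> is \<open>fam A\<close> with \<open>A (- \<gamma>\<^sub>j)\<close> proportional to \<open>t\<^sub>j / (s\<^sub>j p'(s\<^sub>j))\<close>, which is exactly the function
  that \<open>\<Phi>\<close> sends to \<open>[t]\<close> (\<open>f_of_fam\<close>). Finally \<open>f\<^sub>z = 0\<close> means that two sums over the frequencies vanish
  at \<open>z\<close>, and these sums are the linear forms defining \<open>\<Theta>\<^sub>0\<close> and \<open>\<Theta>\<^sub>\<infinity>\<close> (\<open>branch_point_hyperplanes\<close>).
\<close>

section \<open>Coordinates adapted to the complex structure\<close>

text \<open>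
  The dual basis of \<open>v\<^sub>1, \<dots>, v\<^sub>4\<close>.
\<close>

definition coord :: "4 \<Rightarrow> complex^4 \<Rightarrow> complex" where
  "coord k x =
    (if k = 1 then (x $ 1 + \<i> * x $ 2) / of_real (sqrt 2)
     else if k = 2 then (x $ 3 + \<i> * x $ 4) / of_real (sqrt 2)
     else if k = 3 then (x $ 1 - \<i> * x $ 2) / of_real (sqrt 2)
     else (x $ 3 - \<i> * x $ 4) / of_real (sqrt 2))"

lemma sqrt2_cx: "of_real (sqrt 2) * of_real (sqrt 2) = (2::complex)"
  by (metis of_real_mult of_real_numeral real_sqrt_mult_self abs_numeral)

lemma vector_4_nth [simp]:
  "(vector [a, b, c, d] :: 'a::zero^4) $ 1 = a"
  "(vector [a, b, c, d] :: 'a::zero^4) $ 2 = b"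
  "(vector [a, b, c, d] :: 'a::zero^4) $ 3 = c"
  "(vector [a, b, c, d] :: 'a::zero^4) $ 4 = d"
  unfolding vector_def by simp_all

lemma coord_simps:
  "coord 1 x = (x $ 1 + \<i> * x $ 2) / of_real (sqrt 2)"
  "coord 2 x = (x $ 3 + \<i> * x $ 4) / of_real (sqrt 2)"
  "coord 3 x = (x $ 1 - \<i> * x $ 2) / of_real (sqrt 2)"
  "coord 4 x = (x $ 3 - \<i> * x $ 4) / of_real (sqrt 2)"
  unfolding coord_def by simp_all

lemma coord_add: "coord k (x + y) = coord k x + coord k y"
  by (simp add: coord_def field_simps)

lemma coord_diff: "coord k (x - y) = coord k x - coord k y"
  by (simp add: coord_def field_simps)

lemma coord_scale: "coord k (c *s x) = c * coord k x"
  by (simp add: coord_def field_simps)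

lemma coord_scaleR: "coord k (r *\<^sub>R x) = of_real r * coord k x"
  unfolding coord_def vector_scaleR_component by (auto simp: scaleR_conv_of_real field_simps)

lemma coord_zero [simp]: "coord k 0 = 0"
  by (simp add: coord_def)

lemma coord_sum: "coord k (\<Sum>i\<in>S. g i) = (\<Sum>i\<in>S. coord k (g i))"
  by (induction S rule: infinite_finite_induct) (simp_all add: coord_add)

lemma bounded_linear_coord: "bounded_linear (coord k)"
proof (rule linear_conv_bounded_linear[THEN iffD1], rule linearI)
  show "coord k (r *\<^sub>R x) = r *\<^sub>R coord k x" for r :: real and x
    unfolding coord_scaleR by (simp add: scaleR_conv_of_real)
qed (simp add: coord_add)

lemma coord_eqI:
  assumes "\<And>k. coord k x = coord k y"
  shows "x = y"
proof -
  have s: "complex_of_real (sqrt 2) \<noteq> 0" by simp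
  have *: "a = c \<and> b = d"
    if "(a + \<i> * b) / of_real (sqrt 2) = (c + \<i> * d) / of_real (sqrt 2)"
       "(a - \<i> * b) / of_real (sqrt 2) = (c - \<i> * d) / of_real (sqrt 2)" for a b c d :: complex
  proof -
    have 1: "a + \<i> * b = c + \<i> * d" "a - \<i> * b = c - \<i> * d" using that s by simp_all
    have "2 * a = 2 * c" using arg_cong2[OF 1, of "(+)"] by simp
    moreover have "2 * (\<i> * b) = 2 * (\<i> * d)" using arg_cong2[OF 1, of "(-)"] by simp
    ultimately show ?thesis by simp
  qed
  have "x $ 1 = y $ 1 \<and> x $ 2 = y $ 2" using assms[of 1] assms[of 3] by (intro *) (simp_all add: coord_simps)
  moreover have "x $ 3 = y $ 3 \<and> x $ 4 = y $ 4" using assms[of 2] assms[of 4] by (intro *) (simp_all add: coord_simps)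
  ultimately show ?thesis by (simp add: Finite_Cartesian_Product.vec_eq_iff forall_4)
qed

lemma coord_eq_iff: "x = y \<longleftrightarrow> coord 1 x = coord 1 y \<and> coord 2 x = coord 2 y \<and> coord 3 x = coord 3 y \<and> coord 4 x = coord 4 y"
  using coord_eqI[of x y] forall_4[of "\<lambda>k. coord k x = coord k y"] by blast

lemma v_basis_simps:
  "v_basis 1 = (1 / complex_of_real (sqrt 2)) *s (axis 1 1 - \<i> *s axis 2 1)"
  "v_basis 2 = (1 / complex_of_real (sqrt 2)) *s (axis 3 1 - \<i> *s axis 4 1)"
  "v_basis 3 = (1 / complex_of_real (sqrt 2)) *s (axis 1 1 + \<i> *s axis 2 1)"
  "v_basis 4 = (1 / complex_of_real (sqrt 2)) *s (axis 3 1 + \<i> *s axis 4 1)"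
  unfolding v_basis_def by simp_all

lemma coord_v_basis: "coord k (v_basis l) = (if k = l then 1 else 0)"
proof -
  have "\<forall>k l. coord k (v_basis l) = (if k = l then 1 else 0)"
    unfolding forall_4 by (simp add: coord_simps v_basis_simps axis_def sqrt2_cx)
  thus ?thesis by blast
qed

lemma coord_basis_sum: "coord k (\<Sum>l\<in>UNIV. c l *s v_basis l) = c k"
  by (simp add: coord_sum coord_scale coord_v_basis if_distrib cong: if_cong)

lemma basis_expansion: "x = (\<Sum>l\<in>UNIV. coord l x *s v_basis l)"
  by (rule coord_eqI) (simp add: coord_basis_sum)

lemma coord_cx_vec_cnj:
  "coord 3 (cx_vec x) = cnj (coord 1 (cx_vec x))"
  "coord 2 (cx_vec x) = cnj (coord 4 (cx_vec x))"
  by (simp_all add: coord_simps cx_vec_def)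

text \<open>The eigenvalue of \<open>J\<close> on \<open>v\<^sub>k\<close> is \<open>\<i>\<close> times this sign.\<close>

definition Jsign :: "4 \<Rightarrow> real" where
  "Jsign k = (if k = 1 \<or> k = 2 then 1 else -1)"

lemma Jsign_simps [simp]: "Jsign 1 = 1" "Jsign 2 = 1" "Jsign 3 = -1" "Jsign 4 = -1"
  unfolding Jsign_def by simp_all

lemma Jmat_nth:
  "(cx_mat Jmat *v x) $ 1 = - x $ 2" "(cx_mat Jmat *v x) $ 2 = x $ 1"
  "(cx_mat Jmat *v x) $ 3 = - x $ 4" "(cx_mat Jmat *v x) $ 4 = x $ 3"
  by (simp_all add: cx_mat_def Jmat_def matrix_vector_mult_def map_matrix_def sum_4 transpose_def axis_def)

lemma Lmat_nth:
  "(cx_mat Lmat *v x) $ 1 = - x $ 3" "(cx_mat Lmat *v x) $ 2 = x $ 4"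
  "(cx_mat Lmat *v x) $ 3 = x $ 1" "(cx_mat Lmat *v x) $ 4 = - x $ 2"
  by (simp_all add: cx_mat_def Lmat_def matrix_vector_mult_def map_matrix_def sum_4 transpose_def axis_def)

lemma coord_J: "coord k (cx_mat Jmat *v x) = \<i> * of_real (Jsign k) * coord k x"
proof -
  have "\<forall>k. coord k (cx_mat Jmat *v x) = \<i> * of_real (Jsign k) * coord k x"
    unfolding forall_4 by (simp add: coord_simps Jmat_nth algebra_simps)
  thus ?thesis by blast
qed

lemma coord_L:
  "coord 1 (cx_mat Lmat *v x) = - coord 4 x" "coord 2 (cx_mat Lmat *v x) = coord 3 x"
  "coord 3 (cx_mat Lmat *v x) = - coord 2 x" "coord 4 (cx_mat Lmat *v x) = coord 1 x"
  by (simp_all add: coord_simps Lmat_nth field_simps)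

lemma L_v1: "cx_mat Lmat *v v_basis 1 = v_basis 4"
  unfolding coord_eq_iff by (simp add: coord_L coord_v_basis)

subsection \<open>Rotations generated by \<open>J\<close>\<close>

lemma J_squared: "Jmat ** Jmat = - Finite_Cartesian_Product.mat 1"
  unfolding Finite_Cartesian_Product.vec_eq_iff forall_4
  by (simp add: Jmat_def matrix_matrix_mult_def sum_4 transpose_def axis_def Finite_Cartesian_Product.mat_def)

lemma cx_mat_scaled:
  "cx_mat (a *\<^sub>R A + b *\<^sub>R B) *v x = of_real a *s (cx_mat A *v x) + of_real b *s (cx_mat B *v x)"
  by (simp add: cx_mat_def map_matrix_def matrix_vector_mult_def Finite_Cartesian_Product.vec_eq_iff sum_distrib_left
      sum.distrib algebra_simps)

lemma cx_mat_one: "cx_mat (Finite_Cartesian_Product.mat 1) *v x = x"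
proof -
  have "cx_mat (Finite_Cartesian_Product.mat 1) = Finite_Cartesian_Product.mat 1"
    by (simp add: cx_mat_def map_matrix_def Finite_Cartesian_Product.mat_def Finite_Cartesian_Product.vec_eq_iff)
  thus ?thesis by simp
qed

lemma mult_scaleR_right: "(A :: real^4^4) ** (r *\<^sub>R B) = r *\<^sub>R (A ** B)"
  by (simp add: matrix_matrix_mult_def Finite_Cartesian_Product.vec_eq_iff sum_distrib_left mult_ac)

text \<open>
  Since \<open>J\<^sup>2 = -1\<close>, the terms of the exponential series are the Taylor terms of cosine and sine.
\<close>

lemma mat_exp_J: "mat_exp (\<theta> *\<^sub>R Jmat) = cos \<theta> *\<^sub>R Finite_Cartesian_Product.mat 1 + sin \<theta> *\<^sub>R Jmat"
proof -
  have pw: "(1 / fact n) *\<^sub>R (((**) (\<theta> *\<^sub>R Jmat) ^^ n) (Finite_Cartesian_Product.mat 1))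
      = (cos_coeff n * \<theta> ^ n) *\<^sub>R Finite_Cartesian_Product.mat 1 + (sin_coeff n * \<theta> ^ n) *\<^sub>R Jmat" for n
  proof (induction n)
    case 0 show ?case by simp
  next
    case (Suc n)
    have step: "(\<theta> *\<^sub>R Jmat) ** (a *\<^sub>R Finite_Cartesian_Product.mat 1 + b *\<^sub>R Jmat)
        = (- \<theta> * b) *\<^sub>R Finite_Cartesian_Product.mat 1 + (\<theta> * a) *\<^sub>R Jmat" for a b
    proof -
      have "(\<theta> *\<^sub>R Jmat) ** (a *\<^sub>R Finite_Cartesian_Product.mat 1 + b *\<^sub>R Jmat)
        = (\<theta> * a) *\<^sub>R Jmat + (\<theta> * b) *\<^sub>R (Jmat ** Jmat)"
        by (simp add: matrix_add_ldistrib scalar_matrix_assoc matrix_scalar_ac scalar_mult_eq_scaleR[symmetric] mult.commute)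
      thus ?thesis by (simp add: J_squared)
    qed
    let ?M = "((**) (\<theta> *\<^sub>R Jmat) ^^ n) (Finite_Cartesian_Product.mat 1)"
    have "(1 / fact (Suc n)) *\<^sub>R (((**) (\<theta> *\<^sub>R Jmat) ^^ Suc n) (Finite_Cartesian_Product.mat 1))
       = (1 / real (Suc n)) *\<^sub>R ((\<theta> *\<^sub>R Jmat) ** ((1 / fact n) *\<^sub>R ?M))"
      unfolding mult_scaleR_right by simp
    also have "\<dots> = (1 / real (Suc n)) *\<^sub>R ((- \<theta> * (sin_coeff n * \<theta> ^ n)) *\<^sub>R Finite_Cartesian_Product.mat 1
        + (\<theta> * (cos_coeff n * \<theta> ^ n)) *\<^sub>R Jmat)"
      unfolding Suc step ..
    also have "\<dots> = (cos_coeff (Suc n) * \<theta> ^ Suc n) *\<^sub>R Finite_Cartesian_Product.mat 1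
        + (sin_coeff (Suc n) * \<theta> ^ Suc n) *\<^sub>R Jmat"
      unfolding cos_coeff_Suc sin_coeff_Suc by (simp add: scaleR_add_right scaleR_diff_right mult_ac)
    finally show ?case .
  qed
  have "(\<lambda>n. (cos_coeff n * \<theta> ^ n) *\<^sub>R Finite_Cartesian_Product.mat 1 + (sin_coeff n * \<theta> ^ n) *\<^sub>R Jmat)
      sums (cos \<theta> *\<^sub>R Finite_Cartesian_Product.mat 1 + sin \<theta> *\<^sub>R Jmat)"
    using cos_converges[of \<theta>] sin_converges[of \<theta>]
    by (intro sums_add sums_scaleR_left) simp_all
  thus ?thesis unfolding mat_exp_def pw by (rule sums_unique[symmetric])
qed

text \<open>
  In these coordinates the gauge transformation \<open>e\<^sup>\<theta>\<^sup>J\<close> is multiplication by \<open>e\<^sup>\<plusminus>\<^sup>\<i>\<^sup>\<theta>\<close>; this is what turns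
  the HSL equation into scalar equations.
\<close>

lemma coord_mat_exp: "coord k (cx_mat (mat_exp (\<theta> *\<^sub>R Jmat)) *v x) = cis (Jsign k * \<theta>) * coord k x"
proof -
  have "coord k (cx_mat (mat_exp (\<theta> *\<^sub>R Jmat)) *v x)
     = (of_real (cos \<theta>) + of_real (sin \<theta>) * \<i> * of_real (Jsign k)) * coord k x"
    by (simp add: mat_exp_J cx_mat_scaled cx_mat_one coord_add coord_scale coord_J algebra_simps)
  also have "of_real (cos \<theta>) + of_real (sin \<theta>) * \<i> * of_real (Jsign k) = cis (Jsign k * \<theta>)"
    by (simp add: Jsign_def complex_eq_iff)
  finally show ?thesis .
qed

subsection \<open>The real vector with given first and fourth coordinates\<close>

definition real_point :: "complex \<Rightarrow> complex \<Rightarrow> real^4" where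
  "real_point p q = 2 *\<^sub>R Re_vec (p *s v_basis 1 + q *s v_basis 4)"

lemma coord_real_point:
  "coord 1 (cx_vec (real_point p q)) = p" "coord 4 (cx_vec (real_point p q)) = q"
proof -
  have s2: "sqrt 2 * sqrt 2 = 2" by simp
  have n: "real_point p q $ 1 = sqrt 2 * Re p" "real_point p q $ 2 = sqrt 2 * Im p"
      "real_point p q $ 3 = sqrt 2 * Re q" "real_point p q $ 4 = - sqrt 2 * Im q"
    by (simp_all add: real_point_def Re_vec_def v_basis_simps axis_def Re_divide_of_real Im_divide_of_real real_div_sqrt field_simps)
  show "coord 1 (cx_vec (real_point p q)) = p" "coord 4 (cx_vec (real_point p q)) = q"
    by (simp_all add: coord_simps cx_vec_def n complex_eq_iff Re_divide_of_real Im_divide_of_real)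
qed

text \<open>
  A real vector has conjugate coordinates along \<open>v\<^sub>1, v\<^sub>3\<close> and along \<open>v\<^sub>4, v\<^sub>2\<close>, so two of them suffice.
\<close>

lemma real_point_coord: "real_point (coord 1 (cx_vec x)) (coord 4 (cx_vec x)) = x"
proof -
  have "cx_vec (real_point (coord 1 (cx_vec x)) (coord 4 (cx_vec x))) = cx_vec x"
    unfolding coord_eq_iff by (simp add: coord_real_point coord_cx_vec_cnj)
  thus ?thesis by (simp add: cx_vec_def Finite_Cartesian_Product.vec_eq_iff)
qed

lemma real_point_eqI:
  "coord 1 (cx_vec x) = p \<Longrightarrow> coord 4 (cx_vec x) = q \<Longrightarrow> x = real_point p q"
  using real_point_coord by metis

lemma bounded_linear_real_point: "bounded_linear (\<lambda>(p, q). real_point p q)"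
  by (rule linear_conv_bounded_linear[THEN iffD1], rule linearI)
     (auto simp: real_point_def Re_vec_def Finite_Cartesian_Product.vec_eq_iff algebra_simps)

lemma real_point_zero [simp]: "real_point 0 0 = 0"
  by (simp add: real_point_def Re_vec_def Finite_Cartesian_Product.vec_eq_iff)

lemma bounded_linear_cx_vec: "bounded_linear cx_vec"
  by (rule linear_conv_bounded_linear[THEN iffD1], rule linearI)
     (auto simp: cx_vec_def Finite_Cartesian_Product.vec_eq_iff complex_eq_iff)

section \<open>Exponentials, smoothness and Wirtinger derivatives\<close>

lemma e_fun_cis: "e_fun \<gamma> z = cis (2 * pi * (\<gamma> \<bullet> z))"
  by (simp add: e_fun_def cis_conv_exp mult_ac)

lemma e_fun_zero [simp]: "e_fun 0 z = 1" "e_fun \<gamma> 0 = 1"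
  by (simp_all add: e_fun_cis)

lemma e_fun_add_left: "e_fun (\<gamma> + \<delta>) z = e_fun \<gamma> z * e_fun \<delta> z"
  by (simp add: e_fun_cis cis_mult inner_add_left ring_distribs)

lemma e_fun_diff_left: "e_fun (\<gamma> - \<delta>) z = e_fun \<gamma> z * e_fun (- \<delta>) z"
  using e_fun_add_left[of \<gamma> "- \<delta>"] by simp

lemma e_fun_add_right: "e_fun \<gamma> (z + w) = e_fun \<gamma> z * e_fun \<gamma> w"
  by (simp add: e_fun_cis cis_mult inner_add_right ring_distribs)

lemma e_fun_minus: "e_fun (- \<gamma>) z = cnj (e_fun \<gamma> z)"
  by (simp add: e_fun_cis cis_cnj)

lemma e_fun_nonzero [simp]: "e_fun \<gamma> z \<noteq> 0"
  by (simp add: e_fun_cis)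

lemma e_fun_cancel [simp]: "e_fun \<gamma> z * e_fun (- \<gamma>) z = 1" "e_fun (- \<gamma>) z * e_fun \<gamma> z = 1"
  using e_fun_add_left[of \<gamma> "- \<gamma>" z] by (simp_all add: mult.commute)

lemma e_fun_integral: "\<gamma> \<bullet> w \<in> \<int> \<Longrightarrow> e_fun \<gamma> w = 1"
  by (auto simp: e_fun_cis elim!: Ints_cases)

lemma has_derivative_e_fun:
  "(e_fun \<gamma> has_derivative (\<lambda>w. (2 * of_real pi * \<i> * of_real (\<gamma> \<bullet> w)) * e_fun \<gamma> z)) (at z)"
proof -
  have "((\<lambda>z. exp (2 * of_real pi * \<i> * of_real (\<gamma> \<bullet> z))) has_derivative
      (\<lambda>w. (2 * of_real pi * \<i> * of_real (\<gamma> \<bullet> w)) * exp (2 * of_real pi * \<i> * of_real (\<gamma> \<bullet> z)))) (at z)"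
  proof -
    have 1: "((\<lambda>z. 2 * of_real pi * \<i> * of_real (\<gamma> \<bullet> z)) has_derivative
        (\<lambda>w. 2 * of_real pi * \<i> * complex_of_real (\<gamma> \<bullet> w))) (at z)"
      by (intro bounded_linear.has_derivative[OF bounded_linear_mult_right] has_derivative_of_real
          has_derivative_inner_right has_derivative_ident)
    have 2: "(exp has_derivative (\<lambda>w. exp x * w)) (at x)" for x :: complex
      using DERIV_exp[of x] unfolding has_field_derivative_def .
    show ?thesis using has_derivative_compose[OF 1 2] by (simp add: mult.commute)
  qed
  thus ?thesis by (simp add: e_fun_def[abs_def])
qed

lemma continuous_e_fun [continuous_intros]: "continuous_on S g \<Longrightarrow> continuous_on S (\<lambda>x. e_fun \<gamma> (g x))"
  unfolding e_fun_cis by (intro continuous_intros)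

lemma inner_wirtinger:
  "2 * of_real (\<gamma> \<bullet> w) = \<gamma> * cnj w + cnj \<gamma> * w" for \<gamma> w :: complex
  by (simp add: complex_eq_iff inner_complex_def algebra_simps)

subsection \<open>Smoothness\<close>

lemma k_smooth_differentiable: "k_smooth (Suc k) f \<Longrightarrow> f differentiable at x"
  by simp

lemma smooth_has_derivative:
  "smooth f \<Longrightarrow> (f has_derivative frechet_derivative f (at x)) (at x)"
  unfolding smooth_def frechet_derivative_works[symmetric] by (rule k_smooth_differentiable[of 0]) simp

lemma smooth_continuous: "smooth f \<Longrightarrow> continuous_on UNIV f"
  unfolding smooth_def k_smooth.simps(1)[symmetric] by (rule spec)

lemma smooth_continuous_derivative:
  assumes "smooth f"
  shows "continuous_on UNIV (\<lambda>x. frechet_derivative f (at x) w)"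
proof -
  have "k_smooth (Suc 0) f" using assms unfolding smooth_def by blast
  thus ?thesis by simp
qed

lemma k_smooth_const: "k_smooth k (\<lambda>x. c)"
  by (induction k arbitrary: c) simp_all

lemma k_smooth_add: "k_smooth k f \<Longrightarrow> k_smooth k g \<Longrightarrow> k_smooth k (\<lambda>x. f x + g x)"
proof (induction k arbitrary: f g)
  case 0 thus ?case by (simp add: continuous_on_add)
next
  case (Suc k)
  have d: "f differentiable at x" "g differentiable at x" for x using Suc.prems by simp_all
  have D: "frechet_derivative (\<lambda>x. f x + g x) (at x) w = frechet_derivative f (at x) w + frechet_derivative g (at x) w"
    for x w
    using frechet_derivative_at[OF has_derivative_add[OF d[unfolded frechet_derivative_works]], symmetric] by simp
  show ?case unfolding k_smooth.simps D using Suc.prems by (intro conjI allI differentiable_add Suc.IH d) simp_all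
qed

lemma differentiable_linear_image:
  assumes "bounded_linear T" "g differentiable at x"
  shows "(\<lambda>x. T (g x)) differentiable at x"
proof -
  obtain D where "(g has_derivative D) (at x)" using assms(2) unfolding differentiable_def ..
  from bounded_linear.has_derivative[OF assms(1) this] show ?thesis unfolding differentiable_def by blast
qed

lemma frechet_derivative_linear_image:
  assumes "bounded_linear T" "g differentiable at x"
  shows "frechet_derivative (\<lambda>x. T (g x)) (at x) w = T (frechet_derivative g (at x) w)"
proof -
  have "((\<lambda>x. T (g x)) has_derivative (\<lambda>w. T (frechet_derivative g (at x) w))) (at x)"
    by (rule bounded_linear.has_derivative[OF assms(1) assms(2)[unfolded frechet_derivative_works]])
  from frechet_derivative_at[OF this, symmetric] show ?thesis by simp
qed

text \<open>
  Used for the coordinate maps, and for exponentials, whose directional derivatives are constant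
  multiples of themselves.
\<close>

lemma k_smooth_linear_image:
  "bounded_linear T \<Longrightarrow> k_smooth k f \<Longrightarrow> k_smooth k (\<lambda>x. T (f x))"
proof (induction k arbitrary: f)
  case 0 thus ?case
    using bounded_linear.continuous_on[OF 0(1), of UNIV f] unfolding k_smooth.simps by blast
next
  case (Suc k)
  have d: "f differentiable at x" for x using Suc.prems by simp
  have "(\<lambda>x. T (f x)) differentiable at x" for x
    by (rule differentiable_linear_image[OF Suc.prems(1) d])
  moreover have "k_smooth k (\<lambda>x. frechet_derivative (\<lambda>x. T (f x)) (at x) w)" for w
    unfolding frechet_derivative_linear_image[OF Suc.prems(1) d]
    using Suc.prems(2) by (intro Suc.IH[OF Suc.prems(1)]) simp
  ultimately show ?case unfolding k_smooth.simps by blast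
qed

lemma k_smooth_e_fun: "k_smooth k (e_fun \<gamma>)"
proof (induction k)
  case 0 show ?case by (simp add: continuous_e_fun)
next
  case (Suc k)
  have D: "frechet_derivative (e_fun \<gamma>) (at z) = (\<lambda>w. (2 * of_real pi * \<i> * of_real (\<gamma> \<bullet> w)) * e_fun \<gamma> z)" for z
    by (rule frechet_derivative_at[OF has_derivative_e_fun, symmetric])
  have d: "e_fun \<gamma> differentiable at z" for z
    using has_derivative_e_fun unfolding differentiable_def by blast
  have "k_smooth k (\<lambda>z. c * e_fun \<gamma> z)" for c
    by (rule k_smooth_linear_image[OF bounded_linear_mult_right Suc])
  thus ?case unfolding k_smooth.simps D using d by blast
qed

lemma smooth_const: "smooth (\<lambda>x. c)"
  unfolding smooth_def by (intro allI k_smooth_const)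

lemma smooth_add: "smooth f \<Longrightarrow> smooth g \<Longrightarrow> smooth (\<lambda>x. f x + g x)"
  unfolding smooth_def by (simp add: k_smooth_add)

lemma smooth_linear_image:
  assumes "bounded_linear T" "smooth f"
  shows "smooth (\<lambda>x. T (f x))"
  using assms(2) k_smooth_linear_image[OF assms(1)] unfolding smooth_def by blast

lemma smooth_e_fun: "smooth (e_fun \<gamma>)"
  unfolding smooth_def by (intro allI k_smooth_e_fun)

lemma smooth_sum: "(\<And>i. i \<in> S \<Longrightarrow> smooth (g i)) \<Longrightarrow> smooth (\<lambda>x. \<Sum>i\<in>S. g i x)"
  by (induction S rule: infinite_finite_induct) (simp_all add: smooth_const smooth_add)

lemma smooth_e_fun_scaled: "smooth (\<lambda>z. c * e_fun \<gamma> z)"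
  by (rule smooth_linear_image[OF bounded_linear_mult_right smooth_e_fun])

lemma smooth_Pair:
  assumes "smooth f" "smooth g"
  shows "smooth (\<lambda>x. (f x, g x))"
proof -
  have "smooth (\<lambda>x. (f x, 0) + (0, g x))"
    by (intro smooth_add smooth_linear_image[OF _ assms(1), where T = "\<lambda>u. (u, 0)"]
        smooth_linear_image[OF _ assms(2), where T = "\<lambda>u. (0, u)"] bounded_linear_intros)
  thus ?thesis by simp
qed

subsection \<open>Wirtinger derivatives of scalar functions\<close>

definition dz :: "(complex \<Rightarrow> complex) \<Rightarrow> complex \<Rightarrow> complex" where
  "dz g z = (1/2) * (frechet_derivative g (at z) 1 - \<i> * frechet_derivative g (at z) \<i>)"

definition dzbar :: "(complex \<Rightarrow> complex) \<Rightarrow> complex \<Rightarrow> complex" where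
  "dzbar g z = (1/2) * (frechet_derivative g (at z) 1 + \<i> * frechet_derivative g (at z) \<i>)"

lemma has_derivative_wirtinger:
  assumes "(g has_derivative (\<lambda>w. p * w + q * cnj w)) (at z)"
  shows "dz g z = p" "dzbar g z = q"
proof -
  have D: "frechet_derivative g (at z) = (\<lambda>w. p * w + q * cnj w)"
    using frechet_derivative_at[OF assms] by simp
  show "dz g z = p" "dzbar g z = q"
    unfolding dz_def dzbar_def D by (simp_all add: algebra_simps)
qed

lemma dz_cnj:
  assumes "g differentiable at z"
  shows "dz (\<lambda>z. cnj (g z)) z = cnj (dzbar g z)" "dzbar (\<lambda>z. cnj (g z)) z = cnj (dz g z)"
  unfolding dz_def dzbar_def frechet_derivative_linear_image[OF bounded_linear_cnj assms] by simp_all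

text \<open>
  The form of the derivative displays the Wirtinger derivatives: \<open>e\<^sub>\<delta>\<close> is an eigenfunction with
  eigenvalues \<open>\<pi> \<i> \<delta>\<^sup>*\<close> (conjugate) and \<open>\<pi> \<i> \<delta>\<close>.
\<close>

lemma e_fun_sum_has_derivative:
  assumes "finite S"
  shows "((\<lambda>z. \<Sum>i\<in>S. c i * (e_fun (\<delta> i) z - d i)) has_derivative
     (\<lambda>w. (\<Sum>i\<in>S. c i * (of_real pi * \<i> * cnj (\<delta> i)) * e_fun (\<delta> i) z) * w
        + (\<Sum>i\<in>S. c i * (of_real pi * \<i> * \<delta> i) * e_fun (\<delta> i) z) * cnj w)) (at z)"
proof -
  have *: "((\<lambda>z. \<Sum>i\<in>S. c i * (e_fun (\<delta> i) z - d i)) has_derivative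
     (\<lambda>w. \<Sum>i\<in>S. c i * ((2 * of_real pi * \<i> * of_real (\<delta> i \<bullet> w)) * e_fun (\<delta> i) z - 0))) (at z)"
    by (intro has_derivative_sum has_derivative_mult_right has_derivative_diff has_derivative_e_fun
        has_derivative_const)
  have "c i * ((2 * of_real pi * \<i> * of_real (\<delta> i \<bullet> w)) * e_fun (\<delta> i) z - 0) =
     (c i * (of_real pi * \<i> * cnj (\<delta> i)) * e_fun (\<delta> i) z) * w
        + (c i * (of_real pi * \<i> * \<delta> i) * e_fun (\<delta> i) z) * cnj w" for i w
  proof -
    have "c i * ((2 * of_real pi * \<i> * of_real (\<delta> i \<bullet> w)) * e_fun (\<delta> i) z - 0)
      = c i * of_real pi * \<i> * e_fun (\<delta> i) z * (2 * of_real (\<delta> i \<bullet> w))" by simp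
    thus ?thesis unfolding inner_wirtinger by (simp add: algebra_simps)
  qed
  with * show ?thesis by (simp add: sum.distrib sum_distrib_right)
qed

subsection \<open>The HSL equation in coordinates\<close>

text \<open>
  The coordinates along \<open>v\<^sub>1\<close> and \<open>v\<^sub>4\<close> are chosen, rather than those along \<open>v\<^sub>1\<close> and \<open>v\<^sub>2\<close>, because \<open>L\<close> exchanges
  the lines of \<open>v\<^sub>1\<close> and \<open>v\<^sub>4\<close> and \<open>T\<^sub>0\<close> acts on both by the same scalar.
\<close>

definition F1 :: "(complex \<Rightarrow> real^4) \<Rightarrow> complex \<Rightarrow> complex" where
  "F1 f z = coord 1 (cx_vec (f z))"

definition F4 :: "(complex \<Rightarrow> real^4) \<Rightarrow> complex \<Rightarrow> complex" where
  "F4 f z = coord 4 (cx_vec (f z))"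

lemma F1_F4_determine: "f = f' \<longleftrightarrow> F1 f = F1 f' \<and> F4 f = F4 f'"
proof
  assume "F1 f = F1 f' \<and> F4 f = F4 f'"
  thus "f = f'" unfolding F1_def F4_def by (metis ext real_point_coord)
qed simp

lemma F1_F4_real_point [simp]:
  "F1 (\<lambda>z. real_point (p z) (q z)) = p" "F4 (\<lambda>z. real_point (p z) (q z)) = q"
  by (simp_all add: F1_def F4_def coord_real_point fun_eq_iff)

lemma F_differentiable:
  assumes "f differentiable at z"
  shows "F1 f differentiable at z" "F4 f differentiable at z"
  unfolding F1_def[abs_def] F4_def[abs_def]
  by (intro differentiable_linear_image[OF bounded_linear_compose[OF bounded_linear_coord bounded_linear_cx_vec] assms])+

lemma F_smooth: "smooth f \<Longrightarrow> smooth (F1 f)" "smooth f \<Longrightarrow> smooth (F4 f)"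
  unfolding F1_def[abs_def] F4_def[abs_def]
  by (rule smooth_linear_image[OF bounded_linear_compose[OF bounded_linear_coord bounded_linear_cx_vec]], assumption)+

lemma coord_f_z_general:
  assumes "f differentiable at z"
  shows "coord k (f_z f z) = dz (\<lambda>z. coord k (cx_vec (f z))) z"
    "coord k (f_zbar f z) = dzbar (\<lambda>z. coord k (cx_vec (f z))) z"
proof -
  have d: "(\<lambda>z. cx_vec (f z)) differentiable at z"
    by (rule differentiable_linear_image[OF bounded_linear_cx_vec assms])
  note * = frechet_derivative_linear_image[OF bounded_linear_coord d]
  show "coord k (f_z f z) = dz (\<lambda>z. coord k (cx_vec (f z))) z"
    "coord k (f_zbar f z) = dzbar (\<lambda>z. coord k (cx_vec (f z))) z"
    unfolding f_z_def d_z_def f_zbar_def d_zbar_def dz_def dzbar_def *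
    by (simp_all add: coord_scale coord_diff coord_add)
qed

lemma coord_f_z:
  assumes "f differentiable at z"
  shows "coord 1 (f_z f z) = dz (F1 f) z" "coord 4 (f_z f z) = dz (F4 f) z"
    "coord 3 (f_z f z) = cnj (dzbar (F1 f) z)" "coord 2 (f_z f z) = cnj (dzbar (F4 f) z)"
    "coord 1 (f_zbar f z) = dzbar (F1 f) z" "coord 4 (f_zbar f z) = dzbar (F4 f) z"
    "coord 3 (f_zbar f z) = cnj (dz (F1 f) z)" "coord 2 (f_zbar f z) = cnj (dz (F4 f) z)"
  using F_differentiable[OF assms]
  by (simp_all add: coord_f_z_general[OF assms] coord_cx_vec_cnj F1_def[symmetric, abs_def]
      F4_def[symmetric, abs_def] dz_cnj)

lemma cis_beta: "cis (beta \<beta>0 z) = e_fun \<beta>0 z" "cis (- beta \<beta>0 z) = e_fun (- \<beta>0) z"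
  "cis (beta \<beta>0 z / 2) = e_fun (\<beta>0 / 2) z" "cis (- (beta \<beta>0 z / 2)) = e_fun (- (\<beta>0 / 2)) z"
proof -
  have h: "(\<beta>0 / 2) \<bullet> z = (\<beta>0 \<bullet> z) / 2"
    by (simp add: inner_complex_def add_divide_distrib)
  show "cis (beta \<beta>0 z) = e_fun \<beta>0 z" "cis (- beta \<beta>0 z) = e_fun (- \<beta>0) z"
    "cis (beta \<beta>0 z / 2) = e_fun (\<beta>0 / 2) z" "cis (- (beta \<beta>0 z / 2)) = e_fun (- (\<beta>0 / 2)) z"
    by (simp_all add: e_fun_cis beta_def h)
qed

text \<open>
  Of the four coordinate equations, those for \<open>v\<^sub>1\<close> and \<open>v\<^sub>4\<close> are equivalent to each other, and so are those
  for \<open>v\<^sub>2\<close> and \<open>v\<^sub>3\<close>: \<open>e\<^sup>J\<^sup>\<beta> L\<close> squares to \<open>-1\<close>. The second pair is conjugated to obtain \<open>dzbar\<close>.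
\<close>

lemma HSL_equation_coords:
  assumes "f differentiable at z"
  shows "cx_mat (mat_exp (beta \<beta>0 z *\<^sub>R Jmat)) *v (cx_mat Lmat *v f_z f z) = \<i> *s f_z f z
     \<longleftrightarrow> dz (F4 f) z = - \<i> * e_fun (- \<beta>0) z * dz (F1 f) z
       \<and> dzbar (F4 f) z = \<i> * e_fun (- \<beta>0) z * dzbar (F1 f) z"
proof -
  define g1 where g1: "g1 = dz (F1 f) z"
  define g4 where g4: "g4 = dz (F4 f) z"
  define g3 where g3: "g3 = cnj (dzbar (F1 f) z)"
  define g2 where g2: "g2 = cnj (dzbar (F4 f) z)"
  note g = g1 g4 g3 g2
  define e where "e = e_fun \<beta>0 z"
  have e: "e_fun (- \<beta>0) z = cnj e" "e * cnj e = 1" "cnj e * e = 1"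
    using e_fun_cancel[of \<beta>0 z] by (simp_all add: e_def e_fun_minus)
  have R: "dzbar (F1 f) z = cnj g3" "dzbar (F4 f) z = cnj g2" by (simp_all add: g)
  have "cx_mat (mat_exp (beta \<beta>0 z *\<^sub>R Jmat)) *v (cx_mat Lmat *v f_z f z) = \<i> *s f_z f z
     \<longleftrightarrow> e * (- g4) = \<i> * g1 \<and> e * g3 = \<i> * g2 \<and> cnj e * (- g2) = \<i> * g3 \<and> cnj e * g1 = \<i> * g4"
    unfolding coord_eq_iff
    by (simp add: coord_mat_exp coord_L coord_scale coord_f_z[OF assms] cis_beta g e_def[symmetric] e)
  also have "\<dots> \<longleftrightarrow> g4 = - \<i> * cnj e * g1 \<and> g2 = - \<i> * e * g3"
  proof -
    have a: "e * (- g4) = \<i> * g1 \<longleftrightarrow> g4 = - \<i> * cnj e * g1"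
    proof
      assume "e * (- g4) = \<i> * g1"
      hence "cnj e * (e * (- g4)) = cnj e * (\<i> * g1)" by simp
      hence "- g4 = cnj e * (\<i> * g1)" using e by (simp add: mult.assoc[symmetric])
      hence "g4 = - (cnj e * (\<i> * g1))" by (metis minus_minus)
      thus "g4 = - \<i> * cnj e * g1" by (simp add: mult_ac)
    next
      assume "g4 = - \<i> * cnj e * g1"
      hence "e * (- g4) = (e * cnj e) * (\<i> * g1)" by simp
      thus "e * (- g4) = \<i> * g1" using e by simp
    qed
    have i: "x = \<i> * y \<longleftrightarrow> y = - \<i> * x" for x y :: complex by (auto simp: complex_eq_iff)
    have b: "cnj e * g1 = \<i> * g4 \<longleftrightarrow> g4 = - \<i> * cnj e * g1" by (subst i) (simp add: mult.assoc)
    have c: "e * g3 = \<i> * g2 \<longleftrightarrow> g2 = - \<i> * e * g3" by (subst i) (simp add: mult.assoc)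
    have d: "cnj e * (- g2) = \<i> * g3 \<longleftrightarrow> g2 = - \<i> * e * g3"
    proof
      assume "cnj e * (- g2) = \<i> * g3"
      hence "e * (cnj e * (- g2)) = e * (\<i> * g3)" by simp
      hence "- g2 = e * (\<i> * g3)" using e by (simp add: mult.assoc[symmetric])
      hence "g2 = - (e * (\<i> * g3))" by (metis minus_minus)
      thus "g2 = - \<i> * e * g3" by (simp add: mult_ac)
    next
      assume "g2 = - \<i> * e * g3"
      hence "cnj e * (- g2) = (cnj e * e) * (\<i> * g3)" by simp
      thus "cnj e * (- g2) = \<i> * g3" using e by simp
    qed
    show ?thesis using a b c d by blast
  qed
  also have "g2 = - \<i> * e * g3 \<longleftrightarrow> cnj g2 = \<i> * cnj e * cnj g3"
    by (metis (no_types, lifting) complex_cnj_cnj complex_cnj_mult complex_cnj_minus complex_cnj_i minus_minus)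
  finally show ?thesis unfolding R e by (simp add: g(1,2)[symmetric])
qed

lemma coord_gauged:
  assumes "f differentiable at z"
  shows "coord 1 (gauged_f_z \<beta>0 f z) = e_fun (- (\<beta>0 / 2)) z * dz (F1 f) z"
    "coord 2 (gauged_f_z \<beta>0 f z) = e_fun (- (\<beta>0 / 2)) z * cnj (dzbar (F4 f) z)"
    "coord 3 (gauged_f_z \<beta>0 f z) = e_fun (\<beta>0 / 2) z * cnj (dzbar (F1 f) z)"
    "coord 4 (gauged_f_z \<beta>0 f z) = e_fun (\<beta>0 / 2) z * dz (F4 f) z"
    "coord 1 (gauged_f_zbar \<beta>0 f z) = e_fun (- (\<beta>0 / 2)) z * dzbar (F1 f) z"
    "coord 2 (gauged_f_zbar \<beta>0 f z) = e_fun (- (\<beta>0 / 2)) z * cnj (dz (F4 f) z)"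
    "coord 3 (gauged_f_zbar \<beta>0 f z) = e_fun (\<beta>0 / 2) z * cnj (dz (F1 f) z)"
    "coord 4 (gauged_f_zbar \<beta>0 f z) = e_fun (\<beta>0 / 2) z * dzbar (F4 f) z"
  unfolding gauged_f_z_def gauged_f_zbar_def coord_mat_exp coord_f_z[OF assms]
  by (simp_all add: cis_beta)

section \<open>Fourier coefficients on the unit square\<close>

abbreviation unit_square :: "(real \<times> real) set" where
  "unit_square \<equiv> cbox (0, 0) (1, 1)"

definition char2 :: "int \<Rightarrow> int \<Rightarrow> real \<times> real \<Rightarrow> complex" where
  "char2 m n p = cis (2 * pi * (of_int m * fst p + of_int n * snd p))"

lemma continuous_char2 [continuous_intros]: "continuous_on S (char2 m n)"
  unfolding char2_def[abs_def] by (intro continuous_intros)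

lemma char2_mult: "char2 m n p * char2 m' n' p = char2 (m + m') (n + n') p"
  by (simp add: char2_def cis_mult algebra_simps)

lemma char2_0 [simp]: "char2 0 0 p = 1"
  by (simp add: char2_def)

lemma periodic_of_int:
  fixes h :: "real \<Rightarrow> 'a"
  assumes "\<And>x. h (x + 1) = h x"
  shows "h (x + of_int n) = h x"
proof (induction n arbitrary: x rule: int_induct[where k = 0])
  case (step1 i)
  show ?case using step1(2)[of x] assms[of "x + of_int i"] by (simp add: algebra_simps)
next
  case (step2 i)
  show ?case using step2(2)[of x] assms[of "x + of_int (i - 1)"] by (simp add: algebra_simps)
qed simp

text \<open>
  The annihilator of all characters; the sign of the frequency is immaterial because it runs through all
  of \<open>\<int>\<^sup>2\<close>.
\<close>

definition fourier_null :: "(real \<times> real \<Rightarrow> complex) \<Rightarrow> bool" where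
  "fourier_null g \<longleftrightarrow> continuous_on UNIV g \<and> (\<forall>m n. integral unit_square (\<lambda>p. char2 m n p * g p) = 0)"

lemma integrable_on_square: "continuous_on UNIV g \<Longrightarrow> g integrable_on unit_square"
  for g :: "real \<times> real \<Rightarrow> 'b::banach"
  by (rule integrable_continuous) (rule continuous_on_subset, auto)

lemma fourier_null_add: "fourier_null g \<Longrightarrow> fourier_null h \<Longrightarrow> fourier_null (\<lambda>p. g p + h p)"
  unfolding fourier_null_def
  by (auto simp: distrib_left intro!: continuous_intros)
     (subst integral_add, auto intro!: integrable_on_square continuous_intros)

lemma fourier_null_scale: "fourier_null g \<Longrightarrow> fourier_null (\<lambda>p. c * g p)"
  unfolding fourier_null_def by (auto simp: mult.left_commute[of _ c] intro!: continuous_intros)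

lemma fourier_null_char2: "fourier_null g \<Longrightarrow> fourier_null (\<lambda>p. char2 m n p * g p)"
  unfolding fourier_null_def
  by (auto simp: mult.assoc[symmetric] char2_mult intro!: continuous_intros)

text \<open>
  Periodic functions cannot separate opposite edges of the square, so the approximation theorem is
  applied to the image of this map, the torus in \<open>\<complex> \<times> \<complex>\<close>.
\<close>

definition torus_map :: "real \<times> real \<Rightarrow> complex \<times> complex" where
  "torus_map p = (cis (2 * pi * fst p), cis (2 * pi * snd p))"

lemma continuous_torus_map: "continuous_on S torus_map"
  unfolding torus_map_def[abs_def] by (intro continuous_intros)

text \<open>
  The continuous functions that preserve the annihilator of all characters form an algebra, so it
  suffices to see that this algebra contains the coordinate functions.
\<close>

lemma fourier_null_polynomial:
  assumes "real_polynomial_function r" "fourier_null g"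
  shows "fourier_null (\<lambda>p. of_real (r (torus_map p)) * g p)"
  using assms
proof (induction r arbitrary: g rule: real_polynomial_function.induct)
  case (linear f)
  interpret bounded_linear f by fact
  have f_eq: "f (torus_map p) = cos (2 * pi * fst p) * f (1, 0) + sin (2 * pi * fst p) * f (\<i>, 0)
     + cos (2 * pi * snd p) * f (0, 1) + sin (2 * pi * snd p) * f (0, \<i>)" for p
  proof -
    have "torus_map p = cos (2 * pi * fst p) *\<^sub>R (1, 0) + sin (2 * pi * fst p) *\<^sub>R (\<i>, 0)
       + cos (2 * pi * snd p) *\<^sub>R (0, 1) + sin (2 * pi * snd p) *\<^sub>R (0, \<i>)"
      by (simp add: torus_map_def complex_eq_iff)
    thus ?thesis by (simp only: add scaleR real_scaleR_def)
  qed
  have trig: "of_real (cos (2 * pi * fst p)) = (1/2) * char2 1 0 p + (1/2) * char2 (-1) 0 p"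
    "of_real (sin (2 * pi * fst p)) = (-\<i>/2) * char2 1 0 p + (\<i>/2) * char2 (-1) 0 p"
    "of_real (cos (2 * pi * snd p)) = (1/2) * char2 0 1 p + (1/2) * char2 0 (-1) p"
    "of_real (sin (2 * pi * snd p)) = (-\<i>/2) * char2 0 1 p + (\<i>/2) * char2 0 (-1) p" for p
    by (simp_all add: char2_def complex_eq_iff)
  have "of_real (f (torus_map p)) * g p =
      (f (1,0) / 2 - \<i> * f (\<i>,0) / 2) * (char2 1 0 p * g p)
    + (f (1,0) / 2 + \<i> * f (\<i>,0) / 2) * (char2 (-1) 0 p * g p)
    + (f (0,1) / 2 - \<i> * f (0,\<i>) / 2) * (char2 0 1 p * g p)
    + (f (0,1) / 2 + \<i> * f (0,\<i>) / 2) * (char2 0 (-1) p * g p)" for p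
    unfolding f_eq of_real_add of_real_mult trig by (simp add: algebra_simps)
  thus ?case
    by (simp only:) (intro fourier_null_add fourier_null_scale fourier_null_char2 linear.prems)
next
  case (const c) thus ?case by (rule fourier_null_scale)
next
  case (add f h)
  show ?case using fourier_null_add[OF add.IH(1)[OF add.prems] add.IH(2)[OF add.prems]]
    by (simp add: distrib_right)
next
  case (mult f h)
  show ?case using mult.IH(1)[OF mult.IH(2)[OF mult.prems]] by (simp add: mult.assoc)
qed

text \<open>
  A continuous periodic function \<open>G\<close> descends to a continuous function on the torus, so its conjugate is
  uniformly close to a polynomial \<open>P\<close>. If all Fourier coefficients of \<open>G\<close> vanish then \<open>\<integral> P G = 0\<close>, hence
  \<open>\<integral> \<bar>G\<bar>\<^sup>2\<close> is arbitrarily small.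
\<close>

lemma fourier_null_periodic_zero:
  assumes null: "fourier_null G"
    and per: "\<And>a b. G (a + 1, b) = G (a, b)" "\<And>a b. G (a, b + 1) = G (a, b)"
  shows "G p = 0"
proof -
  have cont: "continuous_on UNIV G" using null unfolding fourier_null_def by blast
  have shift: "G (a + of_int m, b + of_int n) = G (a, b)" for a b m n
  proof -
    have "G (a + of_int m, b + of_int n) = G (a, b + of_int n)"
      using periodic_of_int[of "\<lambda>a. G (a, b + of_int n)"] per(1) by blast
    also have "\<dots> = G (a, b)"
      using periodic_of_int[of "\<lambda>b. G (a, b)"] per(2) by blast
    finally show ?thesis .
  qed
  define F where "F \<zeta> = G (Arg (fst \<zeta>) / (2 * pi), Arg (snd \<zeta>) / (2 * pi))" for \<zeta>
  have arg: "\<exists>n. x = Arg (cis (2 * pi * x)) / (2 * pi) + of_int n" for x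
  proof -
    have "cis (Arg (cis (2 * pi * x))) = cis (2 * pi * x)" by (subst cis_Arg) (simp_all add: sgn_div_norm)
    hence "sin (2 * pi * x) = sin (Arg (cis (2 * pi * x))) \<and> cos (2 * pi * x) = cos (Arg (cis (2 * pi * x)))"
      by (metis cis.sel)
    then obtain n :: int where "2 * pi * x = Arg (cis (2 * pi * x)) + 2 * pi * n"
      unfolding sin_cos_eq_iff by blast
    hence "x = Arg (cis (2 * pi * x)) / (2 * pi) + of_int n" by (simp add: field_simps)
    thus ?thesis ..
  qed
  have Fq: "F (torus_map p) = G p" for p
  proof -
    obtain a b where p: "p = (a, b)" by fastforce
    obtain m n where mn: "a = Arg (cis (2 * pi * a)) / (2 * pi) + of_int m"
        "b = Arg (cis (2 * pi * b)) / (2 * pi) + of_int n" using arg by blast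
    have "G (a, b) = F (torus_map (a, b))"
      unfolding F_def torus_map_def
      using shift[of "Arg (cis (2 * pi * a)) / (2 * pi)" m "Arg (cis (2 * pi * b)) / (2 * pi)" n] mn
      by simp
    thus ?thesis using p by simp
  qed
  define S where "S = torus_map ` unit_square"
  have compS: "compact S"
    unfolding S_def by (intro compact_continuous_image continuous_torus_map compact_cbox)
  \<comment> \<open>the map onto the torus is closed because the square is compact\<close>
  have contF: "continuous_on S F"
    unfolding continuous_closedin_preimage_eq
  proof (intro allI impI)
    fix T :: "complex set" assume T: "closed T"
    have "S \<inter> F -` T = torus_map ` (unit_square \<inter> G -` T)"
      unfolding S_def using Fq by auto
    moreover have "compact (unit_square \<inter> G -` T)"
      using T cont by (intro compact_Int_closed compact_cbox closed_vimage) 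
    ultimately have "compact (S \<inter> F -` T)"
      using compact_continuous_image[OF continuous_torus_map] by metis
    thus "closedin (top_of_set S) (S \<inter> F -` T)"
      by (meson closed_subset compact_imp_closed inf_le1)
  qed
  obtain B where B: "B > 0" "\<And>p. p \<in> unit_square \<Longrightarrow> norm (G p) \<le> B"
  proof -
    have "compact (G ` unit_square)"
      by (intro compact_continuous_image compact_cbox continuous_on_subset[OF cont]) auto
    thus thesis using that compact_imp_bounded bounded_pos by (metis imageI)
  qed
  define I where "I = integral unit_square (\<lambda>p. cnj (G p) * G p)"
  have "norm I \<le> e * B" if e: "e > 0" for e
  proof -
    have "continuous_on S (\<lambda>\<zeta>. cnj (F \<zeta>))" by (intro continuous_intros contF)
    from Stone_Weierstrass_polynomial_function[OF compS this e]
    obtain P where P: "polynomial_function P" "\<forall>\<zeta>\<in>S. norm (cnj (F \<zeta>) - P \<zeta>) < e" by auto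
    have rp: "real_polynomial_function (\<lambda>x. Re (P x))" "real_polynomial_function (\<lambda>x. Im (P x))"
      using P(1)[unfolded polynomial_function_def o_def, rule_format, OF bounded_linear_Re]
        P(1)[unfolded polynomial_function_def o_def, rule_format, OF bounded_linear_Im] by simp_all
    have "fourier_null (\<lambda>p. of_real (Re (P (torus_map p))) * G p + \<i> * (of_real (Im (P (torus_map p))) * G p))"
      by (intro fourier_null_add fourier_null_scale fourier_null_polynomial[OF rp(1) null] fourier_null_polynomial[OF rp(2) null])
    hence nl: "fourier_null (\<lambda>p. P (torus_map p) * G p)"
      by (rule back_subst[of fourier_null]) (auto simp: fun_eq_iff complex_eq_iff)
    hence i0: "integral unit_square (\<lambda>p. P (torus_map p) * G p) = 0"
      and c0: "continuous_on UNIV (\<lambda>p. P (torus_map p) * G p)"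
      using nl[unfolded fourier_null_def, THEN conjunct2, THEN spec, THEN spec, of 0 0]
        nl[unfolded fourier_null_def, THEN conjunct1] by simp_all
    have h1: "((\<lambda>p. cnj (G p) * G p) has_integral I) unit_square"
      unfolding I_def by (intro integrable_integral integrable_on_square continuous_intros cont)
    have h2: "((\<lambda>p. P (torus_map p) * G p) has_integral 0) unit_square"
      using integrable_integral[OF integrable_on_square[OF c0]] i0 by simp
    have "((\<lambda>p. cnj (G p) * G p - P (torus_map p) * G p) has_integral I - 0) unit_square"
      by (rule has_integral_diff[OF h1 h2])
    moreover have "norm (cnj (G p) * G p - P (torus_map p) * G p) \<le> e * B" if p: "p \<in> unit_square" for p
    proof -
      have "norm (cnj (G p) - P (torus_map p)) \<le> e"
        using P(2)[THEN bspec, of "torus_map p"] p unfolding S_def by (simp add: Fq less_imp_le)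
      hence "norm ((cnj (G p) - P (torus_map p)) * G p) \<le> e * B"
        unfolding norm_mult using B p e by (intro mult_mono) auto
      thus ?thesis by (simp add: left_diff_distrib)
    qed
    ultimately have "norm (I - 0) \<le> e * B * measure lborel unit_square"
      using e B(1) by (intro has_integral_bound) auto
    thus ?thesis by (simp add: content_Pair)
  qed
  hence "norm I \<le> 0 + e" if "e > 0" for e
    using that B(1) by (metis add_0 divide_pos_pos nonzero_divide_eq_eq less_irrefl)
  hence I0: "I = 0" using field_le_epsilon[of "norm I" 0] by simp
  have z: "G p = 0" if p: "p \<in> unit_square" for p
  proof -
    have "((\<lambda>p. Re (cnj (G p) * G p)) has_integral Re I) unit_square"
      unfolding I_def
      by (intro has_integral_Re integrable_integral integrable_on_square continuous_intros cont)
    hence hi: "((\<lambda>p. (norm (G p))\<^sup>2) has_integral 0) unit_square"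
      unfolding I0 cmod_power2 by (simp add: power2_eq_square)
    have cn: "continuous_on unit_square (\<lambda>p. (norm (G p))\<^sup>2)"
      by (intro continuous_intros continuous_on_subset[OF cont]) auto
    have "(1/2 :: real, 1/2 :: real) \<in> box (0, 0) (1, 1)"
      by (auto simp: mem_box Basis_prod_def)
    hence ne: "box (0, 0) (1, 1) \<noteq> ({} :: (real \<times> real) set)" by blast
    have "(norm (G p))\<^sup>2 = 0"
      by (rule has_integral_0_cbox_imp_0[OF cn _ hi ne p]) simp
    thus ?thesis by simp
  qed
  obtain a b where p: "p = (a, b)" by fastforce
  have "G p = G (frac a + of_int \<lfloor>a\<rfloor>, frac b + of_int \<lfloor>b\<rfloor>)" by (simp add: p frac_def)
  also have "\<dots> = G (frac a, frac b)" by (rule shift)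
  also have "\<dots> = 0" using frac_lt_1[of a] frac_lt_1[of b] by (intro z) (auto simp: less_imp_le)
  finally show ?thesis .
qed

section \<open>Fourier coefficients of functions on \<open>\<complex>/\<Gamma>\<close>\<close>

definition period_map :: "complex \<Rightarrow> complex \<Rightarrow> real \<times> real \<Rightarrow> complex" where
  "period_map \<omega>1 \<omega>2 p = of_real (fst p) * \<omega>1 + of_real (snd p) * \<omega>2"

lemma inner_period_map: "\<delta> \<bullet> period_map \<omega>1 \<omega>2 p = fst p * (\<delta> \<bullet> \<omega>1) + snd p * (\<delta> \<bullet> \<omega>2)"
  by (simp add: period_map_def inner_add_right inner_complex_def algebra_simps)

lemma continuous_period_map [continuous_intros]: "continuous_on S (period_map \<omega>1 \<omega>2)"
  unfolding period_map_def[abs_def] by (intro continuous_intros)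

text \<open>
  The Fourier coefficient at \<open>\<delta>\<close> as a mean over the period parallelogram, pulled back to the unit square.
\<close>

definition mean_coeff :: "complex \<Rightarrow> complex \<Rightarrow> (complex \<Rightarrow> complex) \<Rightarrow> complex \<Rightarrow> complex" where
  "mean_coeff \<omega>1 \<omega>2 g \<delta> =
     integral unit_square (\<lambda>p. e_fun (- \<delta>) (period_map \<omega>1 \<omega>2 p) * g (period_map \<omega>1 \<omega>2 p))"

locale period_lattice =
  fixes \<Gamma> :: "complex set" and \<omega>1 \<omega>2 :: complex
  assumes basis: "lattice_basis \<Gamma> \<omega>1 \<omega>2"
begin

abbreviation fcoeff :: "(complex \<Rightarrow> complex) \<Rightarrow> complex \<Rightarrow> complex" where
  "fcoeff \<equiv> mean_coeff \<omega>1 \<omega>2"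

text \<open>
  The signed area of the period parallelogram; it is the determinant in the formulae for coordinates and for
  the dual basis.
\<close>

definition area :: real where "area = Im (\<omega>2 * cnj \<omega>1)"

lemma area_nonzero: "area \<noteq> 0"
proof
  assume A: "area = 0"
  have ind: "Real_Vector_Spaces.independent {\<omega>1, \<omega>2}" and ne: "\<omega>1 \<noteq> \<omega>2"
    using basis unfolding lattice_basis_def by auto
  have nz: "\<omega>1 \<noteq> 0" using ind real_vector.dependent_zero[of "{\<omega>1, \<omega>2}"] by auto
  have "\<omega>2 * cnj \<omega>1 = of_real (Re (\<omega>2 * cnj \<omega>1))"
    using A unfolding area_def by (simp add: complex_eq_iff)
  hence "\<omega>2 * cnj \<omega>1 * \<omega>1 = of_real (Re (\<omega>2 * cnj \<omega>1)) * \<omega>1" by simp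
  moreover have "cnj \<omega>1 * \<omega>1 = of_real ((norm \<omega>1)\<^sup>2)"
    using complex_norm_square[of \<omega>1] by (simp add: mult.commute)
  ultimately have "\<omega>2 * of_real ((norm \<omega>1)\<^sup>2) = of_real (Re (\<omega>2 * cnj \<omega>1)) * \<omega>1"
    by (simp add: mult.assoc)
  hence "\<omega>2 = (Re (\<omega>2 * cnj \<omega>1) / (norm \<omega>1)\<^sup>2) *\<^sub>R \<omega>1"
    using nz by (simp add: scaleR_conv_of_real field_simps)
  hence "\<omega>2 \<in> span {\<omega>1}" by (metis real_vector.span_base real_vector.span_scale singletonI)
  thus False using ind ne
    by (metis insert_commute real_vector.independent_insert singletonD)
qed

lemma periods: "\<omega>1 \<in> \<Gamma>" "\<omega>2 \<in> \<Gamma>"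
proof -
  have "\<Gamma> = {of_int m * \<omega>1 + of_int n * \<omega>2 | m n. True}" using basis unfolding lattice_basis_def by blast
  moreover have "\<omega>1 = of_int 1 * \<omega>1 + of_int 0 * \<omega>2" "\<omega>2 = of_int 0 * \<omega>1 + of_int 1 * \<omega>2" by simp_all
  ultimately show "\<omega>1 \<in> \<Gamma>" "\<omega>2 \<in> \<Gamma>" by blast+
qed

lemma dual_iff: "\<delta> \<in> dual_lattice \<Gamma> \<longleftrightarrow> \<delta> \<bullet> \<omega>1 \<in> \<int> \<and> \<delta> \<bullet> \<omega>2 \<in> \<int>"
proof
  assume "\<delta> \<bullet> \<omega>1 \<in> \<int> \<and> \<delta> \<bullet> \<omega>2 \<in> \<int>"
  moreover have "\<Gamma> = {of_int m * \<omega>1 + of_int n * \<omega>2 | m n. True}" using basis unfolding lattice_basis_def by blast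
  moreover have "\<delta> \<bullet> (of_int m * \<omega>1 + of_int n * \<omega>2) = of_int m * (\<delta> \<bullet> \<omega>1) + of_int n * (\<delta> \<bullet> \<omega>2)" for m n
    by (simp add: inner_add_right inner_complex_def algebra_simps)
  ultimately show "\<delta> \<in> dual_lattice \<Gamma>" unfolding dual_lattice_def by auto
qed (auto simp: dual_lattice_def periods)

lemma coordinates: obtains p where "z = period_map \<omega>1 \<omega>2 p"
proof -
  define a where "a = - (Im (z * cnj \<omega>2)) / area"
  define b where "b = Im (z * cnj \<omega>1) / area"
  have ab: "of_real area * complex_of_real a = of_real (- Im (z * cnj \<omega>2))"
    "of_real area * complex_of_real b = of_real (Im (z * cnj \<omega>1))"
    using area_nonzero unfolding a_def b_def of_real_mult[symmetric] by simp_all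
  have "of_real area * period_map \<omega>1 \<omega>2 (a, b)
      = of_real (- Im (z * cnj \<omega>2)) * \<omega>1 + of_real (Im (z * cnj \<omega>1)) * \<omega>2"
    unfolding period_map_def distrib_left mult.assoc[symmetric] fst_conv snd_conv ab ..
  also have "\<dots> = of_real area * z"
    by (simp add: complex_eq_iff area_def algebra_simps)
  finally have "of_real area * z = of_real area * period_map \<omega>1 \<omega>2 (a, b)" ..
  hence "z = period_map \<omega>1 \<omega>2 (a, b)" using area_nonzero by simp
  thus thesis by (rule that)
qed

lemma dual_element:
  obtains \<delta> where "\<delta> \<in> dual_lattice \<Gamma>" "\<delta> \<bullet> \<omega>1 = of_int m" "\<delta> \<bullet> \<omega>2 = of_int n"
proof -
  define \<delta> where "\<delta> = \<i> * (of_int n * \<omega>1 - of_int m * \<omega>2) / of_real area"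
  have "\<delta> \<bullet> \<omega>1 = of_int m * (area / area)" "\<delta> \<bullet> \<omega>2 = of_int n * (area / area)"
    unfolding \<delta>_def inner_complex_def Re_divide_of_real Im_divide_of_real
    by (simp_all add: field_simps area_nonzero) (simp_all add: area_def algebra_simps)
  hence "\<delta> \<bullet> \<omega>1 = of_int m" "\<delta> \<bullet> \<omega>2 = of_int n" using area_nonzero by simp_all
  thus thesis using that[of \<delta>] dual_iff by simp
qed

lemma dual_zero:
  assumes "\<delta> \<bullet> \<omega>1 = 0" "\<delta> \<bullet> \<omega>2 = 0"
  shows "\<delta> = 0"
proof -
  obtain p where "\<delta> = period_map \<omega>1 \<omega>2 p" by (rule coordinates)
  hence "\<delta> \<bullet> \<delta> = 0" using assms inner_period_map[of \<delta> \<omega>1 \<omega>2 p] by simp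
  thus ?thesis by simp
qed

lemma period_map_shift:
  "period_map \<omega>1 \<omega>2 (a + 1, b) = period_map \<omega>1 \<omega>2 (a, b) + \<omega>1"
  "period_map \<omega>1 \<omega>2 (a, b + 1) = period_map \<omega>1 \<omega>2 (a, b) + \<omega>2"
  by (simp_all add: period_map_def algebra_simps)

text \<open>
  Every pair of integers is realised by a dual vector, so vanishing of the coefficients on the dual lattice
  is vanishing of all Fourier coefficients in the coordinates of the period parallelogram.
\<close>

lemma fourier_complete:
  assumes cont: "continuous_on UNIV g" and per: "\<And>z w. w \<in> \<Gamma> \<Longrightarrow> g (z + w) = g z"
    and zero: "\<And>\<delta>. \<delta> \<in> dual_lattice \<Gamma> \<Longrightarrow> fcoeff g \<delta> = 0"
  shows "g z = 0"
proof -
  define G where "G = (\<lambda>p. g (period_map \<omega>1 \<omega>2 p))"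
  have "fourier_null G"
    unfolding fourier_null_def
  proof (intro conjI allI)
    show "continuous_on UNIV G" unfolding G_def
      by (intro continuous_on_compose2[OF cont] continuous_intros) auto
    fix m n
    obtain \<delta> where \<delta>: "\<delta> \<in> dual_lattice \<Gamma>" "\<delta> \<bullet> \<omega>1 = of_int (- m)" "\<delta> \<bullet> \<omega>2 = of_int (- n)"
      by (rule dual_element)
    have "e_fun (- \<delta>) (period_map \<omega>1 \<omega>2 p) = char2 m n p" for p
      by (simp add: e_fun_cis inner_period_map \<delta> char2_def mult.commute)
    thus "integral unit_square (\<lambda>p. char2 m n p * G p) = 0"
      using zero[OF \<delta>(1)] unfolding mean_coeff_def G_def by simp
  qed
  hence "G p = 0" for p
    by (rule fourier_null_periodic_zero) (simp_all add: G_def period_map_shift per periods)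
  moreover obtain p where "z = period_map \<omega>1 \<omega>2 p" by (rule coordinates)
  ultimately show ?thesis by (simp add: G_def)
qed

text \<open>
  Along a period the integral of a derivative telescopes to zero; an arbitrary direction is a real
  combination of the two periods.
\<close>

lemma integral_derivative_zero:
  fixes h :: "complex \<Rightarrow> complex"
  assumes der: "\<And>z. (h has_derivative h' z) (at z)" and cont: "\<And>w. continuous_on UNIV (\<lambda>z. h' z w)"
    and per: "\<And>z w. w \<in> \<Gamma> \<Longrightarrow> h (z + w) = h z"
  shows "integral unit_square (\<lambda>p. h' (period_map \<omega>1 \<omega>2 p) w) = 0"
proof -
  let ?T = "period_map \<omega>1 \<omega>2"
  have c: "continuous_on S (\<lambda>p. h' (?T p) w)" for w and S :: "(real \<times> real) set"
    by (intro continuous_on_compose2[OF cont] continuous_intros) auto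
  have one: "integral (cbox 0 1) (\<lambda>t. h' (u + of_real t * \<omega>) \<omega>) = 0" if \<omega>: "\<omega> \<in> \<Gamma>" for u \<omega>
  proof -
    have "((\<lambda>t. h' (u + of_real t * \<omega>) \<omega>) has_integral (h (u + of_real 1 * \<omega>) - h (u + of_real 0 * \<omega>))) {0..1}"
    proof (rule fundamental_theorem_of_calculus)
      fix x :: real
      have "((\<lambda>t. u + of_real t * \<omega>) has_vector_derivative \<omega>) (at x within {0..1})"
        by (auto intro!: derivative_eq_intros)
      from vector_derivative_diff_chain_within[OF this, of h "h' (u + of_real x * \<omega>)"]
      show "((\<lambda>t. h (u + of_real t * \<omega>)) has_vector_derivative h' (u + of_real x * \<omega>) \<omega>) (at x within {0..1})"
        using has_derivative_at_withinI[OF der[of "u + of_real x * \<omega>"]] by (simp add: o_def)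
    qed simp
    thus ?thesis using per[OF \<omega>, of u] by (simp add: integral_unique)
  qed
  have b: "integral unit_square (\<lambda>p. h' (?T p) \<omega>2) = 0"
  proof -
    have "integral (cbox 0 1) (\<lambda>y. h' (?T (x, y)) \<omega>2) = 0" for x
      using one[OF periods(2), of "of_real x * \<omega>1"] by (simp add: period_map_def)
    thus ?thesis by (subst integral_prod_continuous[OF c]) simp
  qed
  have a: "integral unit_square (\<lambda>p. h' (?T p) \<omega>1) = 0"
  proof -
    have "integral unit_square (\<lambda>p. h' (?T p) \<omega>1)
       = integral (cbox 0 1) (\<lambda>x. integral (cbox 0 1) (\<lambda>y. h' (?T (x, y)) \<omega>1))"
      by (rule integral_prod_continuous[OF c])
    also have "\<dots> = integral (cbox 0 1) (\<lambda>y. integral (cbox 0 1) (\<lambda>x. h' (?T (x, y)) \<omega>1))"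
      by (rule integral_swap_continuous) (use c[of _ \<omega>1] in \<open>simp add: case_prod_beta\<close>)
    also have "\<dots> = 0"
      using one[OF periods(1)] by (simp add: period_map_def add.commute)
    finally show ?thesis .
  qed
  obtain p where p: "w = period_map \<omega>1 \<omega>2 p" by (rule coordinates)
  have "h' z w = of_real (fst p) * h' z \<omega>1 + of_real (snd p) * h' z \<omega>2" for z
  proof -
    interpret bounded_linear "h' z" using der has_derivative_bounded_linear by blast
    have "w = fst p *\<^sub>R \<omega>1 + snd p *\<^sub>R \<omega>2" by (simp add: p period_map_def scaleR_conv_of_real)
    thus ?thesis by (simp only: add scaleR) (simp add: scaleR_conv_of_real)
  qed
  hence "integral unit_square (\<lambda>p. h' (?T p) w) = integral unit_square
      (\<lambda>q. of_real (fst p) * h' (?T q) \<omega>1 + of_real (snd p) * h' (?T q) \<omega>2)" by simp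
  also have "\<dots> = 0"
    by (subst integral_add) (auto intro!: integrable_on_square continuous_intros c simp: a b)
  finally show ?thesis .
qed

text \<open>
  Integration by parts: \<open>e\<^sub>-\<^sub>\<delta> g\<close> is periodic, so the mean of its derivative vanishes.
\<close>

lemma mean_coeff_derivative:
  assumes sm: "smooth g" and per: "\<And>z w. w \<in> \<Gamma> \<Longrightarrow> g (z + w) = g z" and \<delta>: "\<delta> \<in> dual_lattice \<Gamma>"
  shows "fcoeff (\<lambda>z. frechet_derivative g (at z) w) \<delta>
    = 2 * of_real pi * \<i> * of_real (\<delta> \<bullet> w) * fcoeff g \<delta>"
proof -
  let ?T = "period_map \<omega>1 \<omega>2"
  let ?D = "\<lambda>z. frechet_derivative g (at z)"
  have cg: "continuous_on UNIV g" "\<And>w. continuous_on UNIV (\<lambda>z. ?D z w)"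
    using smooth_continuous[OF sm] smooth_continuous_derivative[OF sm] by blast+
  have cT: "continuous_on UNIV (\<lambda>p. g (?T p))" "\<And>w. continuous_on UNIV (\<lambda>p. ?D (?T p) w)"
    by (auto intro!: continuous_on_compose2[OF cg(1)] continuous_on_compose2[OF cg(2)] continuous_intros)
  have "integral unit_square (\<lambda>p. e_fun (- \<delta>) (?T p) * ?D (?T p) w
      + (2 * of_real pi * \<i> * of_real (- \<delta> \<bullet> w)) * e_fun (- \<delta>) (?T p) * g (?T p)) = 0"
  proof (rule integral_derivative_zero[where h = "\<lambda>z. e_fun (- \<delta>) z * g z" and
        h' = "\<lambda>z w. e_fun (- \<delta>) z * ?D z w + (2 * of_real pi * \<i> * of_real (- \<delta> \<bullet> w)) * e_fun (- \<delta>) z * g z"])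
    show "((\<lambda>z. e_fun (- \<delta>) z * g z) has_derivative
       (\<lambda>w. e_fun (- \<delta>) z * ?D z w + (2 * of_real pi * \<i> * of_real (- \<delta> \<bullet> w)) * e_fun (- \<delta>) z * g z)) (at z)" for z
      by (rule has_derivative_mult[OF has_derivative_e_fun smooth_has_derivative[OF sm]])
    show "continuous_on UNIV (\<lambda>z. e_fun (- \<delta>) z * ?D z w + (2 * of_real pi * \<i> * of_real (- \<delta> \<bullet> w)) * e_fun (- \<delta>) z * g z)" for w
      by (intro continuous_intros cg)
    show "e_fun (- \<delta>) (z + w) * g (z + w) = e_fun (- \<delta>) z * g z" if "w \<in> \<Gamma>" for z w
    proof -
      have "- \<delta> \<bullet> w \<in> \<int>" using \<delta> that unfolding dual_lattice_def by simp
      thus ?thesis by (simp add: e_fun_add_right e_fun_integral per that)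
    qed
  qed
  also have "(\<lambda>p. e_fun (- \<delta>) (?T p) * ?D (?T p) w
      + (2 * of_real pi * \<i> * of_real (- \<delta> \<bullet> w)) * e_fun (- \<delta>) (?T p) * g (?T p))
    = (\<lambda>p. e_fun (- \<delta>) (?T p) * ?D (?T p) w
      - (2 * of_real pi * \<i> * of_real (\<delta> \<bullet> w)) * (e_fun (- \<delta>) (?T p) * g (?T p)))"
    by (simp add: fun_eq_iff mult.assoc)
  also have "integral unit_square \<dots> = fcoeff (\<lambda>z. ?D z w) \<delta>
     - 2 * of_real pi * \<i> * of_real (\<delta> \<bullet> w) * fcoeff g \<delta>"
    unfolding mean_coeff_def
    by (subst integral_diff) (auto intro!: integrable_on_square continuous_intros cT)
  finally show ?thesis by simp
qed

lemma integral_circle: "integral (cbox 0 1) (\<lambda>t::real. cis (2 * pi * (of_int m * t))) = (if m = 0 then 1 else 0)"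
proof (cases "m = 0")
  case False
  have "((\<lambda>t. cis (2 * pi * (of_int m * t))) has_integral
      (cis (2 * pi * (of_int m * 1)) / (2 * pi * of_int m * \<i>) - cis (2 * pi * (of_int m * 0)) / (2 * pi * of_int m * \<i>))) {0..1}"
  proof (rule fundamental_theorem_of_calculus)
    fix x :: real
    let ?c = "\<i> * of_real (2 * pi * of_int m)"
    have "((\<lambda>t. exp (?c * t) / ?c) has_field_derivative exp (?c * of_real x)) (at (of_real x))"
      using False by (auto intro!: derivative_eq_intros)
    from has_vector_derivative_real_field[OF this]
    have "((\<lambda>t. exp (?c * of_real t) / ?c) has_vector_derivative exp (?c * of_real x)) (at x within {0..1})" .
    thus "((\<lambda>t. cis (2 * pi * (of_int m * t)) / (2 * pi * of_int m * \<i>)) has_vector_derivative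
        cis (2 * pi * (of_int m * x))) (at x within {0..1})"
      by (simp add: cis_conv_exp mult_ac)
  qed simp
  moreover have "cis (2 * pi * of_int m) = 1" by (simp add: complex_eq_iff sin_times_pi_eq_0 cos_one_2pi_int)
  ultimately show ?thesis using False by (simp add: integral_unique)
qed simp

lemma mean_coeff_e_fun:
  assumes "\<gamma> - \<delta> \<in> dual_lattice \<Gamma>"
  shows "fcoeff (e_fun \<gamma>) \<delta> = (if \<gamma> = \<delta> then 1 else 0)"
proof -
  obtain m n :: int where mn: "(\<gamma> - \<delta>) \<bullet> \<omega>1 = of_int m" "(\<gamma> - \<delta>) \<bullet> \<omega>2 = of_int n"
    using assms unfolding dual_iff by (auto elim!: Ints_cases)
  have "e_fun (- \<delta>) (period_map \<omega>1 \<omega>2 p) * e_fun \<gamma> (period_map \<omega>1 \<omega>2 p)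
     = cis (2 * pi * (of_int m * fst p)) * cis (2 * pi * (of_int n * snd p))" for p
  proof -
    have "e_fun (- \<delta>) (period_map \<omega>1 \<omega>2 p) * e_fun \<gamma> (period_map \<omega>1 \<omega>2 p) = e_fun (\<gamma> - \<delta>) (period_map \<omega>1 \<omega>2 p)"
      by (simp add: e_fun_diff_left mult.commute)
    thus ?thesis unfolding e_fun_cis inner_period_map mn cis_mult by (simp add: algebra_simps)
  qed
  hence "fcoeff (e_fun \<gamma>) \<delta>
      = integral unit_square (\<lambda>p. cis (2 * pi * (of_int m * fst p)) * cis (2 * pi * (of_int n * snd p)))"
    unfolding mean_coeff_def by simp
  also have "\<dots> = integral (cbox 0 1) (\<lambda>x. integral (cbox 0 1) (\<lambda>y. cis (2 * pi * (of_int m * x)) * cis (2 * pi * (of_int n * y))))"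
    by (subst integral_prod_continuous) (auto intro!: continuous_intros)
  also have "\<dots> = (if m = 0 then 1 else 0) * (if n = 0 then 1 else 0)"
    by (simp add: integral_circle[unfolded box_real])
  also have "\<dots> = (if \<gamma> = \<delta> then 1 else 0)"
    using dual_zero[of "\<gamma> - \<delta>"] mn by auto
  finally show ?thesis .
qed

lemma mean_coeff_sum:
  assumes "finite S" "\<And>\<gamma>. \<gamma> \<in> S \<Longrightarrow> \<gamma> - \<delta> \<in> dual_lattice \<Gamma>"
  shows "fcoeff (\<lambda>z. \<Sum>\<gamma>\<in>S. c \<gamma> * e_fun \<gamma> z) \<delta> = (if \<delta> \<in> S then c \<delta> else 0)"
proof -
  have "fcoeff (\<lambda>z. \<Sum>\<gamma>\<in>S. c \<gamma> * e_fun \<gamma> z) \<delta>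
     = integral unit_square (\<lambda>p. \<Sum>\<gamma>\<in>S. c \<gamma> * (e_fun (- \<delta>) (period_map \<omega>1 \<omega>2 p) * e_fun \<gamma> (period_map \<omega>1 \<omega>2 p)))"
    unfolding mean_coeff_def by (simp add: sum_distrib_left mult_ac)
  also have "\<dots> = (\<Sum>\<gamma>\<in>S. c \<gamma> * fcoeff (e_fun \<gamma>) \<delta>)"
    unfolding mean_coeff_def
    by (subst integral_sum) (auto intro!: assms(1) integrable_on_square continuous_intros)
  also have "\<dots> = (\<Sum>\<gamma>\<in>S. if \<gamma> = \<delta> then c \<gamma> else 0)"
    by (intro sum.cong) (auto simp: mean_coeff_e_fun assms(2))
  finally show ?thesis by (simp add: assms(1))
qed

end

text \<open>
  The iterated integral with the basis picked by the choice operator is an integral over the square, and it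
  commutes with the linear coordinate maps.
\<close>

lemma coord_fourier_coeff:
  assumes "continuous_on UNIV u" "(SOME (\<omega>1, \<omega>2). lattice_basis \<Gamma> \<omega>1 \<omega>2) = (\<omega>1, \<omega>2)"
  shows "coord k (fourier_coeff \<Gamma> u \<gamma>) = mean_coeff \<omega>1 \<omega>2 (\<lambda>z. coord k (u z)) \<gamma>"
proof -
  let ?U = "\<lambda>p. e_fun (- \<gamma>) (period_map \<omega>1 \<omega>2 p) *s u (period_map \<omega>1 \<omega>2 p)"
  have c: "continuous_on S ?U" for S
  proof -
    have "continuous_on S (\<lambda>p. u (period_map \<omega>1 \<omega>2 p))"
      by (intro continuous_on_compose2[OF assms(1)] continuous_intros) auto
    hence "continuous_on S (\<lambda>p. \<chi> i. e_fun (- \<gamma>) (period_map \<omega>1 \<omega>2 p) * u (period_map \<omega>1 \<omega>2 p) $ i)"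
      by (intro continuous_intros)
    thus ?thesis by (simp add: vector_scalar_mult_def)
  qed
  have "fourier_coeff \<Gamma> u \<gamma> = integral (cbox 0 1) (\<lambda>a. integral (cbox 0 1) (\<lambda>b. ?U (a, b)))"
    unfolding fourier_coeff_def assms(2) by (simp add: period_map_def Let_def)
  also have "\<dots> = integral unit_square ?U"
    by (rule integral_prod_continuous[OF c, symmetric])
  finally have "coord k (fourier_coeff \<Gamma> u \<gamma>) = integral unit_square (coord k \<circ> ?U)"
    using integral_linear[OF integrable_continuous[OF c] bounded_linear_coord] by simp
  thus ?thesis by (simp add: o_def coord_scale mean_coeff_def)
qed

context period_lattice begin

lemma mean_coeff_lin:
  assumes "continuous_on UNIV g" "continuous_on UNIV h"
  shows "fcoeff (\<lambda>z. c * g z + d * h z) \<delta> = c * fcoeff g \<delta> + d * fcoeff h \<delta>"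
proof -
  let ?T = "period_map \<omega>1 \<omega>2"
  have c: "continuous_on UNIV (\<lambda>p. g (?T p))" "continuous_on UNIV (\<lambda>p. h (?T p))"
    by (auto intro!: continuous_on_compose2[OF assms(1)] continuous_on_compose2[OF assms(2)] continuous_intros)
  have "fcoeff (\<lambda>z. c * g z + d * h z) \<delta>
     = integral unit_square (\<lambda>p. c * (e_fun (- \<delta>) (?T p) * g (?T p)) + d * (e_fun (- \<delta>) (?T p) * h (?T p)))"
    unfolding mean_coeff_def by (simp add: algebra_simps)
  also have "\<dots> = c * fcoeff g \<delta> + d * fcoeff h \<delta>"
    unfolding mean_coeff_def
    by (subst integral_add) (auto intro!: integrable_on_square continuous_intros c)
  finally show ?thesis .
qed

lemma mean_coeff_wirtinger:
  assumes sm: "smooth g" and per: "\<And>z w. w \<in> \<Gamma> \<Longrightarrow> g (z + w) = g z" and \<delta>: "\<delta> \<in> dual_lattice \<Gamma>"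
  shows "fcoeff (dz g) \<delta> = of_real pi * \<i> * cnj \<delta> * fcoeff g \<delta>"
    "fcoeff (dzbar g) \<delta> = of_real pi * \<i> * \<delta> * fcoeff g \<delta>"
proof -
  note c = smooth_continuous_derivative[OF sm]
  have D: "fcoeff (\<lambda>z. frechet_derivative g (at z) w) \<delta>
    = 2 * of_real pi * \<i> * of_real (\<delta> \<bullet> w) * fcoeff g \<delta>" for w
    by (rule mean_coeff_derivative[OF sm per \<delta>])
  have e: "dz g = (\<lambda>z. (1/2) * frechet_derivative g (at z) 1 + (- \<i>/2) * frechet_derivative g (at z) \<i>)"
    "dzbar g = (\<lambda>z. (1/2) * frechet_derivative g (at z) 1 + (\<i>/2) * frechet_derivative g (at z) \<i>)"
    by (simp_all add: dz_def dzbar_def fun_eq_iff algebra_simps)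
  have in1: "of_real (\<delta> \<bullet> 1) = complex_of_real (Re \<delta>)" "of_real (\<delta> \<bullet> \<i>) = complex_of_real (Im \<delta>)"
    by (simp_all add: inner_complex_def)
  have cd: "of_real (Re \<delta>) - \<i> * of_real (Im \<delta>) = cnj \<delta>" "of_real (Re \<delta>) + \<i> * of_real (Im \<delta>) = \<delta>"
    by (simp_all add: complex_eq_iff)
  let ?m = "fcoeff g \<delta>"
  have "fcoeff (dz g) \<delta> = of_real pi * \<i> * (of_real (Re \<delta>) - \<i> * of_real (Im \<delta>)) * ?m"
    unfolding e mean_coeff_lin[OF c c] D in1 by (simp add: algebra_simps)
  thus "fcoeff (dz g) \<delta> = of_real pi * \<i> * cnj \<delta> * ?m" unfolding cd .
  have "fcoeff (dzbar g) \<delta> = of_real pi * \<i> * (of_real (Re \<delta>) + \<i> * of_real (Im \<delta>)) * ?m"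
    unfolding e mean_coeff_lin[OF c c] D in1 by (simp add: algebra_simps)
  thus "fcoeff (dzbar g) \<delta> = of_real pi * \<i> * \<delta> * ?m" unfolding cd .
qed

lemma mean_coeff_shift:
  assumes "continuous_on UNIV g"
  shows "fcoeff (\<lambda>z. c * e_fun (- \<epsilon>) z * g z) \<delta> = c * fcoeff g (\<delta> + \<epsilon>)"
proof -
  have "e_fun (- (\<delta> + \<epsilon>)) z = e_fun (- \<delta>) z * e_fun (- \<epsilon>) z" for z
    using e_fun_add_left[of "- \<delta>" "- \<epsilon>" z] by (simp add: add.commute)
  thus ?thesis unfolding mean_coeff_def integral_mult_right[symmetric] by (simp add: mult_ac)
qed

text \<open>
  A function with finite spectrum is its Fourier sum, by completeness; subtracting the value at the origin
  eliminates the constant coefficient.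
\<close>

lemma fourier_sum:
  assumes cont: "continuous_on UNIV g" and per: "\<And>z w. w \<in> \<Gamma> \<Longrightarrow> g (z + w) = g z" and g0: "g 0 = 0"
    and S: "finite S" "S \<subseteq> dual_lattice \<Gamma>" "0 \<notin> S"
    and zero: "\<And>\<delta>. \<delta> \<in> dual_lattice \<Gamma> \<Longrightarrow> \<delta> \<notin> S \<Longrightarrow> \<delta> \<noteq> 0 \<Longrightarrow> fcoeff g \<delta> = 0"
  shows "g z = (\<Sum>\<delta>\<in>S. fcoeff g \<delta> * (e_fun \<delta> z - 1))"
proof -
  let ?m = "fcoeff g"
  define h where "h z = (\<Sum>\<delta>\<in>insert 0 S. ?m \<delta> * e_fun \<delta> z)" for z
  have ch: "continuous_on UNIV h" unfolding h_def[abs_def] by (intro continuous_intros)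
  have d0: "0 \<in> dual_lattice \<Gamma>" by (simp add: dual_iff)
  have dd: "\<gamma> - \<delta> \<in> dual_lattice \<Gamma>" if "\<gamma> \<in> dual_lattice \<Gamma>" "\<delta> \<in> dual_lattice \<Gamma>" for \<gamma> \<delta>
    using that unfolding dual_lattice_def by (auto simp: inner_diff_left)
  have "1 * g z + (-1) * h z = 0" for z
  proof (rule fourier_complete[where g = "\<lambda>z. 1 * g z + (-1) * h z"])
    show "continuous_on UNIV (\<lambda>z. 1 * g z + (-1) * h z)" by (intro continuous_intros cont ch)
    show "1 * g (z + w) + (-1) * h (z + w) = 1 * g z + (-1) * h z" if "w \<in> \<Gamma>" for z w
    proof -
      have "e_fun \<delta> (z + w) = e_fun \<delta> z" if "\<delta> \<in> insert 0 S" for \<delta>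
        using that S(2) \<open>w \<in> \<Gamma>\<close> by (auto simp: e_fun_add_right dual_lattice_def e_fun_integral subset_iff)
      hence "h (z + w) = h z" unfolding h_def by (intro sum.cong) auto
      thus ?thesis by (simp add: per[OF that])
    qed
    fix \<delta> assume \<delta>: "\<delta> \<in> dual_lattice \<Gamma>"
    have "fcoeff h \<delta> = (if \<delta> \<in> insert 0 S then ?m \<delta> else 0)"
      unfolding h_def[abs_def] using S(1,2) d0 \<delta> by (intro mean_coeff_sum) (auto intro: dd)
    also have "\<dots> = ?m \<delta>" using zero[OF \<delta>] by auto
    finally show "fcoeff (\<lambda>z. 1 * g z + (-1) * h z) \<delta> = 0"
      unfolding mean_coeff_lin[OF cont ch] by simp
  qed
  hence gh: "g z = h z" for z by (simp add: eq_neg_iff_add_eq_0)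
  have hz: "h z = ?m 0 + (\<Sum>\<delta>\<in>S. ?m \<delta> * e_fun \<delta> z)" for z
    unfolding h_def using S by simp
  have "?m 0 + (\<Sum>\<delta>\<in>S. ?m \<delta>) = 0" using gh[of 0] g0 hz[of 0] by simp
  hence "?m 0 = - (\<Sum>\<delta>\<in>S. ?m \<delta>)" by (simp add: eq_neg_iff_add_eq_0)
  thus ?thesis using gh[of z] hz[of z] by (simp add: algebra_simps sum_subtractf)
qed

end

section \<open>The explicit family of HSL tori\<close>

locale hsl_lattice = period_lattice +
  fixes \<beta>0 :: complex
  assumes some_basis: "(SOME (\<omega>1, \<omega>2). lattice_basis \<Gamma> \<omega>1 \<omega>2) = (\<omega>1, \<omega>2)"
    and beta_dual: "\<beta>0 \<in> dual_lattice \<Gamma>"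
    and freqs_nonempty: "freqs \<Gamma> \<beta>0 \<noteq> {}"
    and freqs_finite: "finite (freqs \<Gamma> \<beta>0)"
begin

abbreviation Fr :: "complex set" where "Fr \<equiv> freqs \<Gamma> \<beta>0"

abbreviation HSL :: "(complex \<Rightarrow> real^4) set" where "HSL \<equiv> based_HSL \<Gamma> \<beta>0"

abbreviation spec :: "(complex \<Rightarrow> real^4) \<Rightarrow> complex set \<times> riemann_sphere multiset" where
  "spec \<equiv> spectral_data \<Gamma> \<beta>0"

abbreviation spectra :: "(complex set \<times> riemann_sphere multiset) set" where
  "spectra \<equiv> spectral_space \<Gamma> \<beta>0"

abbreviation sl :: "complex \<Rightarrow> complex" where "sl \<equiv> slope \<beta>0"

lemma beta_nonzero: "\<beta>0 \<noteq> 0"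
  using freqs_nonempty unfolding freqs_def by auto

lemma shifted_iff: "\<gamma> \<in> shifted_dual \<Gamma> \<beta>0 \<longleftrightarrow> \<gamma> - \<beta>0 / 2 \<in> dual_lattice \<Gamma>"
  unfolding shifted_dual_def by (auto simp: image_iff) (metis diff_add_cancel)

lemma dual_add: "\<gamma> \<in> dual_lattice \<Gamma> \<Longrightarrow> \<delta> \<in> dual_lattice \<Gamma> \<Longrightarrow> \<gamma> + \<delta> \<in> dual_lattice \<Gamma>"
  and dual_diff: "\<gamma> \<in> dual_lattice \<Gamma> \<Longrightarrow> \<delta> \<in> dual_lattice \<Gamma> \<Longrightarrow> \<gamma> - \<delta> \<in> dual_lattice \<Gamma>"
  and dual_minus: "\<gamma> \<in> dual_lattice \<Gamma> \<Longrightarrow> - \<gamma> \<in> dual_lattice \<Gamma>"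
  unfolding dual_lattice_def by (auto simp: inner_add_left inner_diff_left)

lemma shifted_dual_plus: "\<gamma> \<in> shifted_dual \<Gamma> \<beta>0 \<Longrightarrow> \<gamma> + \<beta>0 / 2 \<in> dual_lattice \<Gamma>"
  using dual_add[OF _ beta_dual, of "\<gamma> - \<beta>0 / 2"] unfolding shifted_iff by (simp add: field_simps)

lemma shifted_diff: "\<gamma> \<in> shifted_dual \<Gamma> \<beta>0 \<Longrightarrow> \<delta> \<in> shifted_dual \<Gamma> \<beta>0 \<Longrightarrow> \<gamma> - \<delta> \<in> dual_lattice \<Gamma>"
  using dual_diff[of "\<gamma> - \<beta>0 / 2" "\<delta> - \<beta>0 / 2"] unfolding shifted_iff by simp

lemma Fr_shifted: "\<gamma> \<in> Fr \<Longrightarrow> \<gamma> \<in> shifted_dual \<Gamma> \<beta>0"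
  unfolding freqs_def by simp

lemma Fr_dual: "\<gamma> \<in> Fr \<Longrightarrow> \<gamma> + \<beta>0 / 2 \<in> dual_lattice \<Gamma>" "\<gamma> \<in> Fr \<Longrightarrow> \<gamma> - \<beta>0 / 2 \<in> dual_lattice \<Gamma>"
  using shifted_dual_plus Fr_shifted shifted_iff by blast+

lemma Fr_minus [simp]: "- \<gamma> \<in> Fr \<longleftrightarrow> \<gamma> \<in> Fr"
proof -
  have "- \<gamma> \<in> Fr" if "\<gamma> \<in> Fr" for \<gamma>
  proof -
    have "- \<gamma> - \<beta>0 / 2 \<in> dual_lattice \<Gamma>"
      using dual_minus[OF Fr_dual(1)[OF that]] by simp
    moreover have g: "norm \<gamma> = norm \<beta>0 / 2" "\<gamma> \<noteq> \<beta>0 / 2" "\<gamma> \<noteq> - (\<beta>0 / 2)"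
      using that unfolding freqs_def by blast+
    moreover have "- \<gamma> \<noteq> \<beta>0 / 2" using g(3) by (metis minus_minus)
    moreover have "- \<gamma> \<noteq> - (\<beta>0 / 2)" using g(2) by (metis minus_minus)
    moreover have "norm (- \<gamma>) = norm \<beta>0 / 2" using g(1) norm_minus_cancel[of \<gamma>] by argo
    ultimately show ?thesis unfolding freqs_def mem_Collect_eq shifted_iff by blast
  qed
  thus ?thesis by (metis minus_minus)
qed

lemma slope_minus [simp]: "sl (- \<gamma>) = - sl \<gamma>"
  by (simp add: slope_def)

lemma slope_inj: "inj sl"
  using beta_nonzero by (auto simp: inj_def slope_def)

lemma slope_eq_iff: "sl \<gamma> = sl \<delta> \<longleftrightarrow> \<gamma> = \<delta>"
  using slope_inj by (simp add: inj_eq)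

lemma from_slope: "\<gamma> = sl \<gamma> * \<beta>0 / 2"
  using beta_nonzero by (simp add: slope_def)

lemma slope_norm: "\<gamma> \<in> Fr \<Longrightarrow> norm (sl \<gamma>) = 1"
  using beta_nonzero by (simp add: freqs_def slope_def norm_divide norm_mult)

lemma slope_special:
  assumes "\<gamma> \<in> Fr"
  shows "sl \<gamma> \<noteq> 0" "sl \<gamma> \<noteq> 1" "sl \<gamma> \<noteq> -1" "1 + sl \<gamma> \<noteq> 0" "1 - sl \<gamma> \<noteq> 0"
proof -
  show "sl \<gamma> \<noteq> 0" using slope_norm[OF assms] by auto
  show *: "sl \<gamma> \<noteq> 1" "sl \<gamma> \<noteq> -1"
  proof -
    have "\<gamma> \<noteq> \<beta>0 / 2" "\<gamma> \<noteq> - (\<beta>0 / 2)" using assms unfolding freqs_def by auto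
    thus "sl \<gamma> \<noteq> 1" "sl \<gamma> \<noteq> -1" by (metis from_slope mult_1 mult_minus1 minus_divide_left)+
  qed
  show "1 + sl \<gamma> \<noteq> 0" "1 - sl \<gamma> \<noteq> 0" using * by (auto simp: add_eq_0_iff)
qed

text \<open>
  The slopes lie on the unit circle. This is what makes the two Wirtinger equations of a single
  frequency compatible.
\<close>

lemma cnj_slope: "\<gamma> \<in> Fr \<Longrightarrow> cnj (sl \<gamma>) = 1 / sl \<gamma>"
  using slope_norm[of \<gamma>] slope_special(1)[of \<gamma>] complex_norm_square[of "sl \<gamma>"]
  by (simp add: field_simps)

lemma cnj_freq: "\<gamma> \<in> Fr \<Longrightarrow> cnj \<gamma> = cnj \<beta>0 / (2 * sl \<gamma>)"
  using arg_cong[OF from_slope[of \<gamma>], of cnj] by (simp add: cnj_slope)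

text \<open>
  The common factor of \<open>1 / (\<pi> \<i> \<gamma>\<^sup>*)\<close>, where \<open>\<gamma>\<^sup>*\<close> is the conjugate of \<open>\<gamma> = s \<beta>0 / 2\<close>, that appears when the
  exponentials are integrated.
\<close>

definition C0 :: complex where "C0 = 2 / (of_real pi * \<i> * cnj \<beta>0)"

lemma C0_nonzero: "C0 \<noteq> 0" and C0_eq: "C0 * (of_real pi * \<i> * cnj \<beta>0) = 2"
  using beta_nonzero by (simp_all add: C0_def)

lemma C0_cancel: "C0 * (of_real pi * \<i> * (cnj \<beta>0 * x)) = 2 * x"
    "C0 * (of_real pi * \<i> * (\<beta>0 * x)) = 2 * (\<beta>0 / cnj \<beta>0) * x"
proof -
  have *: "C0 * (of_real pi * \<i> * (cnj \<beta>0 * y)) = 2 * y" for y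
    using C0_eq by (simp add: mult.assoc[symmetric])
  show "C0 * (of_real pi * \<i> * (cnj \<beta>0 * x)) = 2 * x" by (rule *)
  show "C0 * (of_real pi * \<i> * (\<beta>0 * x)) = 2 * (\<beta>0 / cnj \<beta>0) * x"
    using *[of "\<beta>0 / cnj \<beta>0 * x"] beta_nonzero by simp
qed

text \<open>
  The first coordinates of \<open>e\<^sup>-\<^sup>J\<^sup>\<beta>\<^sup>/\<^sup>2 f\<^sub>z\<close> and of its analogue for the conjugate derivative, for the map
  \<open>fam A\<close>.
\<close>

definition psum :: "(complex \<Rightarrow> complex) \<Rightarrow> complex \<Rightarrow> complex" where
  "psum A z = (\<Sum>\<gamma>\<in>Fr. A \<gamma> * e_fun \<gamma> z)"

definition qsum :: "(complex \<Rightarrow> complex) \<Rightarrow> complex \<Rightarrow> complex" where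
  "qsum A z = (\<beta>0 / cnj \<beta>0) * (\<Sum>\<gamma>\<in>Fr. A \<gamma> * sl \<gamma> * e_fun \<gamma> z)"

lemma psum_scale: "psum (\<lambda>\<gamma>. c * A \<gamma>) z = c * psum A z"
  and qsum_scale: "qsum (\<lambda>\<gamma>. c * A \<gamma>) z = c * qsum A z"
  by (simp_all add: psum_def qsum_def sum_distrib_left mult_ac)

text \<open>
  For \<open>\<epsilon> = \<plusminus>1\<close>, the function that vanishes at the origin and has the Wirtinger derivatives
  \<open>e\<^sub>\<epsilon>\<^sub>\<beta>\<^sub>0\<^sub>/\<^sub>2\<close> times \<open>psum B\<close> and \<open>\<epsilon> qsum B\<close>; the two signs give \<open>F1\<close> and \<open>F4\<close> of the maps below. The
  excluded frequencies \<open>\<plusminus>\<beta>0/2\<close> are those for which a denominator vanishes.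
\<close>

definition primitive :: "complex \<Rightarrow> (complex \<Rightarrow> complex) \<Rightarrow> complex \<Rightarrow> complex" where
  "primitive \<epsilon> B z = (\<Sum>\<gamma>\<in>Fr. (B \<gamma> * C0 * sl \<gamma> / (1 + \<epsilon> * sl \<gamma>)) * (e_fun (\<gamma> + \<epsilon> * (\<beta>0 / 2)) z - 1))"

lemma primitive_wirtinger:
  assumes \<epsilon>: "\<epsilon> = 1 \<or> \<epsilon> = -1"
  shows "dz (primitive \<epsilon> B) z = e_fun (\<epsilon> * (\<beta>0 / 2)) z * psum B z"
    "dzbar (primitive \<epsilon> B) z = \<epsilon> * e_fun (\<epsilon> * (\<beta>0 / 2)) z * qsum B z"
proof -
  let ?c = "\<lambda>\<gamma>. B \<gamma> * C0 * sl \<gamma> / (1 + \<epsilon> * sl \<gamma>)"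
  have p: "primitive \<epsilon> B = (\<lambda>z. \<Sum>\<gamma>\<in>Fr. ?c \<gamma> * (e_fun (\<gamma> + \<epsilon> * (\<beta>0 / 2)) z - 1))"
    by (simp add: primitive_def fun_eq_iff)
  note D = has_derivative_wirtinger[OF e_fun_sum_has_derivative[OF freqs_finite,
        of ?c "\<lambda>\<gamma>. \<gamma> + \<epsilon> * (\<beta>0 / 2)" "\<lambda>_. 1" z, folded p]]
  have fac: "?c \<gamma> * (of_real pi * \<i> * cnj (\<gamma> + \<epsilon> * (\<beta>0 / 2))) = B \<gamma>"
    "?c \<gamma> * (of_real pi * \<i> * (\<gamma> + \<epsilon> * (\<beta>0 / 2))) = \<epsilon> * ((\<beta>0 / cnj \<beta>0) * (B \<gamma> * sl \<gamma>))"
    if g: "\<gamma> \<in> Fr" for \<gamma>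
  proof -
    let ?x = "1 + \<epsilon> * sl \<gamma>"
    have n: "?x \<noteq> 0" "sl \<gamma> \<noteq> 0" using slope_special[OF g] \<epsilon> by auto
    have cg: "cnj (\<gamma> + \<epsilon> * (\<beta>0 / 2)) = cnj \<beta>0 * (?x / (2 * sl \<gamma>))"
      using \<epsilon> n by (auto simp: cnj_freq[OF g] field_simps)
    have gb: "\<gamma> + \<epsilon> * (\<beta>0 / 2) = \<beta>0 * (\<epsilon> * ?x / 2)"
      using \<epsilon> by (subst from_slope) (auto simp: algebra_simps add_divide_distrib)
    have cancel: "b * (s / x * (2 * (x / (2 * s)))) = b" "b * s / x * (2 * q * (e * x / 2)) = e * (q * (b * s))"
      if "x \<noteq> 0" "s \<noteq> 0" for b s x q e :: complex
      using that by simp_all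
    have "?c \<gamma> * (of_real pi * \<i> * cnj (\<gamma> + \<epsilon> * (\<beta>0 / 2)))
        = B \<gamma> * (sl \<gamma> / ?x * (C0 * (of_real pi * \<i> * (cnj \<beta>0 * (?x / (2 * sl \<gamma>))))))"
      unfolding cg by simp
    thus "?c \<gamma> * (of_real pi * \<i> * cnj (\<gamma> + \<epsilon> * (\<beta>0 / 2))) = B \<gamma>"
      unfolding C0_cancel cancel(1)[OF n] .
    have "?c \<gamma> * (of_real pi * \<i> * (\<gamma> + \<epsilon> * (\<beta>0 / 2)))
        = B \<gamma> * sl \<gamma> / ?x * (C0 * (of_real pi * \<i> * (\<beta>0 * (\<epsilon> * ?x / 2))))"
      unfolding gb by simp
    thus "?c \<gamma> * (of_real pi * \<i> * (\<gamma> + \<epsilon> * (\<beta>0 / 2))) = \<epsilon> * ((\<beta>0 / cnj \<beta>0) * (B \<gamma> * sl \<gamma>))"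
      unfolding C0_cancel cancel(2)[OF n] .
  qed
  show "dz (primitive \<epsilon> B) z = e_fun (\<epsilon> * (\<beta>0 / 2)) z * psum B z"
    "dzbar (primitive \<epsilon> B) z = \<epsilon> * e_fun (\<epsilon> * (\<beta>0 / 2)) z * qsum B z"
    unfolding D psum_def qsum_def sum_distrib_left
    by (rule sum.cong[OF refl], simp only: fac e_fun_add_left, simp)+
qed

definition fam1 :: "(complex \<Rightarrow> complex) \<Rightarrow> complex \<Rightarrow> complex" where
  "fam1 A = primitive 1 A"

definition fam4 :: "(complex \<Rightarrow> complex) \<Rightarrow> complex \<Rightarrow> complex" where
  "fam4 A = primitive (-1) (\<lambda>\<gamma>. - \<i> * A \<gamma>)"

definition fam :: "(complex \<Rightarrow> complex) \<Rightarrow> complex \<Rightarrow> real^4" where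
  "fam A z = real_point (fam1 A z) (fam4 A z)"

lemma fam1_eq: "fam1 A z = (\<Sum>\<gamma>\<in>Fr. (A \<gamma> * C0 * sl \<gamma> / (1 + sl \<gamma>)) * (e_fun (\<gamma> + \<beta>0 / 2) z - 1))"
  and fam4_eq: "fam4 A z = (\<Sum>\<gamma>\<in>Fr. (- \<i> * A \<gamma> * C0 * sl \<gamma> / (1 - sl \<gamma>)) * (e_fun (\<gamma> - \<beta>0 / 2) z - 1))"
  by (simp_all add: fam1_def fam4_def primitive_def)

lemma fam_wirtinger:
  shows "dz (fam1 A) z = e_fun (\<beta>0 / 2) z * psum A z"
    "dzbar (fam1 A) z = e_fun (\<beta>0 / 2) z * qsum A z"
    "dz (fam4 A) z = - \<i> * e_fun (- (\<beta>0 / 2)) z * psum A z"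
    "dzbar (fam4 A) z = \<i> * e_fun (- (\<beta>0 / 2)) z * qsum A z"
  unfolding fam1_def fam4_def
  using primitive_wirtinger[of 1 A z] primitive_wirtinger[of "-1" "\<lambda>\<gamma>. - \<i> * A \<gamma>" z]
    psum_scale[of "- \<i>" A z] qsum_scale[of "- \<i>" A z] by simp_all

lemma F1_fam: "F1 (fam A) = fam1 A" and F4_fam: "F4 (fam A) = fam4 A"
  unfolding fam_def[abs_def] by simp_all

lemma smooth_fam: "smooth (fam A)"
proof -
  have *: "smooth (\<lambda>z. c * (e_fun \<delta> z - 1))" for c \<delta>
    using smooth_add[OF smooth_e_fun_scaled[of c \<delta>] smooth_const[of "- c"]] by (simp add: algebra_simps)
  have "smooth (fam1 A)" "smooth (fam4 A)"
    unfolding fam1_def fam4_def primitive_def[abs_def] by (intro smooth_sum *)+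
  from smooth_linear_image[OF bounded_linear_real_point smooth_Pair[OF this]]
  show ?thesis by (simp add: fam_def[abs_def])
qed

lemma fam_differentiable: "fam A differentiable at z"
  using smooth_has_derivative[OF smooth_fam, of A z] unfolding differentiable_def by blast

lemma half_shift: "e_fun (- \<beta>0) z * e_fun (\<beta>0 / 2) z = e_fun (- (\<beta>0 / 2)) z"
  using e_fun_add_left[of "- \<beta>0" "\<beta>0 / 2" z] by (simp add: field_simps)

lemma fam_HSL_equation:
  "cx_mat (mat_exp (beta \<beta>0 z *\<^sub>R Jmat)) *v (cx_mat Lmat *v f_z (fam A) z) = \<i> *s f_z (fam A) z"
  unfolding HSL_equation_coords[OF fam_differentiable] F1_fam F4_fam fam_wirtinger
  by (simp add: half_shift[symmetric] mult_ac)

lemma psum_coeff: "\<gamma> \<in> shifted_dual \<Gamma> \<beta>0 \<Longrightarrow> fcoeff (psum A) \<gamma> = (if \<gamma> \<in> Fr then A \<gamma> else 0)"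
  unfolding psum_def[abs_def]
  by (rule mean_coeff_sum[OF freqs_finite]) (auto intro: shifted_diff Fr_shifted)

text \<open>
  If the map were constant then \<open>psum A\<close> would vanish identically, and so would all its Fourier coefficients
  \<open>A \<gamma>\<close>.
\<close>

lemma fam_in_HSL:
  assumes "\<exists>\<gamma>\<in>Fr. A \<gamma> \<noteq> 0"
  shows "fam A \<in> HSL"
  unfolding based_HSL_def
proof (intro CollectI conjI allI ballI)
  fix z w assume w: "w \<in> \<Gamma>"
  have "e_fun \<delta> (z + w) = e_fun \<delta> z" if "\<delta> \<in> dual_lattice \<Gamma>" for \<delta>
    using that w by (simp add: e_fun_add_right dual_lattice_def e_fun_integral)
  hence "fam1 A (z + w) = fam1 A z" "fam4 A (z + w) = fam4 A z"
    unfolding fam1_eq fam4_eq by (auto intro!: sum.cong simp: Fr_dual)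
  thus "fam A (z + w) = fam A z" by (simp add: fam_def)
next
  show "smooth (fam A)" by (rule smooth_fam)
  show "fam A 0 = 0" by (simp add: fam_def fam1_eq fam4_eq)
  show "cx_mat (mat_exp (beta \<beta>0 z *\<^sub>R Jmat)) *v (cx_mat Lmat *v f_z (fam A) z) = \<i> *s f_z (fam A) z" for z
    by (rule fam_HSL_equation)
  show "\<nexists>c. \<forall>z. fam A z = c"
  proof
    assume "\<exists>c. \<forall>z. fam A z = c"
    then obtain c where "\<forall>z. fam A z = c" ..
    hence "fam1 A = (\<lambda>z. coord 1 (cx_vec c))" unfolding F1_fam[symmetric] F1_def[abs_def] by simp
    hence "dz (fam1 A) z = 0" for z by (simp add: dz_def)
    hence "psum A z = 0" for z unfolding fam_wirtinger by simp
    hence "psum A = (\<lambda>z. 0)" by (intro ext)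
    hence "A \<gamma> = 0" if "\<gamma> \<in> Fr" for \<gamma>
      using psum_coeff[OF Fr_shifted[OF that], of A] that by (simp add: mean_coeff_def)
    thus False using assms by blast
  qed
qed

lemma primitive_from_coeffs:
  assumes \<epsilon>: "\<epsilon> = 1 \<or> \<epsilon> = -1"
    and g: "smooth g" "\<And>z w. w \<in> \<Gamma> \<Longrightarrow> g (z + w) = g z" "g 0 = 0"
    and off: "\<And>\<delta>. \<delta> \<in> dual_lattice \<Gamma> \<Longrightarrow> \<delta> - \<epsilon> * (\<beta>0 / 2) \<notin> Fr \<Longrightarrow> \<delta> \<noteq> 0 \<Longrightarrow> fcoeff g \<delta> = 0"
    and on: "\<And>\<gamma>. \<gamma> \<in> Fr \<Longrightarrow> fcoeff g (\<gamma> + \<epsilon> * (\<beta>0 / 2)) = B \<gamma> * C0 * sl \<gamma> / (1 + \<epsilon> * sl \<gamma>)"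
  shows "g z = primitive \<epsilon> B z"
proof -
  let ?sh = "\<lambda>\<gamma>. \<gamma> + \<epsilon> * (\<beta>0 / 2)"
  have nz: "?sh \<gamma> \<noteq> 0" if "\<gamma> \<in> Fr" for \<gamma>
    using that \<epsilon> unfolding freqs_def by (auto simp: add_eq_0_iff)
  have "g z = (\<Sum>\<delta>\<in>?sh ` Fr. fcoeff g \<delta> * (e_fun \<delta> z - 1))"
  proof (rule fourier_sum[OF smooth_continuous[OF g(1)] g(2,3)])
    show "fcoeff g \<delta> = 0" if d: "\<delta> \<in> dual_lattice \<Gamma>" "\<delta> \<notin> ?sh ` Fr" "\<delta> \<noteq> 0" for \<delta>
    proof (rule off[OF d(1) _ d(3)])
      have "\<delta> = ?sh (\<delta> - \<epsilon> * (\<beta>0 / 2))" by simp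
      thus "\<delta> - \<epsilon> * (\<beta>0 / 2) \<notin> Fr" using d(2) by (metis imageI)
    qed
  qed (use freqs_finite Fr_dual nz \<epsilon> in auto)
  also have "\<dots> = (\<Sum>\<gamma>\<in>Fr. fcoeff g (?sh \<gamma>) * (e_fun (?sh \<gamma>) z - 1))"
    by (rule sum.reindex_cong[of ?sh]) (auto simp: inj_on_def)
  also have "\<dots> = primitive \<epsilon> B z"
    unfolding primitive_def by (rule sum.cong[OF refl]) (simp only: on)
  finally show ?thesis .
qed

text \<open>
  The converse: the Fourier coefficients \<open>\<phi>\<close> of \<open>F1 f\<close> and \<open>\<psi>\<close> of \<open>F4 f\<close> satisfy, for each dual vector,
  two linear equations (\<open>rel\<close>), which force them to vanish off the circle of frequencies. At a frequency in \<open>Fr\<close>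
  the equations are dependent and determine \<open>\<psi>\<close> from \<open>\<phi>\<close>.
\<close>

lemma HSL_is_fam:
  assumes f: "f \<in> HSL"
  obtains A where "\<exists>\<gamma>\<in>Fr. A \<gamma> \<noteq> 0" "f = fam A"
proof -
  have per: "\<And>z w. w \<in> \<Gamma> \<Longrightarrow> f (z + w) = f z" and sm: "smooth f" and nc: "\<nexists>c. \<forall>z. f z = c" and f0: "f 0 = 0"
    and eq: "\<And>z. cx_mat (mat_exp (beta \<beta>0 z *\<^sub>R Jmat)) *v (cx_mat Lmat *v f_z f z) = \<i> *s f_z f z"
    using f unfolding based_HSL_def by blast+
  have df: "f differentiable at z" for z
    using smooth_has_derivative[OF sm, of z] unfolding differentiable_def by blast
  note s1 = F_smooth(1)[OF sm] and s4 = F_smooth(2)[OF sm]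
  have p1: "F1 f (z + w) = F1 f z" and p4: "F4 f (z + w) = F4 f z" if "w \<in> \<Gamma>" for z w
    by (simp_all add: F1_def F4_def per that)
  have z1: "F1 f 0 = 0" and z4: "F4 f 0 = 0" by (simp_all add: F1_def F4_def f0 cx_vec_def coord_def)
  define \<phi> where "\<phi> = fcoeff (F1 f)"
  define \<psi> where "\<psi> = fcoeff (F4 f)"
  have eqs: "dz (F4 f) = (\<lambda>z. - \<i> * e_fun (- \<beta>0) z * dz (F1 f) z)"
    "dzbar (F4 f) = (\<lambda>z. \<i> * e_fun (- \<beta>0) z * dzbar (F1 f) z)"
    using eq unfolding HSL_equation_coords[OF df] by (simp_all add: fun_eq_iff)
  have cd: "continuous_on UNIV (dz (F1 f))" "continuous_on UNIV (dzbar (F1 f))"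
    unfolding dz_def[abs_def] dzbar_def[abs_def]
    by (intro continuous_intros smooth_continuous_derivative[OF s1])+
  have rel: "cnj \<delta> * \<psi> \<delta> = - \<i> * cnj (\<delta> + \<beta>0) * \<phi> (\<delta> + \<beta>0)" "\<delta> * \<psi> \<delta> = \<i> * (\<delta> + \<beta>0) * \<phi> (\<delta> + \<beta>0)"
    if d: "\<delta> \<in> dual_lattice \<Gamma>" for \<delta>
  proof -
    note d' = dual_add[OF d beta_dual]
    have "of_real pi * \<i> * cnj \<delta> * \<psi> \<delta> = - \<i> * (of_real pi * \<i> * cnj (\<delta> + \<beta>0) * \<phi> (\<delta> + \<beta>0))"
    proof -
      have "fcoeff (dz (F4 f)) \<delta> = - \<i> * fcoeff (dz (F1 f)) (\<delta> + \<beta>0)"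
        unfolding eqs(1) by (rule mean_coeff_shift[OF cd(1)])
      moreover have "fcoeff (dz (F4 f)) \<delta> = of_real pi * \<i> * cnj \<delta> * \<psi> \<delta>"
        unfolding \<psi>_def by (rule mean_coeff_wirtinger(1)[OF s4 p4 d])
      moreover have "fcoeff (dz (F1 f)) (\<delta> + \<beta>0) = of_real pi * \<i> * cnj (\<delta> + \<beta>0) * \<phi> (\<delta> + \<beta>0)"
        unfolding \<phi>_def by (rule mean_coeff_wirtinger(1)[OF s1 p1 d'])
      ultimately show ?thesis by (simp only:)
    qed
    hence "(of_real pi * \<i>) * (cnj \<delta> * \<psi> \<delta>) = (of_real pi * \<i>) * (- \<i> * cnj (\<delta> + \<beta>0) * \<phi> (\<delta> + \<beta>0))"
      by (simp add: mult_ac)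
    thus "cnj \<delta> * \<psi> \<delta> = - \<i> * cnj (\<delta> + \<beta>0) * \<phi> (\<delta> + \<beta>0)"
      unfolding mult_cancel_left by simp
    have "of_real pi * \<i> * \<delta> * \<psi> \<delta> = \<i> * (of_real pi * \<i> * (\<delta> + \<beta>0) * \<phi> (\<delta> + \<beta>0))"
    proof -
      have "fcoeff (dzbar (F4 f)) \<delta> = \<i> * fcoeff (dzbar (F1 f)) (\<delta> + \<beta>0)"
        unfolding eqs(2) by (rule mean_coeff_shift[OF cd(2)])
      moreover have "fcoeff (dzbar (F4 f)) \<delta> = of_real pi * \<i> * \<delta> * \<psi> \<delta>"
        unfolding \<psi>_def by (rule mean_coeff_wirtinger(2)[OF s4 p4 d])
      moreover have "fcoeff (dzbar (F1 f)) (\<delta> + \<beta>0) = of_real pi * \<i> * (\<delta> + \<beta>0) * \<phi> (\<delta> + \<beta>0)"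
        unfolding \<phi>_def by (rule mean_coeff_wirtinger(2)[OF s1 p1 d'])
      ultimately show ?thesis by (simp only:)
    qed
    hence "(of_real pi * \<i>) * (\<delta> * \<psi> \<delta>) = (of_real pi * \<i>) * (\<i> * (\<delta> + \<beta>0) * \<phi> (\<delta> + \<beta>0))"
      by (simp add: mult_ac)
    thus "\<delta> * \<psi> \<delta> = \<i> * (\<delta> + \<beta>0) * \<phi> (\<delta> + \<beta>0)"
      unfolding mult_cancel_left by simp
  qed
  have vanish: "(\<delta> + \<beta>0 = 0 \<or> \<phi> (\<delta> + \<beta>0) = 0) \<and> (\<delta> = 0 \<or> \<psi> \<delta> = 0)"
    if d: "\<delta> \<in> dual_lattice \<Gamma>" and nf: "\<delta> + \<beta>0 / 2 \<notin> Fr" for \<delta>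
  proof -
    \<comment> \<open>the determinant of the two equations\<close>
    have bracket: "cnj \<delta> * (\<delta> + \<beta>0) + \<delta> * cnj (\<delta> + \<beta>0) = 2 * of_real ((norm (\<delta> + \<beta>0 / 2))\<^sup>2 - (norm \<beta>0 / 2)\<^sup>2)"
      unfolding power_divide cmod_power2 by (simp add: complex_eq_iff power2_eq_square field_simps)
    have "\<i> * (cnj \<delta> * (\<delta> + \<beta>0) + \<delta> * cnj (\<delta> + \<beta>0)) * \<phi> (\<delta> + \<beta>0)
        = cnj \<delta> * (\<i> * (\<delta> + \<beta>0) * \<phi> (\<delta> + \<beta>0)) - \<delta> * (- \<i> * cnj (\<delta> + \<beta>0) * \<phi> (\<delta> + \<beta>0))"
      by (simp add: algebra_simps)
    also have "\<dots> = 0" unfolding rel[OF d, symmetric] by simp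
    finally have 0: "of_real ((norm (\<delta> + \<beta>0 / 2))\<^sup>2 - (norm \<beta>0 / 2)\<^sup>2) * \<phi> (\<delta> + \<beta>0) = 0"
      unfolding bracket by simp
    have sh: "\<delta> + \<beta>0 / 2 \<in> shifted_dual \<Gamma> \<beta>0" using d by (simp add: shifted_iff)
    show ?thesis
    proof (cases "norm (\<delta> + \<beta>0 / 2) = norm \<beta>0 / 2")
      case True
      \<comment> \<open>the two excluded points of the circle; there one equation still kills one coefficient\<close>
      hence "\<delta> + \<beta>0 / 2 = \<beta>0 / 2 \<or> \<delta> + \<beta>0 / 2 = - (\<beta>0 / 2)"
        using nf sh unfolding freqs_def by auto
      moreover have "\<delta> + \<beta>0 = (\<delta> + \<beta>0 / 2) + \<beta>0 / 2" by simp
      ultimately have "\<delta> = 0 \<or> \<delta> + \<beta>0 = 0" by (metis add_cancel_left_left add.left_inverse)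
      thus ?thesis using rel(2)[OF d] beta_nonzero by auto
    next
      case False
      hence "(norm (\<delta> + \<beta>0 / 2))\<^sup>2 \<noteq> (norm \<beta>0 / 2)\<^sup>2" by simp
      hence "\<phi> (\<delta> + \<beta>0) = 0" using 0 by (simp del: of_real_diff)
      thus ?thesis using rel(2)[OF d] by auto
    qed
  qed
  define A where "A \<gamma> = \<phi> (\<gamma> + \<beta>0 / 2) * (1 + sl \<gamma>) / (C0 * sl \<gamma>)" for \<gamma>
  have A1: "A \<gamma> * C0 * sl \<gamma> / (1 + sl \<gamma>) = \<phi> (\<gamma> + \<beta>0 / 2)" if "\<gamma> \<in> Fr" for \<gamma>
    using slope_special[OF that] C0_nonzero by (simp add: A_def)
  have A4: "- \<i> * A \<gamma> * C0 * sl \<gamma> / (1 - sl \<gamma>) = \<psi> (\<gamma> - \<beta>0 / 2)" if g: "\<gamma> \<in> Fr" for \<gamma>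
  proof -
    note n = slope_special[OF g]
    have e1: "\<gamma> - \<beta>0 / 2 = (\<beta>0 / 2) * (- (1 - sl \<gamma>))" "\<gamma> - \<beta>0 / 2 + \<beta>0 = (\<beta>0 / 2) * (1 + sl \<gamma>)"
      using from_slope[of \<gamma>] by (simp_all add: algebra_simps)
    have e2: "\<gamma> - \<beta>0 / 2 + \<beta>0 = \<gamma> + \<beta>0 / 2" by simp
    have "(\<beta>0 / 2) * (- (1 - sl \<gamma>)) * \<psi> (\<gamma> - \<beta>0 / 2) = \<i> * ((\<beta>0 / 2) * (1 + sl \<gamma>)) * \<phi> (\<gamma> + \<beta>0 / 2)"
      using rel(2)[OF Fr_dual(2)[OF g]] e1 e2 by metis
    hence "- ((\<beta>0 / 2) * (- (1 - sl \<gamma>)) * \<psi> (\<gamma> - \<beta>0 / 2)) = - (\<i> * ((\<beta>0 / 2) * (1 + sl \<gamma>)) * \<phi> (\<gamma> + \<beta>0 / 2))"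
      by (rule arg_cong)
    hence "(\<beta>0 / 2) * ((1 - sl \<gamma>) * \<psi> (\<gamma> - \<beta>0 / 2)) = (\<beta>0 / 2) * (- \<i> * (1 + sl \<gamma>) * \<phi> (\<gamma> + \<beta>0 / 2))"
      by (simp only: mult_minus_left mult_minus_right minus_minus mult_ac)
    hence "(1 - sl \<gamma>) * \<psi> (\<gamma> - \<beta>0 / 2) = - \<i> * (1 + sl \<gamma>) * \<phi> (\<gamma> + \<beta>0 / 2)"
      unfolding mult_cancel_left using beta_nonzero by simp
    also have "\<dots> = - \<i> * A \<gamma> * C0 * sl \<gamma>"
      unfolding A1[OF g, symmetric] using n by simp
    finally have x: "(1 - sl \<gamma>) * \<psi> (\<gamma> - \<beta>0 / 2) = - \<i> * A \<gamma> * C0 * sl \<gamma>" .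
    show ?thesis unfolding x[symmetric] using n by simp
  qed
  have "F1 f z = fam1 A z" for z
    unfolding fam1_def
  proof (rule primitive_from_coeffs[OF _ s1 p1 z1])
    fix \<delta> assume d: "\<delta> \<in> dual_lattice \<Gamma>" "\<delta> - 1 * (\<beta>0 / 2) \<notin> Fr" "\<delta> \<noteq> 0"
    have "\<delta> - \<beta>0 + \<beta>0 / 2 \<notin> Fr" using d(2) by (simp add: algebra_simps)
    from vanish[OF dual_diff[OF d(1) beta_dual] this]
    show "fcoeff (F1 f) \<delta> = 0" using d(3) by (simp add: \<phi>_def)
  qed (use A1 in \<open>simp_all add: \<phi>_def\<close>)
  moreover have "F4 f z = fam4 A z" for z
    unfolding fam4_def
  proof (rule primitive_from_coeffs[OF _ s4 p4 z4])
    fix \<delta> assume d: "\<delta> \<in> dual_lattice \<Gamma>" "\<delta> - (-1) * (\<beta>0 / 2) \<notin> Fr" "\<delta> \<noteq> 0"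
    have "\<delta> + \<beta>0 / 2 \<notin> Fr" using d(2) by simp
    from vanish[OF d(1) this] show "fcoeff (F4 f) \<delta> = 0" using d(3) by (simp add: \<psi>_def)
  qed (use A4 in \<open>simp_all add: \<psi>_def\<close>)
  ultimately have fA: "f = fam A"
    unfolding F1_F4_determine F1_fam F4_fam by (simp add: fun_eq_iff)
  have "\<exists>\<gamma>\<in>Fr. A \<gamma> \<noteq> 0"
  proof (rule ccontr)
    assume "\<not> (\<exists>\<gamma>\<in>Fr. A \<gamma> \<noteq> 0)"
    hence "fam A z = 0" for z by (simp add: fam_def fam1_eq fam4_eq)
    thus False using nc fA by blast
  qed
  thus thesis using that fA by blast
qed

end

section \<open>The polynomial Killing field\<close>

lemma continuous_from_coords:
  assumes "\<And>k. continuous_on S (\<lambda>z. coord k (u z))"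
  shows "continuous_on S u"
proof -
  have "continuous_on S (\<lambda>z. \<chi> i. \<Sum>k\<in>UNIV. coord k (u z) * v_basis k $ i)"
    by (intro continuous_intros assms)
  moreover have "(\<chi> i. \<Sum>k\<in>UNIV. coord k (u z) * v_basis k $ i) = u z" for z
    by (subst (2) basis_expansion) (simp add: Finite_Cartesian_Product.vec_eq_iff)
  ultimately show ?thesis by simp
qed

lemma bounded_linear_scale_vec: "bounded_linear (\<lambda>c. c *s (v :: complex^4))"
  by (rule linear_conv_bounded_linear[THEN iffD1], rule linearI)
     (auto simp: Finite_Cartesian_Product.vec_eq_iff algebra_simps)

lemma poly_sum_upto: "degree p \<le> d \<Longrightarrow> poly p x = (\<Sum>n\<le>d. coeff p n * x ^ n)"
  for p :: "complex poly"
  unfolding poly_altdef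
  by (rule sum.mono_neutral_left) (auto simp: coeff_eq_0)

lemma smooth_poly:
  fixes Y :: "complex \<Rightarrow> complex poly"
  assumes "\<And>z. degree (Y z) \<le> d" "\<And>n. smooth (\<lambda>z. coeff (Y z) n)"
  shows "smooth (\<lambda>z. poly (Y z) lam)"
proof -
  have "smooth (\<lambda>z. \<Sum>n\<le>d. coeff (Y z) n * lam ^ n)"
    by (intro smooth_sum smooth_linear_image[OF bounded_linear_mult_left assms(2)])
  thus ?thesis using poly_sum_upto[OF assms(1)] by simp
qed

lemma frechet_derivative_poly:
  fixes Y :: "complex \<Rightarrow> complex poly"
  assumes "\<And>z. degree (Y z) \<le> d" "\<And>n. smooth (\<lambda>z. coeff (Y z) n)"
  shows "frechet_derivative (\<lambda>z. poly (Y z) lam) (at z) w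
    = (\<Sum>n\<le>d. frechet_derivative (\<lambda>z. coeff (Y z) n) (at z) w * lam ^ n)"
proof -
  have "((\<lambda>z. \<Sum>n\<le>d. coeff (Y z) n * lam ^ n) has_derivative
     (\<lambda>w. \<Sum>n\<le>d. frechet_derivative (\<lambda>z. coeff (Y z) n) (at z) w * lam ^ n)) (at z)"
    by (intro has_derivative_sum bounded_linear.has_derivative[OF bounded_linear_mult_left]
        smooth_has_derivative assms(2))
  hence "((\<lambda>z. poly (Y z) lam) has_derivative
     (\<lambda>w. \<Sum>n\<le>d. frechet_derivative (\<lambda>z. coeff (Y z) n) (at z) w * lam ^ n)) (at z)"
    using poly_sum_upto[OF assms(1)] by simp
  from frechet_derivative_at[OF this, symmetric] show ?thesis by simp
qed

text \<open>
  Since \<open>J\<close> is diagonal the equation for \<open>x\<close> decouples into four scalar equations.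
\<close>

lemma is_x_coords:
  "is_x \<Gamma> \<beta>0 f X \<longleftrightarrow>
     (\<exists>d. \<forall>z k. degree (X z $ k) \<le> d) \<and> (\<forall>k n. smooth (\<lambda>z. coeff (X z $ k) n)) \<and>
     (\<forall>lam z w k. lam \<noteq> 0 \<longrightarrow>
        frechet_derivative (\<lambda>z. poly (X z $ k) lam) (at z) w
          + of_real (pi / 2) * (inverse lam * cnj \<beta>0 * w + lam * \<beta>0 * cnj w)
              * (\<i> * of_real (Jsign k) * poly (X z $ k) lam)
        = p_f \<Gamma> \<beta>0 f lam * (w * coord k (gauged_f_z \<beta>0 f z) + lam * cnj w * coord k (gauged_f_zbar \<beta>0 f z)))"
proof -
  have x: "coord k (x_val X lam z) = poly (X z $ k) lam" for k lam z
    unfolding x_val_def coord_basis_sum ..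
  have iff: "frechet_derivative (x_val X lam) (at z) w
          + (of_real (pi / 2) * (inverse lam * cnj \<beta>0 * w + lam * \<beta>0 * cnj w)) *s (cx_mat Jmat *v x_val X lam z)
        = p_f \<Gamma> \<beta>0 f lam *s (w *s gauged_f_z \<beta>0 f z + (lam * cnj w) *s gauged_f_zbar \<beta>0 f z)
     \<longleftrightarrow> (\<forall>k. frechet_derivative (\<lambda>z. poly (X z $ k) lam) (at z) w
          + of_real (pi / 2) * (inverse lam * cnj \<beta>0 * w + lam * \<beta>0 * cnj w)
              * (\<i> * of_real (Jsign k) * poly (X z $ k) lam)
        = p_f \<Gamma> \<beta>0 f lam * (w * coord k (gauged_f_z \<beta>0 f z) + lam * cnj w * coord k (gauged_f_zbar \<beta>0 f z)))"
    (is "?L = ?R \<longleftrightarrow> (\<forall>k. ?l k = ?r k)")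
    if deg: "\<forall>z k. degree (X z $ k) \<le> d" and sm: "\<forall>k n. smooth (\<lambda>z. coeff (X z $ k) n)" for d lam z w
  proof -
    have "smooth (\<lambda>z. \<Sum>k\<in>UNIV. poly (X z $ k) lam *s v_basis k)"
      by (intro smooth_sum smooth_linear_image[OF bounded_linear_scale_vec] smooth_poly[of _ d])
         (use deg sm in auto)
    hence "x_val X lam differentiable at z"
      using smooth_has_derivative unfolding x_val_def[abs_def] differentiable_def by blast
    from frechet_derivative_linear_image[OF bounded_linear_coord this]
    have D: "coord k (frechet_derivative (x_val X lam) (at z) w) = frechet_derivative (\<lambda>z. poly (X z $ k) lam) (at z) w" for k
      by (simp add: x)
    have "coord k ?L = ?l k" "coord k ?R = ?r k" for k
      unfolding coord_add coord_scale coord_J D x by simp_all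
    thus ?thesis using coord_eqI[of ?L ?R] by metis
  qed
  show ?thesis
    unfolding is_x_def using iff by blast
qed

text \<open>
  The difference \<open>r\<close> of two solutions satisfies the homogeneous equation. Multiplied by \<open>\<lambda>\<close> this is a
  polynomial identity, and its coefficient of \<open>\<lambda>\<^sup>n\<close> expresses \<open>r\<^sub>n\<close> through a derivative of \<open>r\<^sub>n\<^sub>-\<^sub>1\<close> and
  \<open>r\<^sub>n\<^sub>-\<^sub>2\<close>, so all coefficients vanish by induction.
\<close>

lemma is_x_unique:
  assumes X: "is_x \<Gamma> \<beta>0 f X" and Y: "is_x \<Gamma> \<beta>0 f Y" and b: "\<beta>0 \<noteq> 0"
  shows "X = Y"
proof -
  obtain dX dY where dX: "\<And>z k. degree (X z $ k) \<le> dX" and dY: "\<And>z k. degree (Y z $ k) \<le> dY"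
    using X Y unfolding is_x_def by blast
  have sX: "\<And>k n. smooth (\<lambda>z. coeff (X z $ k) n)" and sY: "\<And>k n. smooth (\<lambda>z. coeff (Y z $ k) n)"
    using X Y unfolding is_x_def by blast+
  define d where "d = max dX dY"
  have degs: "degree (X z $ k) \<le> d" "degree (Y z $ k) \<le> d" for z k
    using dX[of z k] dY[of z k] unfolding d_def by linarith+
  have "coeff (X z $ k) n = coeff (Y z $ k) n" for z k n
  proof -
    define r where "r z = X z $ k - Y z $ k" for z
    define D where "D n z = frechet_derivative (\<lambda>z. coeff (X z $ k) n) (at z) 1
        - frechet_derivative (\<lambda>z. coeff (Y z $ k) n) (at z) 1" for n z
    define K where "K = of_real (pi / 2) * (\<i> * complex_of_real (Jsign k))"
    have K: "K \<noteq> 0" unfolding K_def by (auto simp: Jsign_def)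
    define Q where "Q z = pCons 0 (\<Sum>n\<le>d. monom (D n z) n) + Polynomial.smult (K * cnj \<beta>0) (r z)
        + Polynomial.smult (K * \<beta>0) (pCons 0 (pCons 0 (r z)))" for z
    have "poly (Q z) lam = 0" if lam: "lam \<noteq> 0" for z lam
    proof -
      have eX: "frechet_derivative (\<lambda>z. poly (X z $ k) lam) (at z) 1
          + of_real (pi / 2) * (inverse lam * cnj \<beta>0 * 1 + lam * \<beta>0 * cnj 1)
              * (\<i> * of_real (Jsign k) * poly (X z $ k) lam)
        = p_f \<Gamma> \<beta>0 f lam * (1 * coord k (gauged_f_z \<beta>0 f z) + lam * cnj 1 * coord k (gauged_f_zbar \<beta>0 f z))"
        using X lam unfolding is_x_coords by blast
      have eY: "frechet_derivative (\<lambda>z. poly (Y z $ k) lam) (at z) 1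
          + of_real (pi / 2) * (inverse lam * cnj \<beta>0 * 1 + lam * \<beta>0 * cnj 1)
              * (\<i> * of_real (Jsign k) * poly (Y z $ k) lam)
        = p_f \<Gamma> \<beta>0 f lam * (1 * coord k (gauged_f_z \<beta>0 f z) + lam * cnj 1 * coord k (gauged_f_zbar \<beta>0 f z))"
        using Y lam unfolding is_x_coords by blast
      have "(\<Sum>n\<le>d. D n z * lam ^ n) + K * (inverse lam * cnj \<beta>0 + lam * \<beta>0) * poly (r z) lam = 0"
      proof -
        have lin: "(sx - sy) + (c * u) * b * (px - py) = 0"
          if "sx + c * b * (u * px) = R" "sy + c * b * (u * py) = R" for sx sy c b u px py R :: complex
        proof -
          have "(sx - sy) + (c * u) * b * (px - py) = (sx + c * b * (u * px)) - (sy + c * b * (u * py))"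
            by (simp add: algebra_simps)
          thus ?thesis using that by simp
        qed
        have "(\<Sum>n\<le>d. D n z * lam ^ n) = frechet_derivative (\<lambda>z. poly (X z $ k) lam) (at z) 1
            - frechet_derivative (\<lambda>z. poly (Y z $ k) lam) (at z) 1"
          unfolding frechet_derivative_poly[OF degs(1) sX] frechet_derivative_poly[OF degs(2) sY] D_def
          by (simp add: left_diff_distrib sum_subtractf)
        thus ?thesis using lin[OF eX eY] unfolding K_def r_def poly_diff by simp
      qed
      hence "lam * ((\<Sum>n\<le>d. D n z * lam ^ n) + K * (inverse lam * cnj \<beta>0 + lam * \<beta>0) * poly (r z) lam) = 0"
        by simp
      moreover have "lam * (y * (inverse lam * x)) = y * x" for x y
        using lam by simp
      ultimately show ?thesis unfolding Q_def
        by (simp add: poly_sum poly_monom algebra_simps)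
    qed
    hence "UNIV - {0} \<subseteq> {lam. poly (Q z) lam = 0}" for z by auto
    moreover have "infinite (UNIV - {0 :: complex})" by (simp add: infinite_UNIV_char_0)
    ultimately have Q0: "Q z = 0" for z using poly_roots_finite[of "Q z"] finite_subset by blast
    have "\<forall>z. coeff (r z) n = 0"
    proof (induction n rule: less_induct)
      case (less n)
      show ?case
      proof
        fix z
        have D0: "D m z = 0" if "m < n" for m
        proof -
          have "(\<lambda>z. coeff (X z $ k) m) = (\<lambda>z. coeff (Y z $ k) m)"
            using less[OF that] unfolding r_def by (simp add: fun_eq_iff)
          thus ?thesis unfolding D_def by simp
        qed
        have "coeff (Q z) n = K * cnj \<beta>0 * coeff (r z) n"
        proof (cases n)
          case 0 thus ?thesis by (simp add: Q_def)
        next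
          case (Suc m)
          have "coeff (\<Sum>i\<le>d. monom (D i z) i) m = (if m \<le> d then D m z else 0)"
            by (simp add: coeff_sum)
          moreover have "D m z = 0" using D0 Suc by simp
          moreover have "coeff (pCons 0 (Polynomial.smult (K * \<beta>0) (r z))) m = 0"
            using less Suc by (cases m) auto
          ultimately show ?thesis using Suc by (simp add: Q_def)
        qed
        thus "coeff (r z) n = 0" using Q0 K b by simp
      qed
    qed
    thus ?thesis unfolding r_def by simp
  qed
  thus ?thesis by (simp add: fun_eq_iff Finite_Cartesian_Product.vec_eq_iff poly_eq_iff)
qed

context hsl_lattice begin

text \<open>
  The Fourier coefficients of the third coordinate of \<open>e\<^sup>-\<^sup>J\<^sup>\<beta>\<^sup>/\<^sup>2 f\<^sub>z\<close>, which is the conjugate of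
  \<open>qsum A\<close>; see \<open>cnj_qsum\<close>.
\<close>

definition conj_coeffs :: "(complex \<Rightarrow> complex) \<Rightarrow> complex \<Rightarrow> complex" where
  "conj_coeffs A \<gamma> = - cnj (A (- \<gamma>)) * cnj \<beta>0 / (\<beta>0 * sl \<gamma>)"

definition gauge_coeffs :: "(complex \<Rightarrow> complex) \<Rightarrow> 4 \<Rightarrow> complex \<Rightarrow> complex" where
  "gauge_coeffs A k \<gamma> = (if k = 1 then A \<gamma> else if k = 2 then - \<i> * conj_coeffs A \<gamma> else if k = 3 then conj_coeffs A \<gamma> else - \<i> * A \<gamma>)"

definition supp :: "(complex \<Rightarrow> complex) \<Rightarrow> complex set" where
  "supp A = {\<gamma> \<in> Fr. A \<gamma> \<noteq> 0 \<or> A (- \<gamma>) \<noteq> 0}"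

lemma gauge_coeffs_simps [simp]: "gauge_coeffs A 1 = A" "gauge_coeffs A 2 = (\<lambda>\<gamma>. - \<i> * conj_coeffs A \<gamma>)" "gauge_coeffs A 3 = conj_coeffs A" "gauge_coeffs A 4 = (\<lambda>\<gamma>. - \<i> * A \<gamma>)"
  unfolding gauge_coeffs_def[abs_def] by simp_all

lemma sum_Fr_minus: "(\<Sum>\<gamma>\<in>Fr. g (- \<gamma>)) = (\<Sum>\<gamma>\<in>Fr. g \<gamma>)"
  by (rule sum.reindex_bij_witness[of _ uminus uminus]) auto

lemma cnj_qsum: "cnj (qsum A z) = psum (conj_coeffs A) z"
proof -
  have "cnj (qsum A z) = (\<Sum>\<gamma>\<in>Fr. cnj \<beta>0 / \<beta>0 * (cnj (A \<gamma>) * cnj (sl \<gamma>) * e_fun (- \<gamma>) z))"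
    by (simp add: qsum_def e_fun_minus sum_distrib_left)
  also have "\<dots> = (\<Sum>\<gamma>\<in>Fr. cnj \<beta>0 / \<beta>0 * (cnj (A (- \<gamma>)) * cnj (sl (- \<gamma>)) * e_fun (- (- \<gamma>)) z))"
    by (rule sum_Fr_minus[symmetric])
  also have "\<dots> = psum (conj_coeffs A) z"
    unfolding psum_def by (rule sum.cong) (simp_all add: conj_coeffs_def cnj_slope)
  finally show ?thesis .
qed

lemma cnj_psum: "cnj (psum A z) = - qsum (conj_coeffs A) z"
proof -
  have "cnj (psum A z) = (\<Sum>\<gamma>\<in>Fr. cnj (A \<gamma>) * e_fun (- \<gamma>) z)"
    by (simp add: psum_def e_fun_minus)
  also have "\<dots> = (\<Sum>\<gamma>\<in>Fr. cnj (A (- \<gamma>)) * e_fun (- (- \<gamma>)) z)"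
    by (rule sum_Fr_minus[symmetric])
  also have "\<dots> = (\<Sum>\<gamma>\<in>Fr. - (\<beta>0 / cnj \<beta>0 * (conj_coeffs A \<gamma> * sl \<gamma> * e_fun \<gamma> z)))"
    by (rule sum.cong) (use beta_nonzero slope_special(1) in \<open>simp_all add: conj_coeffs_def\<close>)
  finally show ?thesis by (simp add: qsum_def sum_negf sum_distrib_left)
qed

lemma e_half [simp]:
  "e_fun (\<beta>0 / 2) z * (e_fun (- (\<beta>0 / 2)) z * x) = x"
  "e_fun (- (\<beta>0 / 2)) z * (e_fun (\<beta>0 / 2) z * x) = x"
  by (simp_all add: mult.assoc[symmetric])

text \<open>
  All four coordinates of both gauged derivatives follow one pattern, up to the sign of the eigenvalue of
  \<open>J\<close>. This allows the four equations for \<open>x\<close> to be solved together.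
\<close>

lemma coord_gauged_fam:
  "coord k (gauged_f_z \<beta>0 (fam A) z) = psum (gauge_coeffs A k) z"
  "coord k (gauged_f_zbar \<beta>0 (fam A) z) = of_real (Jsign k) * qsum (gauge_coeffs A k) z"
proof -
  have c: "cnj (e_fun (\<beta>0 / 2) z) = e_fun (- (\<beta>0 / 2)) z" "cnj (e_fun (- (\<beta>0 / 2)) z) = e_fun (\<beta>0 / 2) z"
    by (simp_all add: e_fun_minus)
  have m: "psum (\<lambda>\<gamma>. - (\<i> * B \<gamma>)) z = - (\<i> * psum B z)" "qsum (\<lambda>\<gamma>. - (\<i> * B \<gamma>)) z = - (\<i> * qsum B z)" for B
    using psum_scale[of "- \<i>" B z] qsum_scale[of "- \<i>" B z] by simp_all
  note simps = coord_gauged[OF fam_differentiable] F1_fam F4_fam fam_wirtinger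
  have "\<forall>k. coord k (gauged_f_z \<beta>0 (fam A) z) = psum (gauge_coeffs A k) z"
    unfolding forall_4 simps by (simp add: c cnj_qsum m mult_ac)
  moreover have "\<forall>k. coord k (gauged_f_zbar \<beta>0 (fam A) z) = of_real (Jsign k) * qsum (gauge_coeffs A k) z"
    unfolding forall_4 simps by (simp add: c cnj_psum m mult_ac)
  ultimately show "coord k (gauged_f_z \<beta>0 (fam A) z) = psum (gauge_coeffs A k) z"
    "coord k (gauged_f_zbar \<beta>0 (fam A) z) = of_real (Jsign k) * qsum (gauge_coeffs A k) z" by blast+
qed

lemma Delta_fam: "Delta \<Gamma> \<beta>0 (fam A) = supp A"
proof -
  have "continuous_on UNIV (gauged_f_z \<beta>0 (fam A))"
    by (rule continuous_from_coords) (auto simp: coord_gauged_fam psum_def intro!: continuous_intros)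
  from coord_fourier_coeff[OF this some_basis]
  have fc: "coord k (fourier_coeff \<Gamma> (gauged_f_z \<beta>0 (fam A)) \<gamma>) = (if \<gamma> \<in> Fr then gauge_coeffs A k \<gamma> else 0)"
    if "\<gamma> \<in> shifted_dual \<Gamma> \<beta>0" for k \<gamma>
    using psum_coeff[OF that, of "gauge_coeffs A k"] by (simp add: coord_gauged_fam)
  have "fourier_coeff \<Gamma> (gauged_f_z \<beta>0 (fam A)) \<gamma> \<noteq> 0 \<longleftrightarrow> \<gamma> \<in> Fr \<and> (A \<gamma> \<noteq> 0 \<or> A (- \<gamma>) \<noteq> 0)"
    if g: "\<gamma> \<in> shifted_dual \<Gamma> \<beta>0" for \<gamma>
    unfolding coord_eq_iff fc[OF g] using beta_nonzero slope_special(1)[of \<gamma>] by (auto simp: conj_coeffs_def)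
  thus ?thesis unfolding Delta_def supp_def using Fr_shifted by blast
qed

lemma supp_subset: "supp A \<subseteq> Fr" and supp_finite: "finite (supp A)" and supp_minus: "- \<gamma> \<in> supp A \<longleftrightarrow> \<gamma> \<in> supp A"
  using freqs_finite unfolding supp_def by auto

lemma gauge_coeffs_outside: "\<gamma> \<in> Fr \<Longrightarrow> \<gamma> \<notin> supp A \<Longrightarrow> gauge_coeffs A k \<gamma> = 0"
  by (simp add: supp_def gauge_coeffs_def conj_coeffs_def)

lemma p_f_fam: "p_f \<Gamma> \<beta>0 (fam A) lam = (\<Prod>\<gamma>\<in>supp A. lam - sl \<gamma>)"
  unfolding p_f_def Delta_fam by (subst prod.reindex) (auto intro: inj_on_subset[OF slope_inj])

text \<open>
The polynomial \<open>p\<^sub>\<Delta>(\<lambda>) / (\<lambda> - s\<^sub>\<gamma>)\<close>, for \<open>\<gamma> \<in> \<Delta>\<close>.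
\<close>

definition omit :: "complex set \<Rightarrow> complex \<Rightarrow> complex poly" where
  "omit \<Delta> \<gamma> = (\<Prod>\<delta>\<in>\<Delta> - {\<gamma>}. [:- sl \<delta>, 1:])"

lemma poly_omit: "poly (omit \<Delta> \<gamma>) x = (\<Prod>\<delta>\<in>\<Delta> - {\<gamma>}. x - sl \<delta>)"
  by (simp add: omit_def poly_prod)

lemma omit_complete: "finite \<Delta> \<Longrightarrow> \<gamma> \<in> \<Delta> \<Longrightarrow> (x - sl \<gamma>) * poly (omit \<Delta> \<gamma>) x = (\<Prod>\<delta>\<in>\<Delta>. x - sl \<delta>)"
  unfolding poly_omit by (rule prod.remove[symmetric])

lemma omit_degree: "finite \<Delta> \<Longrightarrow> \<gamma> \<in> \<Delta> \<Longrightarrow> degree (omit \<Delta> \<gamma>) = card \<Delta> - 1"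
  unfolding omit_def by (subst degree_prod_sum_eq) auto

lemma omit_degree_le: "finite \<Delta> \<Longrightarrow> degree (omit \<Delta> \<gamma>) \<le> card \<Delta>"
  unfolding omit_def by (subst degree_prod_sum_eq) (auto intro!: card_mono)

lemma omit_at_other: "finite \<Delta> \<Longrightarrow> \<delta> \<in> \<Delta> \<Longrightarrow> \<delta> \<noteq> \<gamma> \<Longrightarrow> poly (omit \<Delta> \<gamma>) (sl \<delta>) = 0"
  unfolding poly_omit by (subst prod_zero_iff) auto

lemma omit_at_own: "finite \<Delta> \<Longrightarrow> poly (omit \<Delta> \<gamma>) (sl \<gamma>) \<noteq> 0"
  unfolding poly_omit by (auto simp: slope_eq_iff)

text \<open>
  At the frequency \<open>\<gamma>\<close> the equation for \<open>x\<^sup>(\<^sup>k\<^sup>)\<close> requires division by \<open>\<lambda> + s\<^sub>\<gamma>\<close> if \<open>J v\<^sub>k = \<i> v\<^sub>k\<close>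
  and by \<open>\<lambda> - s\<^sub>\<gamma>\<close> otherwise; the slope of \<open>twist k \<gamma>\<close> is the zero of that factor. The symmetry of \<open>\<Delta>\<close> ensures
  that the factor divides \<open>p\<^sub>f\<close>.
\<close>

definition twist :: "4 \<Rightarrow> complex \<Rightarrow> complex" where
  "twist k \<gamma> = (if k = 1 \<or> k = 2 then - \<gamma> else \<gamma>)"

lemma slope_twist: "sl (twist k \<gamma>) = - (of_real (Jsign k) * sl \<gamma>)"
  by (simp add: twist_def Jsign_def)

definition killing :: "(complex \<Rightarrow> complex) \<Rightarrow> complex \<Rightarrow> complex poly ^ 4" where
  "killing A z = (\<chi> k. \<Sum>\<gamma>\<in>supp A.
      Polynomial.smult (C0 * sl \<gamma> * gauge_coeffs A k \<gamma> * e_fun \<gamma> z) (pCons 0 (omit (supp A) (twist k \<gamma>))))"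

lemma killing_nth: "killing A z $ k = (\<Sum>\<gamma>\<in>supp A.
      Polynomial.smult (C0 * sl \<gamma> * gauge_coeffs A k \<gamma> * e_fun \<gamma> z) (pCons 0 (omit (supp A) (twist k \<gamma>))))"
  by (simp add: killing_def)

text \<open>
  Applied to a single term \<open>c e\<^sub>\<gamma>\<close>, the left-hand side becomes multiplication by
  a constant times \<open>1/s + \<sigma>/\<lambda>\<close> in the \<open>dz\<close> part and times \<open>s + \<sigma>\<lambda>\<close> in the conjugate part. Both contain the
  factor \<open>\<lambda> + \<sigma>s\<close>, which is completed to \<open>p\<^sub>f\<close>.
\<close>

lemma killing_is_x: "is_x \<Gamma> \<beta>0 (fam A) (killing A)"
  unfolding is_x_coords
proof (intro conjI allI impI)
  let ?d = "Suc (card (supp A))"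
  have "degree (killing A z $ k) \<le> ?d" for z k
    unfolding killing_nth
  proof (rule degree_sum_le[OF supp_finite])
    fix \<gamma>
    have "degree (pCons 0 (omit (supp A) (twist k \<gamma>))) \<le> ?d"
      using degree_pCons_le[of 0 "omit (supp A) (twist k \<gamma>)"] omit_degree_le[OF supp_finite, of A "twist k \<gamma>"] by linarith
    thus "degree (Polynomial.smult (C0 * sl \<gamma> * gauge_coeffs A k \<gamma> * e_fun \<gamma> z) (pCons 0 (omit (supp A) (twist k \<gamma>)))) \<le> ?d"
      using degree_smult_le le_trans by blast
  qed
  thus "\<exists>d. \<forall>z k. degree (killing A z $ k) \<le> d" by blast
next
  fix k n
  have "smooth (\<lambda>z. \<Sum>\<gamma>\<in>supp A. (C0 * sl \<gamma> * gauge_coeffs A k \<gamma> * coeff (pCons 0 (omit (supp A) (twist k \<gamma>))) n) * e_fun \<gamma> z)"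
    by (intro smooth_sum smooth_e_fun_scaled)
  thus "smooth (\<lambda>z. coeff (killing A z $ k) n)"
    unfolding killing_nth coeff_sum coeff_smult by (simp add: mult_ac)
next
  fix lam z w k assume lam: "lam \<noteq> (0 :: complex)"
  define \<sigma> where "\<sigma> = complex_of_real (Jsign k)"
  have \<sigma>: "\<sigma> * \<sigma> = 1" by (simp add: \<sigma>_def Jsign_def)
  define pf where "pf = (\<Prod>\<gamma>\<in>supp A. lam - sl \<gamma>)"
  define P where "P \<gamma> = poly (omit (supp A) (twist k \<gamma>)) lam" for \<gamma>
  have P: "(lam + \<sigma> * sl \<gamma>) * P \<gamma> = pf" if "\<gamma> \<in> supp A" for \<gamma>
    using omit_complete[OF supp_finite, of "twist k \<gamma>" A lam] that
    unfolding slope_twist P_def pf_def \<sigma>_def by (simp add: twist_def supp_minus split: if_splits)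
  have val: "poly (killing A z $ k) lam = (\<Sum>\<gamma>\<in>supp A. (C0 * sl \<gamma> * gauge_coeffs A k \<gamma> * lam * P \<gamma>) * (e_fun \<gamma> z - 0))" for z
    unfolding killing_nth poly_sum by (simp add: P_def mult_ac)
  have D: "frechet_derivative (\<lambda>z. poly (killing A z $ k) lam) (at z) w =
      (\<Sum>\<gamma>\<in>supp A. (C0 * sl \<gamma> * gauge_coeffs A k \<gamma> * lam * P \<gamma>) * (of_real pi * \<i> * cnj \<gamma>) * e_fun \<gamma> z) * w
      + (\<Sum>\<gamma>\<in>supp A. (C0 * sl \<gamma> * gauge_coeffs A k \<gamma> * lam * P \<gamma>) * (of_real pi * \<i> * \<gamma>) * e_fun \<gamma> z) * cnj w"
    unfolding val
    using frechet_derivative_at[OF e_fun_sum_has_derivative[OF supp_finite[of A], of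
        "\<lambda>\<gamma>. C0 * sl \<gamma> * gauge_coeffs A k \<gamma> * lam * P \<gamma>" "\<lambda>\<gamma>. \<gamma>" "\<lambda>_. 0" z], symmetric] by simp
  have term_w: "(C0 * sl \<gamma> * gauge_coeffs A k \<gamma> * lam * P \<gamma>) * (of_real pi * \<i> * cnj \<gamma>)
      + of_real (pi / 2) * (inverse lam * cnj \<beta>0) * (\<i> * \<sigma>) * (C0 * sl \<gamma> * gauge_coeffs A k \<gamma> * lam * P \<gamma>) = pf * gauge_coeffs A k \<gamma>"
    if g: "\<gamma> \<in> supp A" for \<gamma>
  proof -
    have gF: "\<gamma> \<in> Fr" using g supp_subset by blast
    note n = slope_special[OF gF]
    have "(C0 * sl \<gamma> * gauge_coeffs A k \<gamma> * lam * P \<gamma>) * (of_real pi * \<i> * cnj \<gamma>)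
      + of_real (pi / 2) * (inverse lam * cnj \<beta>0) * (\<i> * \<sigma>) * (C0 * sl \<gamma> * gauge_coeffs A k \<gamma> * lam * P \<gamma>)
      = sl \<gamma> * gauge_coeffs A k \<gamma> * lam * P \<gamma> * (C0 * (of_real pi * \<i> * (cnj \<beta>0 * (1 / (2 * sl \<gamma>) + inverse lam * \<sigma> / 2))))"
      unfolding cnj_freq[OF gF] by (simp add: algebra_simps)
    also have "\<dots> = gauge_coeffs A k \<gamma> * P \<gamma> * (lam * sl \<gamma> * (1 / sl \<gamma> + inverse lam * \<sigma>))"
      unfolding C0_cancel using n by (simp add: algebra_simps)
    also have "lam * sl \<gamma> * (1 / sl \<gamma> + inverse lam * \<sigma>) = lam + \<sigma> * sl \<gamma>"
      using n lam by (simp add: field_simps)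
    also have "gauge_coeffs A k \<gamma> * P \<gamma> * (lam + \<sigma> * sl \<gamma>) = pf * gauge_coeffs A k \<gamma>"
      using P[OF g] by (simp add: mult_ac)
    finally show ?thesis .
  qed
  have term_wbar: "(C0 * sl \<gamma> * gauge_coeffs A k \<gamma> * lam * P \<gamma>) * (of_real pi * \<i> * \<gamma>)
      + of_real (pi / 2) * (lam * \<beta>0) * (\<i> * \<sigma>) * (C0 * sl \<gamma> * gauge_coeffs A k \<gamma> * lam * P \<gamma>)
      = pf * (lam * \<sigma> * (\<beta>0 / cnj \<beta>0 * (gauge_coeffs A k \<gamma> * sl \<gamma>)))"
    if g: "\<gamma> \<in> supp A" for \<gamma>
  proof -
    have gb: "\<gamma> = \<beta>0 * (sl \<gamma> / 2)" using from_slope[of \<gamma>] by simp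
    have "(C0 * sl \<gamma> * gauge_coeffs A k \<gamma> * lam * P \<gamma>) * (of_real pi * \<i> * \<gamma>) =
      sl \<gamma> * gauge_coeffs A k \<gamma> * lam * P \<gamma> * (C0 * (of_real pi * \<i> * (\<beta>0 * (sl \<gamma> / 2))))"
      by (subst (4) gb) simp
    also have "\<dots> + of_real (pi / 2) * (lam * \<beta>0) * (\<i> * \<sigma>) * (C0 * sl \<gamma> * gauge_coeffs A k \<gamma> * lam * P \<gamma>)
      = sl \<gamma> * gauge_coeffs A k \<gamma> * lam * P \<gamma> * (C0 * (of_real pi * \<i> * (\<beta>0 * (sl \<gamma> / 2 + lam * \<sigma> / 2))))"
      by (simp add: algebra_simps)
    also have "\<dots> = sl \<gamma> * gauge_coeffs A k \<gamma> * lam * P \<gamma> * ((\<beta>0 / cnj \<beta>0) * (sl \<gamma> * (\<sigma> * \<sigma>) + lam * \<sigma>))"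
      unfolding C0_cancel \<sigma> by (simp add: algebra_simps)
    also have "\<dots> = ((lam + \<sigma> * sl \<gamma>) * P \<gamma>) * (lam * \<sigma> * (\<beta>0 / cnj \<beta>0 * (gauge_coeffs A k \<gamma> * sl \<gamma>)))"
      by (simp add: algebra_simps add_divide_distrib)
    finally show ?thesis unfolding P[OF g] .
  qed
  have ps: "psum (gauge_coeffs A k) z = (\<Sum>\<gamma>\<in>supp A. gauge_coeffs A k \<gamma> * e_fun \<gamma> z)"
    unfolding psum_def by (rule sum.mono_neutral_right[OF freqs_finite supp_subset]) (auto simp: gauge_coeffs_outside)
  have qs: "qsum (gauge_coeffs A k) z = (\<Sum>\<gamma>\<in>supp A. (\<beta>0 / cnj \<beta>0) * (gauge_coeffs A k \<gamma> * sl \<gamma> * e_fun \<gamma> z))"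
    unfolding qsum_def sum_distrib_left[symmetric]
    by (rule arg_cong[where f = "(*) (\<beta>0 / cnj \<beta>0)"])
       (rule sum.mono_neutral_right[OF freqs_finite supp_subset], auto simp: gauge_coeffs_outside)
  have "frechet_derivative (\<lambda>z. poly (killing A z $ k) lam) (at z) w
          + of_real (pi / 2) * (inverse lam * cnj \<beta>0 * w + lam * \<beta>0 * cnj w) * (\<i> * \<sigma> * poly (killing A z $ k) lam)
     = (\<Sum>\<gamma>\<in>supp A. w * e_fun \<gamma> z * ((C0 * sl \<gamma> * gauge_coeffs A k \<gamma> * lam * P \<gamma>) * (of_real pi * \<i> * cnj \<gamma>)
          + of_real (pi / 2) * (inverse lam * cnj \<beta>0) * (\<i> * \<sigma>) * (C0 * sl \<gamma> * gauge_coeffs A k \<gamma> * lam * P \<gamma>))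
        + cnj w * e_fun \<gamma> z * ((C0 * sl \<gamma> * gauge_coeffs A k \<gamma> * lam * P \<gamma>) * (of_real pi * \<i> * \<gamma>)
          + of_real (pi / 2) * (lam * \<beta>0) * (\<i> * \<sigma>) * (C0 * sl \<gamma> * gauge_coeffs A k \<gamma> * lam * P \<gamma>)))"
    unfolding D unfolding val
    by (simp add: sum.distrib sum_distrib_left sum_distrib_right algebra_simps)
  also have "\<dots> = (\<Sum>\<gamma>\<in>supp A. w * e_fun \<gamma> z * (pf * gauge_coeffs A k \<gamma>)
        + cnj w * e_fun \<gamma> z * (pf * (lam * \<sigma> * (\<beta>0 / cnj \<beta>0 * (gauge_coeffs A k \<gamma> * sl \<gamma>)))))"
    by (intro sum.cong refl) (simp only: term_w term_wbar)
  also have "\<dots> = pf * (w * psum (gauge_coeffs A k) z + lam * cnj w * (\<sigma> * qsum (gauge_coeffs A k) z))"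
    unfolding ps qs by (simp add: sum.distrib sum_distrib_left algebra_simps)
  finally show "frechet_derivative (\<lambda>z. poly (killing A z $ k) lam) (at z) w
          + of_real (pi / 2) * (inverse lam * cnj \<beta>0 * w + lam * \<beta>0 * cnj w)
              * (\<i> * of_real (Jsign k) * poly (killing A z $ k) lam)
        = p_f \<Gamma> \<beta>0 (fam A) lam * (w * coord k (gauged_f_z \<beta>0 (fam A) z) + lam * cnj w * coord k (gauged_f_zbar \<beta>0 (fam A) z))"
    unfolding p_f_fam coord_gauged_fam pf_def[symmetric] \<sigma>_def[symmetric] .
qed

lemma x_of_fam: "x_of \<Gamma> \<beta>0 (fam A) = killing A"
  unfolding x_of_def using killing_is_x is_x_unique beta_nonzero by (intro the_equality) blast+

end

section \<open>Zero divisors\<close>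

fun finite_part :: "riemann_sphere \<Rightarrow> complex" where
  "finite_part (Fin x) = x" | "finite_part Infty = 0"

definition finite_zeros :: "riemann_sphere multiset \<Rightarrow> complex multiset" where
  "finite_zeros E = image_mset finite_part (filter_mset (\<lambda>x. x \<noteq> Infty) E)"

lemma finite_zeros_divisor [simp]: "finite_zeros (image_mset Fin M + replicate_mset n Infty) = M"
proof -
  have "filter_mset (\<lambda>x. x \<noteq> Infty) (image_mset Fin M) = image_mset Fin M"
    by (induction M) auto
  moreover have "filter_mset (\<lambda>x. x \<noteq> Infty) (replicate_mset n Infty) = {#}"
    by (induction n) auto
  moreover have "image_mset finite_part (image_mset Fin M) = M"
    by (induction M) auto
  ultimately show ?thesis by (simp add: finite_zeros_def)
qed

lemma divisor_decompose: "image_mset Fin (finite_zeros E) + replicate_mset (count E Infty) Infty = E"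
proof (induction E)
  case (add x E)
  thus ?case by (cases x) (simp_all add: finite_zeros_def)
qed (simp add: finite_zeros_def)

lemma size_zero_divisor: "degree q \<le> d \<Longrightarrow> size (zero_divisor d q) = d"
  by (simp add: zero_divisor_def size_proots_complex)

lemma Fin_in_zero_divisor: "q \<noteq> 0 \<Longrightarrow> Fin x \<in># zero_divisor d q \<longleftrightarrow> poly q x = 0"
  by (auto simp: zero_divisor_def)

lemma zero_divisor_smult: "c \<noteq> 0 \<Longrightarrow> zero_divisor d (Polynomial.smult c q) = zero_divisor d q"
  by (simp add: zero_divisor_def)

text \<open>
  Over \<open>\<complex>\<close> a polynomial is the product of its linear factors up to its leading coefficient.
\<close>

lemma zero_divisor_eqD:
  assumes "zero_divisor d q = zero_divisor d r" "q \<noteq> 0" "r \<noteq> 0"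
  obtains c where "c \<noteq> 0" "q = Polynomial.smult c r"
proof -
  have "proots q = proots r"
    using arg_cong[OF assms(1), of finite_zeros] by (simp add: zero_divisor_def)
  moreover define R where "R = (\<Prod>x\<in>#proots r. [:- x, 1:])"
  ultimately have q: "Polynomial.smult (lead_coeff q) R = q" and r: "Polynomial.smult (lead_coeff r) R = r"
    using complex_poly_decompose_multiset[of q] complex_poly_decompose_multiset[of r] by simp_all
  have "Polynomial.smult (lead_coeff q / lead_coeff r) r = Polynomial.smult (lead_coeff q / lead_coeff r) (Polynomial.smult (lead_coeff r) R)"
    unfolding r ..
  also have "\<dots> = q" using assms(3) q by simp
  finally show thesis using that[of "lead_coeff q / lead_coeff r"] assms(2,3) by simp
qed

lemma proots_linear_factors: "finite S \<Longrightarrow> proots (\<Prod>\<delta>\<in>S. [:- g \<delta>, 1:]) = image_mset g (mset_set S)"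
  for g :: "'a \<Rightarrow> complex"
  by (induction S rule: finite_induct) (simp_all add: proots_mult del: mult_pCons_left)

lemma zero_divisor_times_linear_factors:
  fixes q :: "complex poly" and g :: "'a \<Rightarrow> complex"
  assumes "q \<noteq> 0" "degree q \<le> d" "finite S"
  shows "zero_divisor (d + card S) (q * (\<Prod>\<delta>\<in>S. [:- g \<delta>, 1:]))
    = zero_divisor d q + image_mset (\<lambda>\<delta>. Fin (g \<delta>)) (mset_set S)"
proof -
  let ?L = "\<Prod>\<delta>\<in>S. [:- g \<delta>, 1:]"
  have L: "?L \<noteq> 0" using assms(3) by simp
  have "degree ?L = card S" by (subst degree_prod_sum_eq) auto
  hence deg: "degree (q * ?L) = degree q + card S"
    using assms(1) L by (simp add: degree_mult_eq)
  have "proots (q * ?L) = proots q + image_mset g (mset_set S)"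
    using assms(1) L by (simp add: proots_mult proots_linear_factors[OF assms(3)])
  thus ?thesis using assms(2) by (simp add: zero_divisor_def deg image_mset.compositionality o_def)
qed

lemma divisor_polynomial:
  assumes "size E = d"
  obtains q where "q \<noteq> 0" "degree q \<le> d" "zero_divisor d q = E"
proof -
  define M where "M = finite_zeros E"
  define q where "q = (\<Prod>x\<in>#M. [:- x, 1:] :: complex poly)"
  have E: "image_mset Fin M + replicate_mset (count E Infty) Infty = E"
    unfolding M_def by (rule divisor_decompose)
  have "q \<noteq> 0 \<and> proots q = M \<and> degree q = size M"
    unfolding q_def
    by (induction M) (auto simp: proots_mult degree_mult_eq simp del: mult_pCons_left)
  moreover have "size M + count E Infty = d"
    using arg_cong[OF E, of size] assms by simp
  moreover from this have "d - size M = count E Infty" "size M \<le> d" by linarith+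
  ultimately show thesis
    using that[of q] E by (simp add: zero_divisor_def)
qed

section \<open>Projective classes\<close>

lemma proj_class_self: "t \<in> proj_class t"
  unfolding proj_class_def by (rule CollectI, rule exI[of _ 1]) simp

lemma proj_class_smult: "c \<noteq> 0 \<Longrightarrow> proj_class (c \<cdot>\<^sub>v t) = proj_class t"
proof -
  assume c: "c \<noteq> 0"
  show ?thesis
    unfolding proj_class_def
  proof (intro equalityI subsetI)
    fix u assume "u \<in> {d \<cdot>\<^sub>v (c \<cdot>\<^sub>v t) | d. d \<noteq> 0}"
    then obtain d where "d \<noteq> 0" "u = (d * c) \<cdot>\<^sub>v t" by (auto simp: smult_smult_assoc)
    moreover have "d * c \<noteq> 0" using \<open>d \<noteq> 0\<close> c by simp
    ultimately show "u \<in> {d \<cdot>\<^sub>v t | d. d \<noteq> 0}" by blast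
  next
    fix u assume "u \<in> {d \<cdot>\<^sub>v t | d. d \<noteq> 0}"
    then obtain d where d: "d \<noteq> 0" "u = d \<cdot>\<^sub>v t" by blast
    have "u = (d / c) \<cdot>\<^sub>v (c \<cdot>\<^sub>v t)" using c d(2) by (simp add: smult_smult_assoc)
    moreover have "d / c \<noteq> 0" using d(1) c by simp
    ultimately show "u \<in> {d \<cdot>\<^sub>v (c \<cdot>\<^sub>v t) | d. d \<noteq> 0}" by blast
  qed
qed

lemma proj_class_eqD: "proj_class t = proj_class u \<Longrightarrow> \<exists>c. c \<noteq> 0 \<and> t = c \<cdot>\<^sub>v u"
  using proj_class_self[of t] unfolding proj_class_def by auto

section \<open>Spectral data of the family\<close>

context hsl_lattice begin

text \<open>
  For \<open>\<Delta> = supp A\<close> this is \<open>\<lambda>\<^sup>-\<^sup>1 x\<^sup>(\<^sup>1\<^sup>)(\<lambda>, 0)\<close>; for the set of all frequencies it is, up to scale,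
  the polynomial \<open>h\<close> in the definition of \<open>\<Phi>\<close>.
\<close>

definition divisor_poly :: "(complex \<Rightarrow> complex) \<Rightarrow> complex set \<Rightarrow> complex poly" where
  "divisor_poly A \<Delta> = (\<Sum>\<gamma>\<in>\<Delta>. Polynomial.smult (C0 * sl \<gamma> * A \<gamma>) (omit \<Delta> (- \<gamma>)))"

lemma killing_divisor_poly: "(killing A 0 $ 1) div [:0, 1:] = divisor_poly A (supp A)"
proof -
  have "killing A 0 $ 1 = (\<Sum>\<gamma>\<in>supp A. pCons 0 (Polynomial.smult (C0 * sl \<gamma> * A \<gamma>) (omit (supp A) (- \<gamma>))))"
    unfolding killing_nth by (simp add: twist_def)
  also have "\<dots> = [:0, 1:] * divisor_poly A (supp A)"
    unfolding divisor_poly_def sum_distrib_left by simp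
  finally show ?thesis by (simp only: nonzero_mult_div_cancel_left[of "[:0, 1:]"] pCons_eq_0_iff one_neq_zero simp_thms)
qed

lemma spectral_data_fam: "spec (fam A) = (supp A, zero_divisor (card (supp A) - 1) (divisor_poly A (supp A)))"
  unfolding spectral_data_def Delta_fam x_of_fam killing_divisor_poly ..

text \<open>
  Only the summand \<open>\<gamma> = - \<delta>\<close> does not contain the factor \<open>\<lambda> - s\<^sub>\<delta>\<close>.
\<close>

lemma poly_divisor_poly:
  assumes "finite \<Delta>" "\<Delta> = uminus ` \<Delta>" "\<delta> \<in> \<Delta>"
  shows "poly (divisor_poly A \<Delta>) (sl \<delta>) = - C0 * sl \<delta> * A (- \<delta>) * poly (omit \<Delta> \<delta>) (sl \<delta>)"
proof -
  have m: "- \<delta> \<in> \<Delta>" using assms(2,3) by (metis imageI)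
  have "poly (divisor_poly A \<Delta>) (sl \<delta>) = (\<Sum>\<gamma>\<in>\<Delta>. C0 * sl \<gamma> * A \<gamma> * poly (omit \<Delta> (- \<gamma>)) (sl \<delta>))"
    by (simp add: divisor_poly_def poly_sum)
  also have "\<dots> = (\<Sum>\<gamma>\<in>\<Delta>. if \<gamma> = - \<delta> then C0 * sl (- \<delta>) * A (- \<delta>) * poly (omit \<Delta> \<delta>) (sl \<delta>) else 0)"
  proof (rule sum.cong[OF refl])
    fix \<gamma>
    have "poly (omit \<Delta> (- \<gamma>)) (sl \<delta>) = 0" if "\<gamma> \<noteq> - \<delta>"
      by (rule omit_at_other[OF assms(1,3)]) (use that in auto)
    thus "C0 * sl \<gamma> * A \<gamma> * poly (omit \<Delta> (- \<gamma>)) (sl \<delta>)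
      = (if \<gamma> = - \<delta> then C0 * sl (- \<delta>) * A (- \<delta>) * poly (omit \<Delta> \<delta>) (sl \<delta>) else 0)"
      by auto
  qed
  also have "\<dots> = C0 * sl (- \<delta>) * A (- \<delta>) * poly (omit \<Delta> \<delta>) (sl \<delta>)"
    using m assms(1) by simp
  finally show ?thesis by simp
qed

lemma degree_divisor_poly:
  assumes "finite \<Delta>" "\<Delta> = uminus ` \<Delta>"
  shows "degree (divisor_poly A \<Delta>) \<le> card \<Delta> - 1"
  unfolding divisor_poly_def
proof (rule degree_sum_le[OF assms(1)])
  fix \<gamma> assume "\<gamma> \<in> \<Delta>"
  hence "- \<gamma> \<in> \<Delta>" using assms(2) by (metis imageI)
  from omit_degree[OF assms(1) this]
  show "degree (Polynomial.smult (C0 * sl \<gamma> * A \<gamma>) (omit \<Delta> (- \<gamma>))) \<le> card \<Delta> - 1"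
    using degree_smult_le[of "C0 * sl \<gamma> * A \<gamma>" "omit \<Delta> (- \<gamma>)"] by simp
qed

lemma symmetric_set: "(\<And>\<gamma>. \<gamma> \<in> S \<Longrightarrow> - \<gamma> \<in> S) \<Longrightarrow> S = uminus ` S" for S :: "complex set"
  by (auto simp: image_iff) (metis minus_minus)

lemma supp_sym: "supp A = uminus ` supp A" and Fr_sym: "Fr = uminus ` Fr"
  by (rule symmetric_set, simp add: supp_minus)+ 

lemma divisor_poly_zero_iff:
  assumes "finite \<Delta>" "\<Delta> = uminus ` \<Delta>" "\<delta> \<in> \<Delta>" "\<Delta> \<subseteq> Fr"
  shows "poly (divisor_poly A \<Delta>) (sl \<delta>) = 0 \<longleftrightarrow> A (- \<delta>) = 0"
  unfolding poly_divisor_poly[OF assms(1-3)]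
  using C0_nonzero slope_special(1)[of \<delta>] omit_at_own[OF assms(1), of \<delta>] assms(3,4) by auto

lemma divisor_poly_nonzero:
  assumes "finite \<Delta>" "\<Delta> = uminus ` \<Delta>" "\<Delta> \<subseteq> Fr" "\<gamma> \<in> \<Delta>" "A \<gamma> \<noteq> 0"
  shows "divisor_poly A \<Delta> \<noteq> 0"
proof -
  have "- \<gamma> \<in> \<Delta>" using assms(2,4) by (metis imageI)
  from divisor_poly_zero_iff[OF assms(1,2) this assms(3), of A] show ?thesis using assms(5) by auto
qed

text \<open>
  Zeros at both \<open>s\<^sub>\<delta>\<close> and \<open>- s\<^sub>\<delta>\<close> would mean \<open>A \<delta> = A (- \<delta>) = 0\<close>, contrary to \<open>\<delta> \<in> supp A\<close>.
\<close>

lemma spectral_data_fam_in_space: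
  assumes "\<exists>\<gamma>\<in>Fr. A \<gamma> \<noteq> 0"
  shows "spec (fam A) \<in> spectra"
proof -
  obtain \<gamma> where g: "\<gamma> \<in> supp A" "A \<gamma> \<noteq> 0" using assms unfolding supp_def by blast
  note nz = divisor_poly_nonzero[of _ _ A, OF supp_finite supp_sym supp_subset g]
  have "\<not> (Fin s \<in># zero_divisor (card (supp A) - 1) (divisor_poly A (supp A)) \<and>
            Fin (- s) \<in># zero_divisor (card (supp A) - 1) (divisor_poly A (supp A)))"
    if s: "s \<in> sl ` supp A" for s
  proof -
    obtain \<delta> where d: "\<delta> \<in> supp A" "s = sl \<delta>" using s by blast
    have m: "- \<delta> \<in> supp A" using d(1) by (simp add: supp_minus)
    have "A \<delta> \<noteq> 0 \<or> A (- \<delta>) \<noteq> 0" using d(1) unfolding supp_def by blast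
    thus ?thesis
      using divisor_poly_zero_iff[OF supp_finite supp_sym d(1) supp_subset, of A]
        divisor_poly_zero_iff[OF supp_finite supp_sym m supp_subset, of A]
      unfolding Fin_in_zero_divisor[OF nz] d(2) by auto
  qed
  thus ?thesis
    unfolding spectral_data_fam spectral_space_def
    using g(1) supp_sym supp_subset size_zero_divisor[OF degree_divisor_poly[OF supp_finite supp_sym, of A A]] by auto
qed

text \<open>
  Take a polynomial with divisor \<open>E\<close> and read off \<open>A\<close> from its values at the slopes; Lagrange
  interpolation recovers the polynomial. The condition on the support of \<open>E\<close> says that \<open>supp A = \<Delta>\<close>.
\<close>

lemma spectral_space_realised:
  assumes "(\<Delta>, E) \<in> spectra"
  obtains A where "\<exists>\<gamma>\<in>Fr. A \<gamma> \<noteq> 0" "spec (fam A) = (\<Delta>, E)"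
proof -
  have D: "\<Delta> \<noteq> {}" "\<Delta> = uminus ` \<Delta>" "\<Delta> \<subseteq> Fr" "size E = card \<Delta> - 1"
    and sup: "\<And>s. s \<in> sl ` \<Delta> \<Longrightarrow> \<not> (Fin s \<in># E \<and> Fin (- s) \<in># E)"
    using assms unfolding spectral_space_def by auto
  have fin: "finite \<Delta>" using D(3) freqs_finite finite_subset by blast
  have neg: "- \<gamma> \<in> \<Delta> \<longleftrightarrow> \<gamma> \<in> \<Delta>" for \<gamma> using D(2) by (metis imageI minus_minus)
  obtain q where q: "q \<noteq> 0" "degree q \<le> card \<Delta> - 1" "zero_divisor (card \<Delta> - 1) q = E"
    using divisor_polynomial[OF D(4)] by blast
  define A where "A \<gamma> = (if \<gamma> \<in> \<Delta> then poly q (sl (- \<gamma>)) / (C0 * sl \<gamma> * poly (omit \<Delta> (- \<gamma>)) (sl (- \<gamma>))) else 0)" for \<gamma>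
  have nz: "C0 * sl \<gamma> * poly (omit \<Delta> (- \<gamma>)) (sl (- \<gamma>)) \<noteq> 0" if "\<gamma> \<in> \<Delta>" for \<gamma>
    using C0_nonzero slope_special(1)[of \<gamma>] omit_at_own[OF fin, of "- \<gamma>"] D(3) that
    by (simp del: slope_minus) blast
  have A0: "A \<gamma> = 0 \<longleftrightarrow> Fin (sl (- \<gamma>)) \<in># E" if "\<gamma> \<in> \<Delta>" for \<gamma>
    using nz[OF that] that Fin_in_zero_divisor[OF q(1)] unfolding A_def q(3)[symmetric] by simp
  have one: "A \<gamma> \<noteq> 0 \<or> A (- \<gamma>) \<noteq> 0" if g: "\<gamma> \<in> \<Delta>" for \<gamma>
    using sup[of "sl \<gamma>"] A0[OF g] A0[of "- \<gamma>"] g neg[of \<gamma>] by auto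
  have S: "supp A = \<Delta>"
    unfolding supp_def using one D(3) by (auto simp: A_def neg split: if_splits)
  have "divisor_poly A \<Delta> = q"
  proof (rule poly_eqI_degree)
    have c: "card (sl ` \<Delta>) = card \<Delta>" by (intro card_image inj_on_subset[OF slope_inj]) simp
    have c1: "card \<Delta> > 0" using D(1) fin by (simp add: card_gt_0_iff)
    show "degree (divisor_poly A \<Delta>) < card (sl ` \<Delta>)" "degree q < card (sl ` \<Delta>)"
      using degree_divisor_poly[OF fin D(2), of A] q(2) c1 unfolding c by linarith+
    fix x assume "x \<in> sl ` \<Delta>"
    then obtain \<delta> where d: "\<delta> \<in> \<Delta>" "x = sl \<delta>" by blast
    have "poly (divisor_poly A \<Delta>) (sl \<delta>) = A (- \<delta>) * (C0 * sl (- \<delta>) * poly (omit \<Delta> (- (- \<delta>))) (sl (- (- \<delta>))))"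
      unfolding poly_divisor_poly[OF fin D(2) d(1)] by simp
    also have "\<dots> = poly q (sl (- (- \<delta>)))"
      using nz[of "- \<delta>"] d(1) neg unfolding A_def by simp
    finally show "poly (divisor_poly A \<Delta>) x = poly q x" using d(2) by simp
  qed
  hence "spec (fam A) = (\<Delta>, E)"
    unfolding spectral_data_fam S using q(3) by simp
  moreover obtain \<gamma> where "\<gamma> \<in> \<Delta>" using D(1) by blast
  hence "\<exists>\<gamma>\<in>Fr. A \<gamma> \<noteq> 0" using one D(3) neg by blast
  ultimately show thesis using that by blast
qed

text \<open>
  The frequencies outside \<open>supp A\<close> contribute no summands, only the common linear factors that \<open>\<Phi>\<close> adds
  to the divisor.
\<close>

lemma divisor_poly_extend:
  "divisor_poly A Fr = divisor_poly A (supp A) * (\<Prod>\<delta>\<in>Fr - supp A. [:- sl \<delta>, 1:])"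
proof -
  have "divisor_poly A Fr = (\<Sum>\<gamma>\<in>supp A. Polynomial.smult (C0 * sl \<gamma> * A \<gamma>) (omit Fr (- \<gamma>)))"
    unfolding divisor_poly_def
    by (rule sum.mono_neutral_right[OF freqs_finite supp_subset]) (auto simp: supp_def)
  also have "\<dots> = (\<Sum>\<gamma>\<in>supp A. Polynomial.smult (C0 * sl \<gamma> * A \<gamma>) (omit (supp A) (- \<gamma>)) * (\<Prod>\<delta>\<in>Fr - supp A. [:- sl \<delta>, 1:]))"
  proof (rule sum.cong[OF refl])
    fix \<gamma> assume "\<gamma> \<in> supp A"
    hence m: "- \<gamma> \<in> supp A" by (simp add: supp_minus)
    have "Fr - {- \<gamma>} = (supp A - {- \<gamma>}) \<union> (Fr - supp A)" using m supp_subset by blast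
    hence "omit Fr (- \<gamma>) = omit (supp A) (- \<gamma>) * (\<Prod>\<delta>\<in>Fr - supp A. [:- sl \<delta>, 1:])"
      unfolding omit_def using supp_finite freqs_finite
      by (simp only:) (subst prod.union_disjoint, auto)
    thus "Polynomial.smult (C0 * sl \<gamma> * A \<gamma>) (omit Fr (- \<gamma>))
      = Polynomial.smult (C0 * sl \<gamma> * A \<gamma>) (omit (supp A) (- \<gamma>)) * (\<Prod>\<delta>\<in>Fr - supp A. [:- sl \<delta>, 1:])" by simp
  qed
  finally show ?thesis by (simp add: divisor_poly_def sum_distrib_right)
qed

lemma divisor_poly_scale: "divisor_poly (\<lambda>\<gamma>. c * A \<gamma>) \<Delta> = Polynomial.smult c (divisor_poly A \<Delta>)"
  by (rule poly_eqI) (simp add: divisor_poly_def coeff_sum sum_distrib_left mult_ac)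

lemma supp_scale: "c \<noteq> 0 \<Longrightarrow> supp (\<lambda>\<gamma>. c * A \<gamma>) = supp A"
  by (simp add: supp_def)

lemma spectral_data_scale: "c \<noteq> 0 \<Longrightarrow> spec (fam (\<lambda>\<gamma>. c * A \<gamma>)) = spec (fam A)"
  unfolding spectral_data_fam supp_scale divisor_poly_scale by (simp add: zero_divisor_smult)

lemma fam_cong:
  assumes "\<And>\<gamma>. \<gamma> \<in> Fr \<Longrightarrow> A \<gamma> = B \<gamma>"
  shows "fam A = fam B"
proof -
  have "fam1 A = fam1 B" "fam4 A = fam4 B"
    by (simp_all add: fun_eq_iff fam1_eq fam4_eq assms)
  thus ?thesis by (simp add: fam_def[abs_def])
qed

end

section \<open>The map \<open>\<Phi>\<close> on the family\<close>

locale hsl_labelled = hsl_lattice +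
  fixes N :: nat and \<gamma> :: "nat \<Rightarrow> complex"
  assumes N_card: "N = card Fr" and labelling: "is_labelling \<Gamma> \<beta>0 N \<gamma>"
begin

abbreviation s :: "nat \<Rightarrow> complex" where "s j \<equiv> sl (\<gamma> j)"

lemma label_bij: "bij_betw \<gamma> {..<N} Fr"
  using labelling unfolding is_labelling_def by blast

lemma label_in: "j < N \<Longrightarrow> \<gamma> j \<in> Fr"
  using label_bij by (auto simp: bij_betw_def)

lemma label_inj: "inj_on \<gamma> {..<N}"
  using label_bij by (rule bij_betw_imp_inj_on)

lemma label_surj: "x \<in> Fr \<Longrightarrow> \<exists>j<N. x = \<gamma> j"
  using label_bij unfolding bij_betw_def by (metis imageE lessThan_iff)

lemma N_pos: "N > 0"
  using N_card freqs_nonempty freqs_finite by (simp add: card_gt_0_iff)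

lemma s_inj: "inj_on s {..<N}"
  using label_inj by (auto simp: inj_on_def slope_eq_iff)

lemma omitted_divisor:
  "image_mset (\<lambda>j. Fin (s j)) (mset_set {j \<in> {..<N}. \<gamma> j \<notin> \<Delta>}) = image_mset (\<lambda>\<delta>. Fin (sl \<delta>)) (mset_set (Fr - \<Delta>))"
proof -
  have "\<gamma> ` {j \<in> {..<N}. \<gamma> j \<notin> \<Delta>} = Fr - \<Delta>" using label_bij unfolding bij_betw_def by auto
  moreover have "inj_on \<gamma> {j \<in> {..<N}. \<gamma> j \<notin> \<Delta>}" by (rule inj_on_subset[OF label_inj]) auto
  ultimately have "mset_set (Fr - \<Delta>) = image_mset \<gamma> (mset_set {j \<in> {..<N}. \<gamma> j \<notin> \<Delta>})"
    using image_mset_mset_set by metis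
  thus ?thesis by (simp add: image_mset.compositionality o_def)
qed

text \<open>
  The homogeneous coordinates \<open>s\<^sub>j p'(s\<^sub>j) A (- \<gamma>\<^sub>j)\<close> of the \<open>\<Phi>\<close>-image of \<open>fam A\<close>.
\<close>

definition weights :: "(complex \<Rightarrow> complex) \<Rightarrow> complex Matrix.vec" where
  "weights A = Matrix.vec N (\<lambda>j. s j * A (- \<gamma> j) * poly (omit Fr (\<gamma> j)) (s j))"

text \<open>
  Any admissible choice of \<open>h\<close> is a multiple of \<open>divisor_poly A Fr\<close>, whose values at the slopes are
  known.
\<close>

lemma Phi_fam:
  assumes "\<exists>\<gamma>\<in>Fr. A \<gamma> \<noteq> 0"
  shows "Phi \<beta>0 N \<gamma> (spec (fam A)) = proj_class (weights A)"
proof -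
  obtain g where g: "g \<in> supp A" "A g \<noteq> 0" using assms unfolding supp_def by blast
  note nzS = divisor_poly_nonzero[of _ _ A, OF supp_finite supp_sym supp_subset g]
  have nz: "divisor_poly A Fr \<noteq> 0"
    using g supp_subset by (intro divisor_poly_nonzero[OF freqs_finite Fr_sym order_refl]) auto
  let ?E = "zero_divisor (card (supp A) - 1) (divisor_poly A (supp A))
     + image_mset (\<lambda>j. Fin (s j)) (mset_set {j \<in> {..<N}. \<gamma> j \<notin> supp A})"
  have card: "card (supp A) - 1 + card (Fr - supp A) = N - 1"
  proof -
    have "card (supp A) > 0" using g(1) supp_finite card_gt_0_iff by blast
    moreover have "card (supp A) \<le> card Fr" by (rule card_mono[OF freqs_finite supp_subset])
    ultimately show ?thesis
      unfolding N_card card_Diff_subset[OF supp_finite supp_subset] by linarith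
  qed
  have zd: "zero_divisor (N - 1) (divisor_poly A Fr) = ?E"
    unfolding divisor_poly_extend omitted_divisor card[symmetric]
    using nzS degree_divisor_poly[OF supp_finite supp_sym] freqs_finite
    by (intro zero_divisor_times_linear_factors) auto
  define h where "h = (SOME h. h \<noteq> 0 \<and> degree h \<le> N - 1 \<and> zero_divisor (N - 1) h = ?E)"
  have "\<exists>h. h \<noteq> 0 \<and> degree h \<le> N - 1 \<and> zero_divisor (N - 1) h = ?E"
    using nz degree_divisor_poly[OF freqs_finite Fr_sym, of A] zd N_card by auto
  from someI_ex[OF this] have h: "h \<noteq> 0" "zero_divisor (N - 1) h = ?E" unfolding h_def by blast+
  obtain c where c: "c \<noteq> 0" "h = Polynomial.smult c (divisor_poly A Fr)"
    using zero_divisor_eqD[OF _ h(1) nz] h(2) zd by metis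
  have "Matrix.vec N (\<lambda>j. poly h (s j)) = (- c * C0) \<cdot>\<^sub>v weights A"
    using c(2) poly_divisor_poly[OF freqs_finite Fr_sym label_in, of _ A]
    by (intro eq_vecI) (auto simp: weights_def)
  hence "proj_class (Matrix.vec N (\<lambda>j. poly h (s j))) = proj_class (weights A)"
    using c(1) C0_nonzero by (simp add: proj_class_smult)
  thus ?thesis
    unfolding spectral_data_fam Phi_def by (simp add: h_def Let_def)
qed

lemma weights_proportional:
  assumes "weights A = c \<cdot>\<^sub>v weights B" "x \<in> Fr"
  shows "A x = c * B x"
proof -
  obtain j where j: "j < N" "- x = \<gamma> j" using label_surj[of "- x"] assms(2) by auto
  have x: "x = - \<gamma> j" using j(2) by (metis minus_minus)
  have "vec_index (weights A) j = vec_index (c \<cdot>\<^sub>v weights B) j" using assms(1) by simp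
  hence "s j * poly (omit Fr (\<gamma> j)) (s j) * A x = s j * poly (omit Fr (\<gamma> j)) (s j) * (c * B x)"
    unfolding x using j(1) by (simp add: weights_def mult_ac)
  moreover have "s j * poly (omit Fr (\<gamma> j)) (s j) \<noteq> 0"
    using slope_special(1)[OF label_in[OF j(1)]] omit_at_own[OF freqs_finite] by simp
  ultimately show ?thesis unfolding mult_cancel_left by blast
qed

text \<open>The inverse of \<open>weights\<close>: the function \<open>A\<close> on the frequencies for which \<open>fam A\<close> has \<open>\<Phi>\<close>-image \<open>[t]\<close>.\<close>

definition coeffs_of :: "complex Matrix.vec \<Rightarrow> complex \<Rightarrow> complex" where
  "coeffs_of t x = (let j = inv_into {..<N} \<gamma> (- x) in vec_index t j / (s j * poly (omit Fr (\<gamma> j)) (s j)))"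

lemma coeffs_of_label: "j < N \<Longrightarrow> coeffs_of t (- \<gamma> j) = vec_index t j / (s j * poly (omit Fr (\<gamma> j)) (s j))"
  unfolding coeffs_of_def by (simp add: inv_into_f_f[OF label_inj])

lemma denominators_nonzero: "j < N \<Longrightarrow> s j * poly (omit Fr (\<gamma> j)) (s j) \<noteq> 0"
  using slope_special(1)[OF label_in] omit_at_own[OF freqs_finite] by simp

lemma weights_coeffs_of: "t \<in> carrier_vec N \<Longrightarrow> weights (coeffs_of t) = t"
  using denominators_nonzero
  by (intro eq_vecI) (auto simp: weights_def coeffs_of_label)

lemma coeffs_of_nonzero:
  assumes "t \<in> carrier_vec N - {0\<^sub>v N}"
  shows "\<exists>x\<in>Fr. coeffs_of t x \<noteq> 0"
proof (rule ccontr)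
  assume z: "\<not> (\<exists>x\<in>Fr. coeffs_of t x \<noteq> 0)"
  have "vec_index t j = 0" if "j < N" for j
  proof -
    have "coeffs_of t (- \<gamma> j) = 0" using z label_in[OF that] Fr_minus by blast
    thus ?thesis using denominators_nonzero[OF that] by (simp add: coeffs_of_label[OF that])
  qed
  hence "t = 0\<^sub>v N" using assms by (intro eq_vecI) auto
  thus False using assms by simp
qed

lemma weights_carrier: "weights A \<in> carrier_vec N"
  by (simp add: weights_def)

lemma weights_nonzero:
  assumes "\<exists>x\<in>Fr. A x \<noteq> 0"
  shows "weights A \<in> carrier_vec N - {0\<^sub>v N}"
proof -
  have "weights A \<noteq> 0\<^sub>v N"
  proof
    assume "weights A = 0\<^sub>v N"
    hence w: "weights A = 0 \<cdot>\<^sub>v weights A" using weights_carrier[of A] by (intro eq_vecI) auto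
    obtain x where x: "x \<in> Fr" "A x \<noteq> 0" using assms by blast
    have "A x = 0 * A x" by (rule weights_proportional[OF w x(1)])
    thus False using x(2) by simp
  qed
  thus ?thesis using weights_carrier by simp
qed

lemma Phi_coeffs_of:
  assumes "t \<in> carrier_vec N - {0\<^sub>v N}"
  shows "Phi \<beta>0 N \<gamma> (spec (fam (coeffs_of t))) = proj_class t"
  using Phi_fam[OF coeffs_of_nonzero[OF assms]] assms by (simp add: weights_coeffs_of)

text \<open>
  The coefficient function \<open>A\<close> is recovered from the projective point up to a scalar. This is the
  common source of the injectivity of \<open>\<Phi>\<close> and of the fact that spectral data determines the map.
\<close>

lemma Phi_eqD:
  assumes "\<exists>x\<in>Fr. A x \<noteq> 0" "\<exists>x\<in>Fr. B x \<noteq> 0"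
    and "Phi \<beta>0 N \<gamma> (spec (fam A)) = Phi \<beta>0 N \<gamma> (spec (fam B))"
  obtains c where "c \<noteq> 0" "fam A = fam (\<lambda>x. c * B x)"
proof -
  obtain c where c: "c \<noteq> 0" "weights A = c \<cdot>\<^sub>v weights B"
    using proj_class_eqD assms(3) unfolding Phi_fam[OF assms(1)] Phi_fam[OF assms(2)] by blast
  have "fam A = fam (\<lambda>x. c * B x)"
    using weights_proportional[OF c(2)] by (intro fam_cong)
  thus thesis using that c(1) by blast
qed

lemma Phi_bij: "bij_betw (Phi \<beta>0 N \<gamma>) spectra (complex_proj (N - 1))"
  unfolding bij_betw_def
proof
  have Np: "N - 1 + 1 = N" using N_pos by simp
  show "inj_on (Phi \<beta>0 N \<gamma>) spectra"
  proof (rule inj_onI)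
    fix d d' assume d: "d \<in> spectra" "d' \<in> spectra" and eq: "Phi \<beta>0 N \<gamma> d = Phi \<beta>0 N \<gamma> d'"
    obtain A where A: "\<exists>x\<in>Fr. A x \<noteq> 0" "spec (fam A) = d"
      using spectral_space_realised d(1) by (metis prod.collapse)
    obtain B where B: "\<exists>x\<in>Fr. B x \<noteq> 0" "spec (fam B) = d'"
      using spectral_space_realised d(2) by (metis prod.collapse)
    obtain c where "c \<noteq> 0" "fam A = fam (\<lambda>x. c * B x)"
      using Phi_eqD[OF A(1) B(1)] eq unfolding A(2) B(2) by blast
    thus "d = d'" using A(2) B(2) spectral_data_scale by metis
  qed
  show "Phi \<beta>0 N \<gamma> ` spectra = complex_proj (N - 1)"
  proof
    show "Phi \<beta>0 N \<gamma> ` spectra \<subseteq> complex_proj (N - 1)"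
    proof
      fix y assume "y \<in> Phi \<beta>0 N \<gamma> ` spectra"
      then obtain d where d: "d \<in> spectra" "y = Phi \<beta>0 N \<gamma> d" by blast
      obtain A where A: "\<exists>x\<in>Fr. A x \<noteq> 0" "spec (fam A) = d"
        using spectral_space_realised d(1) by (metis prod.collapse)
      have "y = proj_class (weights A)" using Phi_fam[OF A(1)] A(2) d(2) by simp
      thus "y \<in> complex_proj (N - 1)"
        using weights_nonzero[OF A(1)] unfolding complex_proj_def Np by blast
    qed
    show "complex_proj (N - 1) \<subseteq> Phi \<beta>0 N \<gamma> ` spectra"
    proof
      fix y assume "y \<in> complex_proj (N - 1)"
      then obtain t where t: "t \<in> carrier_vec N - {0\<^sub>v N}" "y = proj_class t"
        unfolding complex_proj_def Np by blast
      show "y \<in> Phi \<beta>0 N \<gamma> ` spectra"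
        using Phi_coeffs_of[OF t(1)] t(2) spectral_data_fam_in_space[OF coeffs_of_nonzero[OF t(1)]] by blast
    qed
  qed
qed

end

section \<open>Dilations and the group \<open>T\<^sub>0\<close>\<close>

text \<open>
  For \<open>\<bar>c\<bar> = 1\<close>, the element of \<open>T\<^sub>0\<close> that multiplies \<open>v\<^sub>1\<close> and \<open>v\<^sub>4\<close> by \<open>c\<close>.
\<close>

definition rot :: "complex \<Rightarrow> real^4^4" where
  "rot c = vector [vector [Re c, - Im c, 0, 0], vector [Im c, Re c, 0, 0],
                   vector [0, 0, Re c, Im c], vector [0, 0, - Im c, Re c]]"

lemma rot_mult: "rot c ** rot d = rot (c * d)"
  unfolding Finite_Cartesian_Product.vec_eq_iff forall_4
  by (simp add: rot_def matrix_matrix_mult_def sum_4)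

lemma rot_one: "rot 1 = Finite_Cartesian_Product.mat 1"
  unfolding Finite_Cartesian_Product.vec_eq_iff forall_4
  by (simp add: rot_def Finite_Cartesian_Product.mat_def)

lemma rot_transpose: "transpose (rot c) = rot (cnj c)"
  unfolding Finite_Cartesian_Product.vec_eq_iff forall_4
  by (simp add: rot_def transpose_def)

lemma rot_orthogonal: "norm c = 1 \<Longrightarrow> orthogonal_matrix (rot c)"
  unfolding orthogonal_matrix rot_transpose rot_mult
  using complex_norm_square[of c] by (simp add: rot_one mult.commute)

text \<open>
  An orthogonal matrix has determinant \<open>\<plusminus>1\<close>, and \<open>rot c\<close> is the square of \<open>rot (csqrt c)\<close>.
\<close>

lemma rot_det:
  assumes "norm c = 1"
  shows "Determinants.det (rot c) = 1"
proof -
  have "norm (csqrt c) = 1" using assms by simp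
  from det_orthogonal_matrix[OF rot_orthogonal[OF this]]
  have "Determinants.det (rot (csqrt c)) * Determinants.det (rot (csqrt c)) = 1" by auto
  thus ?thesis
    unfolding det_mul[symmetric] rot_mult by (simp add: power2_eq_square[symmetric])
qed

lemma rot_commute: "rot c ** Jmat = Jmat ** rot c" "rot c ** Lmat = Lmat ** rot c"
  unfolding Finite_Cartesian_Product.vec_eq_iff forall_4
  by (simp_all add: rot_def Jmat_def Lmat_def matrix_matrix_mult_def sum_4 transpose_def axis_def)

lemma cx_vec_mult: "cx_vec (g *v x) = cx_mat g *v cx_vec x"
  by (simp add: cx_vec_def cx_mat_def map_matrix_def matrix_vector_mult_def Finite_Cartesian_Product.vec_eq_iff)

lemma coord_rot:
  "coord 1 (cx_vec (rot c *v x)) = c * coord 1 (cx_vec x)"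
  "coord 4 (cx_vec (rot c *v x)) = c * coord 4 (cx_vec x)"
  by (simp_all add: coord_simps cx_vec_def rot_def matrix_vector_mult_def sum_4 complex_eq_iff
      Re_divide_of_real Im_divide_of_real field_simps)

lemma cx_mat_rot_v1: "cx_mat (rot c) *v v_basis 1 = c *s v_basis 1"
  unfolding Finite_Cartesian_Product.vec_eq_iff forall_4
  by (simp add: cx_mat_def map_matrix_def rot_def matrix_vector_mult_def sum_4 v_basis_simps axis_def complex_eq_iff
      Re_divide_of_real Im_divide_of_real)

lemma cx_mat_scale: "cx_mat g *v (d *s x) = d *s (cx_mat g *v x)"
  by (simp add: matrix_vector_mult_def Finite_Cartesian_Product.vec_eq_iff sum_distrib_left mult_ac)

lemma rot_in_T0:
  assumes "norm c = 1"
  shows "rot c \<in> T0"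
proof -
  have c: "c \<noteq> 0" using assms by auto
  have "(\<lambda>x. cx_mat (rot c) *v x) ` range (\<lambda>d. d *s v_basis 1) = range (\<lambda>d. (d * c) *s v_basis 1)"
    by (auto simp: image_iff cx_mat_scale cx_mat_rot_v1)
  also have "\<dots> = range (\<lambda>d. d *s v_basis 1)"
  proof (intro equalityI subsetI)
    fix x assume "x \<in> range (\<lambda>d. d *s v_basis 1)"
    then obtain d where "x = ((d / c) * c) *s v_basis 1" using c by auto
    thus "x \<in> range (\<lambda>d. (d * c) *s v_basis 1)" by blast
  qed auto
  finally show ?thesis
    unfolding T0_def G0_def using rot_orthogonal[OF assms] rot_det[OF assms] rot_commute by blast
qed

lemma cx_mat_mult: "cx_mat (A ** B) = cx_mat A ** cx_mat B"
  by (simp add: cx_mat_def map_matrix_def matrix_matrix_mult_def Finite_Cartesian_Product.vec_eq_iff)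

definition cnj_vec :: "complex^4 \<Rightarrow> complex^4" where
  "cnj_vec x = (\<chi> k. cnj (x $ k))"

lemma cx_mat_cnj: "cx_mat g *v cnj_vec x = cnj_vec (cx_mat g *v x)"
  by (simp add: cnj_vec_def cx_mat_def map_matrix_def matrix_vector_mult_def Finite_Cartesian_Product.vec_eq_iff)

lemma cnj_v1: "cnj_vec (c *s v_basis 1) = cnj c *s v_basis 3"
  unfolding Finite_Cartesian_Product.vec_eq_iff forall_4
  by (simp add: cnj_vec_def v_basis_simps axis_def)

text \<open>
  The scalar by which \<open>g\<close> acts on \<open>v\<^sub>1\<close> determines \<open>g\<close>: on \<open>v\<^sub>3\<close> it is the conjugate scalar since \<open>g\<close> is real,
  and \<open>v\<^sub>4 = L v\<^sub>1\<close>, \<open>v\<^sub>2 = L v\<^sub>3\<close> where \<open>g\<close> commutes with \<open>L\<close>.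
\<close>

lemma T0_scalar:
  assumes "g \<in> T0"
  obtains c where "c \<noteq> 0"
    "\<And>x. coord 1 (cx_vec (g *v x)) = c * coord 1 (cx_vec x)"
    "\<And>x. coord 4 (cx_vec (g *v x)) = c * coord 4 (cx_vec x)"
proof -
  let ?g = "\<lambda>x. cx_mat g *v x" and ?L = "\<lambda>x. cx_mat Lmat *v x"
  have line: "?g ` range (\<lambda>c. c *s v_basis 1) = range (\<lambda>c. c *s v_basis 1)"
    and gL: "g ** Lmat = Lmat ** g" using assms unfolding T0_def G0_def by blast+
  have "v_basis 1 \<in> range (\<lambda>c. c *s v_basis 1)" by (rule range_eqI[of _ _ 1]) simp
  moreover from this obtain c where c: "?g (v_basis 1) = c *s v_basis 1" using line by blast
  ultimately obtain d where "v_basis 1 = ?g (d *s v_basis 1)" using line by blast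
  hence "v_basis 1 = (d * c) *s v_basis 1" by (simp add: cx_mat_scale c)
  hence "coord 1 (v_basis 1) = coord 1 ((d * c) *s v_basis 1)" by simp
  hence "d * c = 1" by (simp add: coord_scale coord_v_basis)
  hence c0: "c \<noteq> 0" by auto
  have comm: "?g (?L x) = ?L (?g x)" for x
    using arg_cong[OF gL, of cx_mat] by (simp add: cx_mat_mult matrix_vector_mul_assoc)
  have v4: "?g (v_basis 4) = c *s v_basis 4"
    using comm[of "v_basis 1"] by (simp add: c L_v1 cx_mat_scale)
  have v3: "?g (v_basis 3) = cnj c *s v_basis 3"
    using cx_mat_cnj[of g "1 *s v_basis 1"] cnj_v1[of 1] cnj_v1[of c] by (simp add: c)
  have "?L (v_basis 3) = v_basis 2"
    unfolding coord_eq_iff by (simp add: coord_L coord_v_basis)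
  hence v2: "?g (v_basis 2) = cnj c *s v_basis 2"
    using comm[of "v_basis 3"] by (simp add: v3 cx_mat_scale)
  have ex: "?g y = (coord 1 y * c) *s v_basis 1 + (coord 2 y * cnj c) *s v_basis 2
      + (coord 3 y * cnj c) *s v_basis 3 + (coord 4 y * c) *s v_basis 4" for y
  proof -
    have "?g y = ?g (\<Sum>l\<in>UNIV. coord l y *s v_basis l)" using basis_expansion[of y] by simp
    also have "\<dots> = coord 1 y *s ?g (v_basis 1) + coord 2 y *s ?g (v_basis 2)
        + coord 3 y *s ?g (v_basis 3) + coord 4 y *s ?g (v_basis 4)"
      by (simp add: sum_4 matrix_vector_right_distrib cx_mat_scale)
    finally show ?thesis by (simp add: c v2 v3 v4)
  qed
  show thesis
    by (rule that[OF c0]) (simp_all add: cx_vec_mult ex coord_add coord_scale coord_v_basis)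
qed

context hsl_lattice begin

lemma fam_scale: "fam1 (\<lambda>x. c * A x) z = c * fam1 A z" "fam4 (\<lambda>x. c * A x) z = c * fam4 A z"
  by (simp_all add: fam1_eq fam4_eq sum_distrib_left mult_ac)

lemma equiv_scale:
  assumes "c \<noteq> 0"
  shows "dilation_T0_equiv (fam A) (fam (\<lambda>x. c * A x))"
proof -
  have "fam (\<lambda>x. c * A x) z = norm c *\<^sub>R (rot (c / norm c) *v fam A z)" for z
  proof -
    have "norm c *\<^sub>R (rot (c / norm c) *v fam A z) = real_point (c * fam1 A z) (c * fam4 A z)"
      by (rule real_point_eqI)
         (use assms in \<open>simp_all add: linear_cmul[OF bounded_linear.linear[OF bounded_linear_cx_vec]]
           coord_scaleR coord_rot fam_def coord_real_point\<close>)
    thus ?thesis by (simp add: fam_def fam_scale)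
  qed
  moreover have "rot (c / norm c) \<in> T0" using assms by (intro rot_in_T0) (simp add: norm_divide)
  ultimately show ?thesis unfolding dilation_T0_equiv_def using assms by (metis zero_less_norm_iff)
qed

lemma equiv_imp_scale:
  assumes "dilation_T0_equiv (fam A) f"
  obtains c where "c \<noteq> 0" "f = fam (\<lambda>x. c * A x)"
proof -
  obtain r g where r: "r > 0" "g \<in> T0" "\<And>z. f z = r *\<^sub>R (g *v fam A z)"
    using assms unfolding dilation_T0_equiv_def by blast
  obtain c where c: "c \<noteq> 0" "\<And>x. coord 1 (cx_vec (g *v x)) = c * coord 1 (cx_vec x)"
    "\<And>x. coord 4 (cx_vec (g *v x)) = c * coord 4 (cx_vec x)" using T0_scalar[OF r(2)] by blast
  have "f z = real_point (of_real r * c * fam1 A z) (of_real r * c * fam4 A z)" for z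
    unfolding r(3)
    by (rule real_point_eqI)
       (simp_all add: linear_cmul[OF bounded_linear.linear[OF bounded_linear_cx_vec]]
           coord_scaleR c(2,3) fam_def coord_real_point)
  hence "f = fam (\<lambda>x. of_real r * c * A x)"
    unfolding fam_def[abs_def] fam_scale by (simp add: fun_eq_iff)
  thus thesis using that[of "of_real r * c"] c(1) r(1) by simp
qed

end

section \<open>The determinant as Lagrange interpolation\<close>

text \<open>
  The matrix in the definition of \<open>\<phi>\<close> with its last column replaced by \<open>x\<close>.
\<close>

definition last_col_mat :: "nat \<Rightarrow> (nat \<Rightarrow> complex) \<Rightarrow> (nat \<Rightarrow> complex) \<Rightarrow> complex Matrix.mat" where
  "last_col_mat N s x = Matrix.mat N N (\<lambda>(i, j). if j < N - 1 then s i ^ j else x i)"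

text \<open>
  These cofactors do not involve the last column, which may therefore be filled with zeros.
\<close>

definition last_cofactor :: "nat \<Rightarrow> (nat \<Rightarrow> complex) \<Rightarrow> nat \<Rightarrow> complex" where
  "last_cofactor N s i = cofactor (last_col_mat N s (\<lambda>_. 0)) i (N - 1)"

lemma det_last_col:
  assumes "N > 0"
  shows "Determinant.det (last_col_mat N s x) = (\<Sum>i<N. x i * last_cofactor N s i)"
proof -
  have c: "cofactor (last_col_mat N s x) i (N - 1) = last_cofactor N s i" for i
  proof -
    have "mat_delete (last_col_mat N s x) i (N - 1) = mat_delete (last_col_mat N s (\<lambda>_. 0)) i (N - 1)"
      by (rule eq_matI) (auto simp: mat_delete_def last_col_mat_def)
    thus ?thesis by (simp add: cofactor_def last_cofactor_def)
  qed
  have "Determinant.det (last_col_mat N s x)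
      = (\<Sum>i<N. last_col_mat N s x $$ (i, N - 1) * cofactor (last_col_mat N s x) i (N - 1))"
    by (rule laplace_expansion_column) (use assms in \<open>auto simp: last_col_mat_def\<close>)
  also have "\<dots> = (\<Sum>i<N. x i * last_cofactor N s i)"
  proof (rule sum.cong[OF refl])
    fix i assume "i \<in> {..<N}"
    hence "last_col_mat N s x $$ (i, N - 1) = x i" using assms by (simp add: last_col_mat_def)
    thus "last_col_mat N s x $$ (i, N - 1) * cofactor (last_col_mat N s x) i (N - 1)
        = x i * last_cofactor N s i" by (simp only: c)
  qed
  finally show ?thesis .
qed

text \<open>
  For a power \<open>s\<^sub>i\<^sup>k\<close> with \<open>k < N - 1\<close> in the last column, two columns agree and the determinant is zero;
  a polynomial of degree less than \<open>N - 1\<close> is a combination of these powers.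
\<close>

lemma cofactors_annihilate:
  assumes "degree q < N - 1"
  shows "(\<Sum>i<N. poly q (s i) * last_cofactor N s i) = 0"
proof -
  have N: "N > 0" using assms by simp
  have pw: "(\<Sum>i<N. s i ^ k * last_cofactor N s i) = 0" if k: "k < N - 1" for k
  proof -
    have "Determinant.det (last_col_mat N s (\<lambda>i. s i ^ k)) = 0"
    proof (rule det_identical_columns)
      show "last_col_mat N s (\<lambda>i. s i ^ k) \<in> carrier_mat N N" by (simp add: last_col_mat_def)
      show "k \<noteq> N - 1" "k < N" "N - 1 < N" using k N by auto
      show "col (last_col_mat N s (\<lambda>i. s i ^ k)) k = col (last_col_mat N s (\<lambda>i. s i ^ k)) (N - 1)"
        using k N by (intro eq_vecI) (auto simp: last_col_mat_def)
    qed
    thus ?thesis unfolding det_last_col[OF N] .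
  qed
  have "(\<Sum>i<N. poly q (s i) * last_cofactor N s i)
      = (\<Sum>i<N. \<Sum>k\<le>degree q. coeff q k * (s i ^ k * last_cofactor N s i))"
    unfolding poly_altdef sum_distrib_right by (simp add: mult.assoc)
  also have "\<dots> = (\<Sum>k\<le>degree q. coeff q k * (\<Sum>i<N. s i ^ k * last_cofactor N s i))"
    unfolding sum_distrib_left by (rule sum.swap)
  also have "\<dots> = 0"
  proof (intro sum.neutral ballI)
    fix k assume "k \<in> {..degree q}"
    hence "k < N - 1" using assms by simp
    thus "coeff q k * (\<Sum>i<N. s i ^ k * last_cofactor N s i) = 0"
      by (simp only: pw mult_zero_right)
  qed
  finally show ?thesis .
qed

text \<open>
  A vector in the kernel consists of the coefficients of a polynomial of degree less than \<open>N\<close> that vanishes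
  at the \<open>N\<close> points \<open>s\<^sub>i\<close>.
\<close>

lemma vandermonde_nonzero:
  assumes inj: "inj_on s {..<N}" and N: "N > 0"
  shows "Determinant.det (last_col_mat N s (\<lambda>i. s i ^ (N - 1))) \<noteq> 0"
proof
  define M where "M = last_col_mat N s (\<lambda>i. s i ^ (N - 1))"
  have M: "M \<in> carrier_mat N N" by (simp add: M_def last_col_mat_def)
  have entry: "M $$ (i, j) = s i ^ j" if "i < N" "j < N" for i j
  proof (cases "j < N - 1")
    case False
    hence "j = N - 1" using that by simp
    thus ?thesis using that by (simp add: M_def last_col_mat_def)
  qed (use that in \<open>simp add: M_def last_col_mat_def\<close>)
  assume "Determinant.det (last_col_mat N s (\<lambda>i. s i ^ (N - 1))) = 0"
  then obtain v where v: "v \<in> carrier_vec N" "v \<noteq> 0\<^sub>v N" "M *\<^sub>v v = 0\<^sub>v N"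
    using det_0_iff_vec_prod_zero[OF M] unfolding M_def[symmetric] by blast
  define q where "q = (\<Sum>j<N. monom (vec_index v j) j)"
  have "degree q \<le> N - 1"
    unfolding q_def
  proof (rule degree_sum_le[OF finite_lessThan])
    fix j assume "j \<in> {..<N}"
    thus "degree (monom (vec_index v j) j) \<le> N - 1"
      using degree_monom_le[of "vec_index v j" j] by simp
  qed
  moreover have "poly q (s i) = 0" if i: "i < N" for i
  proof -
    have "poly q (s i) = (\<Sum>j<N. M $$ (i, j) * vec_index v j)"
      using i by (simp add: q_def poly_sum poly_monom entry mult.commute)
    also have "\<dots> = vec_index (M *\<^sub>v v) i"
      using i M v(1) by (simp add: scalar_prod_def lessThan_atLeast0)
    finally show ?thesis using i by (simp add: v(3))
  qed
  ultimately have "q = 0"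
    using N card_image[OF inj] by (intro poly_eqI_degree[of "s ` {..<N}"]) auto
  moreover have "coeff q j = vec_index v j" if "j < N" for j
    using that by (simp add: q_def coeff_sum)
  ultimately have "vec_index v j = 0" if "j < N" for j
    using that by simp
  hence "v = 0\<^sub>v N" using v(1) by (intro eq_vecI) auto
  thus False using v(2) by simp
qed

text \<open>
  The cofactors \<open>c\<^sub>i\<close> are \<open>K / p'(s\<^sub>i)\<close> with a common \<open>K\<close>: evaluate the relation
  \<open>cofactors_annihilate\<close> on the product of all \<open>\<lambda> - s\<^sub>m\<close> with \<open>m \<noteq> i, j\<close>, which leaves only the terms \<open>i\<close> and \<open>j\<close>.
  If \<open>K\<close> were zero, the Vandermonde determinant would vanish.
\<close>

lemma phi_partial_fractions:
  assumes inj: "inj_on s {..<N}" and N: "N > 0"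
  shows "\<exists>K. K \<noteq> 0 \<and> (\<forall>lam t. phi N s lam t = (\<Prod>j<N. lam - s j) *
        (\<Sum>i<N. vec_index t i / (lam - s i) * (K / (\<Prod>m\<in>{..<N} - {i}. s i - s m))))"
proof -
  let ?cof = "last_cofactor N s"
  define p where "p i = (\<Prod>m\<in>{..<N} - {i}. s i - s m)" for i
  have p0: "p i \<noteq> 0" if "i < N" for i
    unfolding p_def using inj that by (auto simp: inj_on_def)
  have const: "?cof i * p i = ?cof j * p j" if i: "i < N" and j: "j < N" and ij: "i \<noteq> j" for i j
  proof -
    define q where "q = (\<Prod>m\<in>{..<N} - {i, j}. [:- s m, 1:])"
    have val: "poly q x = (\<Prod>m\<in>{..<N} - {i, j}. x - s m)" for x
      by (simp add: q_def poly_prod)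
    have "degree q = card ({..<N} - {i, j})" unfolding q_def by (subst degree_prod_sum_eq) auto
    also have "\<dots> = N - 2" using i j ij by (subst card_Diff_subset) auto
    finally have "degree q < N - 1" using i j ij by simp
    hence "0 = (\<Sum>k<N. poly q (s k) * ?cof k)" by (rule cofactors_annihilate[symmetric])
    also have "\<dots> = (\<Sum>k\<in>{i, j}. poly q (s k) * ?cof k)"
      by (rule sum.mono_neutral_right) (use i j in \<open>auto simp: val\<close>)
    also have "\<dots> = poly q (s i) * ?cof i + poly q (s j) * ?cof j" using ij by simp
    finally have e: "poly q (s i) * ?cof i = - (poly q (s j) * ?cof j)" by (simp add: eq_neg_iff_add_eq_0)
    define R where "R = {..<N} - {i, j}"
    have R: "{..<N} - {i} = insert j R" "{..<N} - {j} = insert i R" "i \<notin> R" "j \<notin> R" "finite R"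
      using i j ij unfolding R_def by auto
    have pi: "p i = (s i - s j) * poly q (s i)" and pj: "p j = (s j - s i) * poly q (s j)"
      unfolding p_def val R_def[symmetric] R(1,2) using R(3-5) by simp_all
    have "?cof i * p i = (s i - s j) * (poly q (s i) * ?cof i)" by (simp add: pi)
    also have "\<dots> = ?cof j * p j" unfolding e by (simp add: pj algebra_simps)
    finally show ?thesis .
  qed
  define K where "K = ?cof 0 * p 0"
  have K: "?cof i = K / p i" if "i < N" for i
    using const[OF that N] p0[OF that] unfolding K_def by (cases "i = 0") (simp_all add: field_simps)
  have det: "Determinant.det (last_col_mat N s x) = (\<Sum>i<N. x i * (K / p i))" for x
    unfolding det_last_col[OF N] by (rule sum.cong) (auto simp: K)
  have K0: "K \<noteq> 0" 
  proof
    assume "K = 0"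
    hence "Determinant.det (last_col_mat N s (\<lambda>i. s i ^ (N - 1))) = 0" unfolding det by simp
    thus False using vandermonde_nonzero[OF inj N] by blast
  qed
  have phi: "phi N s lam t = (\<Prod>j<N. lam - s j) *
        (\<Sum>i<N. vec_index t i / (lam - s i) * (K / p i))" for lam t
    using det[of "\<lambda>i. vec_index t i / (lam - s i)"] unfolding phi_def last_col_mat_def by simp
  show ?thesis using K0 phi[unfolded p_def] by (intro exI conjI allI)
qed

text \<open>
  The involution \<open>x \<mapsto> - x\<close> has no fixed point in \<open>S\<close>. The parity of \<open>N\<close> gives \<open>p(-1) = p(1)\<close>, and this is
  why the formula for \<open>f\<close> divides both terms by \<open>p(1)\<close>.
\<close>

lemma even_card_symmetric:
  fixes S :: "complex set"
  assumes "finite S" "\<And>x. x \<in> S \<Longrightarrow> - x \<in> S" "0 \<notin> S"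
  shows "even (card S)"
  using assms
proof (induction "card S" arbitrary: S rule: less_induct)
  case less
  show ?case
  proof (cases "S = {}")
    case False
    then obtain x where x: "x \<in> S" by blast
    have m: "- x \<in> S" "x \<noteq> - x" using less.prems(2)[OF x] x less.prems(3) by (auto simp: equal_neg_zero)
    have card: "card S = card (S - {x, - x}) + 2"
    proof -
      have "card {x, - x} = 2" using m(2) by simp
      moreover have "card (S - {x, - x}) = card S - card {x, - x}"
        using x m(1) by (intro card_Diff_subset) auto
      moreover have "card {x, - x} \<le> card S" using x m(1) less.prems(1) by (intro card_mono) auto
      ultimately show ?thesis by linarith
    qed
    have "even (card (S - {x, - x}))"
    proof (rule less.hyps)
      show "card (S - {x, - x}) < card S" using card by simp
      show "- y \<in> S - {x, - x}" if "y \<in> S - {x, - x}" for y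
        using that less.prems(2) by (auto simp: minus_equation_iff)
    qed (use less.prems in auto)
    thus ?thesis using card by simp
  qed simp
qed

section \<open>The explicit formula\<close>

text \<open>
  The imaginary part of \<open>q v\<^sub>4\<close> is the real part of \<open>- \<i> q v\<^sub>4\<close>.
\<close>

lemma real_point_Im: "real_point p (- \<i> * q) = 2 *\<^sub>R Re_vec (p *s v_basis 1) + 2 *\<^sub>R Im_vec (q *s (cx_mat Lmat *v v_basis 1))"
  by (simp add: real_point_def L_v1 Re_vec_def Im_vec_def Finite_Cartesian_Product.vec_eq_iff algebra_simps)

context hsl_labelled begin

lemma sum_labels: "(\<Sum>x\<in>Fr. g x) = (\<Sum>j<N. g (\<gamma> j))"
  by (rule sum.reindex_bij_betw[OF label_bij, symmetric])

lemma sum_neg_labels: "(\<Sum>x\<in>Fr. g x) = (\<Sum>j<N. g (- \<gamma> j))"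
  using sum_Fr_minus[of g] sum_labels[of "\<lambda>x. g (- x)"] by simp

lemma omit_labels: "j < N \<Longrightarrow> poly (omit Fr (\<gamma> j)) (s j) = (\<Prod>m\<in>{..<N} - {j}. s j - s m)"
proof -
  assume j: "j < N"
  have "bij_betw \<gamma> ({..<N} - {j}) (Fr - {\<gamma> j})"
    using bij_betw_DiffI[OF label_bij, of "{j}" "{\<gamma> j}"] j label_in by auto
  from prod.reindex_bij_betw[OF this, of "\<lambda>x. s j - sl x"]
  show ?thesis by (simp add: poly_omit)
qed

lemma p_fun_minus_one: "p_fun N s (-1) = p_fun N s 1" and p_fun_one_nonzero: "p_fun N s 1 \<noteq> 0"
proof -
  have lab: "p_fun N s x = (\<Prod>\<delta>\<in>Fr. x - sl \<delta>)" for x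
    unfolding p_fun_def by (rule prod.reindex_bij_betw[OF label_bij])
  have ev: "even (card Fr)"
    using slope_special(1)[of 0] by (intro even_card_symmetric freqs_finite) (auto simp: slope_def)
  have "p_fun N s (-1) = (\<Prod>\<delta>\<in>Fr. - (1 - sl (- \<delta>)))"
    unfolding lab by simp
  also have "\<dots> = (\<Prod>\<delta>\<in>Fr. 1 - sl (- \<delta>))"
    unfolding prod_uminus using ev by simp
  also have "\<dots> = p_fun N s 1"
    unfolding lab by (rule prod.reindex_bij_witness[of _ uminus uminus]) auto
  finally show "p_fun N s (-1) = p_fun N s 1" .
  show "p_fun N s 1 \<noteq> 0" unfolding lab using freqs_finite slope_special(5) by auto
qed

text \<open>
  The sums over \<open>j\<close> produced by \<open>\<phi>\<close> have the denominators \<open>1 - s\<^sub>j\<close> and \<open>-1 - s\<^sub>j\<close> at \<open>\<lambda> = \<plusminus>1\<close>. Since the exponents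
  in \<open>t\<^sub>j(z)\<close> are \<open>- \<gamma>\<^sub>j\<close>, they match, up to sign, \<open>1 + s\<close> and \<open>1 - s\<close> in \<open>fam1\<close> and \<open>fam4\<close> at the frequency \<open>- \<gamma>\<^sub>j\<close>.
\<close>

lemma f_of_fam:
  obtains c where "c \<noteq> 0" "\<And>t. f_of \<beta>0 N \<gamma> t = fam (\<lambda>x. c * coeffs_of t x)"
proof -
  define p' where "p' j = (\<Prod>m\<in>{..<N} - {j}. s j - s m)" for j
  from phi_partial_fractions[OF s_inj N_pos]
  obtain K where K0: "K \<noteq> 0" and "\<forall>lam t. phi N s lam t = (\<Prod>j<N. lam - s j) *
        (\<Sum>i<N. vec_index t i / (lam - s i) * (K / (\<Prod>m\<in>{..<N} - {i}. s i - s m)))"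
    by (elim exE conjE)
  hence phi: "phi N s lam t = p_fun N s lam * (\<Sum>j<N. vec_index t j / (lam - s j) * (K / p' j))" for lam t
    unfolding p_fun_def p'_def by simp
  note K = K0 phi
  \<comment> \<open>cancels the factor \<open>C0\<close> of the family; the sign is that of \<open>s\<close> at the frequency \<open>- \<gamma>\<^sub>j\<close>\<close>
  define c where "c = - K / C0"
  have c0: "c \<noteq> 0" using K(1) C0_nonzero by (simp add: c_def)
  have cC: "c * C0 = - K" using C0_nonzero by (simp add: c_def)
  have co: "c * coeffs_of t (- \<gamma> j) * C0 = - K * vec_index t j / (s j * p' j)" if "j < N" for t j
  proof -
    have "c * coeffs_of t (- \<gamma> j) * C0 = (c * C0) * (vec_index t j / (s j * p' j))"
      by (simp add: coeffs_of_label[OF that] omit_labels[OF that] p'_def[symmetric] mult_ac)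
    thus ?thesis unfolding cC by simp
  qed
  have "f_of \<beta>0 N \<gamma> t z = fam (\<lambda>x. c * coeffs_of t x) z" for t z
  proof -
    let ?p1 = "p_fun N s 1"
    define P where "P = 1 / ?p1 * (chi1 \<beta>0 N \<gamma> t 1 z * e_fun (\<beta>0 / 2) z - chi1 \<beta>0 N \<gamma> t 1 0)"
    define Q where "Q = 1 / ?p1 * (chi1 \<beta>0 N \<gamma> t (-1) z * e_fun (- (\<beta>0 / 2)) z - chi1 \<beta>0 N \<gamma> t (-1) 0)"
    have f: "f_of \<beta>0 N \<gamma> t z = real_point P (- \<i> * Q)"
      unfolding real_point_Im f_of_def Let_def P_def Q_def ..
    have chi: "1 / ?p1 * chi1 \<beta>0 N \<gamma> t lam z = lam * (\<Sum>j<N. vec_index t j * e_fun (- \<gamma> j) z / (lam - s j) * (K / p' j))"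
      if "p_fun N s lam = ?p1" for lam z
      unfolding chi1_def K(2) that using p_fun_one_nonzero by (simp add: t_at_def)
    have "P = (\<Sum>j<N. vec_index t j * e_fun (- \<gamma> j) z / (1 - s j) * (K / p' j)) * e_fun (\<beta>0 / 2) z
        - (\<Sum>j<N. vec_index t j * e_fun (- \<gamma> j) 0 / (1 - s j) * (K / p' j))"
      unfolding P_def right_diff_distrib mult.assoc[symmetric] chi[OF refl] by simp
    also have "\<dots> = (\<Sum>j<N. (K * vec_index t j / p' j / (1 - s j)) * (e_fun (- \<gamma> j + \<beta>0 / 2) z - 1))"
      unfolding sum_distrib_right sum_subtractf[symmetric] e_fun_add_left e_fun_zero
      by (intro sum.cong refl) (simp only: right_diff_distrib, simp add: mult_ac)
    also have "\<dots> = fam1 (\<lambda>x. c * coeffs_of t x) z"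
      unfolding fam1_eq sum_neg_labels
    proof (rule sum.cong[OF refl])
      fix j assume "j \<in> {..<N}"
      hence j: "j < N" by simp
      show "(K * vec_index t j / p' j / (1 - s j)) * (e_fun (- \<gamma> j + \<beta>0 / 2) z - 1)
        = (c * coeffs_of t (- \<gamma> j) * C0 * sl (- \<gamma> j) / (1 + sl (- \<gamma> j))) * (e_fun (- \<gamma> j + \<beta>0 / 2) z - 1)"
        unfolding co[OF j] using slope_special(1)[OF label_in[OF j]] by simp
    qed
    finally have P: "P = fam1 (\<lambda>x. c * coeffs_of t x) z" .
    have "Q = - (\<Sum>j<N. vec_index t j * e_fun (- \<gamma> j) z / (-1 - s j) * (K / p' j)) * e_fun (- (\<beta>0 / 2)) z
        + (\<Sum>j<N. vec_index t j * e_fun (- \<gamma> j) 0 / (-1 - s j) * (K / p' j))"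
      unfolding Q_def right_diff_distrib mult.assoc[symmetric] chi[OF p_fun_minus_one] by simp
    also have "\<dots> = (\<Sum>j<N. (K * vec_index t j / p' j / (1 + s j)) * (e_fun (- \<gamma> j - \<beta>0 / 2) z - 1))"
    proof -
      have m: "x / (- 1 - s j) * y = - (x / (1 + s j) * y)" for x y j
      proof -
        have e: "-1 - s j = - (1 + s j)" by simp
        show ?thesis by (simp only: e minus_divide_right[symmetric] mult_minus_left)
      qed
      show ?thesis
        unfolding m sum_negf minus_minus sum_distrib_right e_fun_diff_left e_fun_zero add_uminus_conv_diff sum_subtractf[symmetric]
        by (intro sum.cong refl) (simp only: right_diff_distrib, simp add: mult_ac)
    qed
    finally have Q: "Q = (\<Sum>j<N. (K * vec_index t j / p' j / (1 + s j)) * (e_fun (- \<gamma> j - \<beta>0 / 2) z - 1))" .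
    have "- \<i> * Q = fam4 (\<lambda>x. c * coeffs_of t x) z"
      unfolding fam4_eq sum_neg_labels Q sum_distrib_left
    proof (rule sum.cong[OF refl])
      fix j assume "j \<in> {..<N}"
      hence j: "j < N" by simp
      have "- \<i> * (c * coeffs_of t (- \<gamma> j)) * C0 = - \<i> * (- K * vec_index t j / (s j * p' j))"
        using co[OF j, of t] by (simp add: mult_ac)
      thus "- \<i> * ((K * vec_index t j / p' j / (1 + s j)) * (e_fun (- \<gamma> j - \<beta>0 / 2) z - 1))
        = (- \<i> * (c * coeffs_of t (- \<gamma> j)) * C0 * sl (- \<gamma> j) / (1 - sl (- \<gamma> j))) * (e_fun (- \<gamma> j - \<beta>0 / 2) z - 1)"
        using slope_special(1)[OF label_in[OF j]] by simp
    qed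
    thus ?thesis unfolding f P fam_def by simp
  qed
  thus thesis using that[OF c0] by blast
qed

lemma branch_point_fam: "branch_point (fam A) z \<longleftrightarrow> psum A z = 0 \<and> qsum A z = 0"
  unfolding branch_point_def coord_eq_iff coord_f_z[OF fam_differentiable] F1_fam F4_fam fam_wirtinger
  by auto

text \<open>
  Membership in a hyperplane may be tested on any representative, since the condition is homogeneous.
\<close>

lemma proj_class_in_image:
  assumes "u \<in> carrier_vec N - {0\<^sub>v N}" "\<And>c t. t \<in> carrier_vec N \<Longrightarrow> l (c \<cdot>\<^sub>v t) = (c :: complex) * l t"
  shows "proj_class u \<in> proj_class ` {t \<in> carrier_vec N - {0\<^sub>v N}. l t = 0} \<longleftrightarrow> l u = (0 :: complex)"
proof
  assume "proj_class u \<in> proj_class ` {t \<in> carrier_vec N - {0\<^sub>v N}. l t = 0}"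
  then obtain t where t: "t \<in> carrier_vec N" "l t = 0" "proj_class u = proj_class t" by blast
  obtain c where "u = c \<cdot>\<^sub>v t" using proj_class_eqD[OF t(3)] by blast
  thus "l u = 0" using assms(2)[OF t(1)] t(2) by simp
qed (use assms(1) in blast)

lemma t_at_nonzero:
  assumes "t \<in> carrier_vec N - {0\<^sub>v N}"
  shows "t_at N \<gamma> t z \<in> carrier_vec N - {0\<^sub>v N}"
proof -
  have "t_at N \<gamma> t z \<noteq> 0\<^sub>v N"
  proof
    assume z: "t_at N \<gamma> t z = 0\<^sub>v N"
    have "vec_index t j = 0" if "j < N" for j
      using arg_cong[OF z, of "\<lambda>v. vec_index v j"] that by (simp add: t_at_def)
    hence "t = 0\<^sub>v N" using assms by (intro eq_vecI) auto
    thus False using assms by simp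
  qed
  thus ?thesis by (simp add: t_at_def)
qed

text \<open>
  With \<open>A (- \<gamma>\<^sub>j) = t\<^sub>j / (s\<^sub>j p'(s\<^sub>j))\<close>, the sum \<open>psum A z\<close> is, up to sign, the form defining \<open>\<Theta>\<^sub>0\<close>, evaluated at
  \<open>t(z)\<close>; in \<open>qsum A z\<close> the additional factor \<open>s\<close> cancels \<open>s\<^sub>j\<close> and leaves a multiple of the form
  defining \<open>\<Theta>\<^sub>\<infinity>\<close>.
\<close>

lemma branch_point_hyperplanes:
  assumes c: "c \<noteq> 0" and t: "t \<in> carrier_vec N - {0\<^sub>v N}"
  shows "branch_point (fam (\<lambda>x. c * coeffs_of t x)) z \<longleftrightarrow>
    proj_class (t_at N \<gamma> t z) \<in> Theta_0 N s \<inter> Theta_infty N s"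
proof -
  let ?u = "t_at N \<gamma> t z"
  define p' where "p' j = (\<Prod>m\<in>{..<N} - {j}. s j - s m)" for j
  define \<epsilon> where "\<epsilon> = (-1 :: complex) ^ (N - 1)"
  have \<epsilon>: "\<epsilon> \<noteq> 0" "\<epsilon> * \<epsilon> = 1" by (simp_all add: \<epsilon>_def power_mult_distrib[symmetric])
  have w: "(\<Prod>m\<in>{..<N} - {j}. 1 / (s m - s j)) = \<epsilon> / p' j" if "j < N" for j
  proof -
    have "(\<Prod>m\<in>{..<N} - {j}. s m - s j) = (\<Prod>m\<in>{..<N} - {j}. - (s j - s m))" by simp
    also have "\<dots> = \<epsilon> * p' j" unfolding prod_uminus p'_def \<epsilon>_def using that by simp
    finally have "(\<Prod>m\<in>{..<N} - {j}. 1 / (s m - s j)) = 1 / (\<epsilon> * p' j)"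
      unfolding prod_dividef by simp
    also have "\<dots> = (\<epsilon> * \<epsilon>) / (\<epsilon> * p' j)" using \<epsilon>(2) by simp
    also have "\<dots> = \<epsilon> / p' j" using \<epsilon>(1) by simp
    finally show ?thesis .
  qed
  have co: "coeffs_of t (- \<gamma> j) = vec_index t j / (s j * p' j)" if "j < N" for j
    using that by (simp add: coeffs_of_label omit_labels p'_def)
  have "proj_class ?u \<in> Theta_infty N s \<longleftrightarrow>
      (\<Sum>j<N. (\<Prod>m\<in>{..<N} - {j}. 1 / (s m - s j)) * vec_index ?u j) = 0"
    unfolding Theta_infty_def
    by (rule proj_class_in_image[OF t_at_nonzero[OF t]]) (auto simp: sum_distrib_left intro!: sum.cong)
  also have "(\<Sum>j<N. (\<Prod>m\<in>{..<N} - {j}. 1 / (s m - s j)) * vec_index ?u j)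
      = \<epsilon> * (\<Sum>j<N. vec_index t j / p' j * e_fun (- \<gamma> j) z)"
    unfolding sum_distrib_left by (intro sum.cong refl) (simp add: w t_at_def)
  finally have inf: "proj_class ?u \<in> Theta_infty N s \<longleftrightarrow> (\<Sum>j<N. vec_index t j / p' j * e_fun (- \<gamma> j) z) = 0"
    using \<epsilon>(1) by simp
  have "proj_class ?u \<in> Theta_0 N s \<longleftrightarrow>
      (\<Sum>j<N. (\<Prod>m\<in>{..<N} - {j}. 1 / (s m - s j)) * (vec_index ?u j / s j)) = 0"
    unfolding Theta_0_def
    by (rule proj_class_in_image[OF t_at_nonzero[OF t]]) (auto simp: sum_distrib_left intro!: sum.cong)
  also have "(\<Sum>j<N. (\<Prod>m\<in>{..<N} - {j}. 1 / (s m - s j)) * (vec_index ?u j / s j))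
      = \<epsilon> * (\<Sum>j<N. coeffs_of t (- \<gamma> j) * e_fun (- \<gamma> j) z)"
    unfolding sum_distrib_left by (intro sum.cong refl) (simp add: w t_at_def co)
  finally have zero: "proj_class ?u \<in> Theta_0 N s \<longleftrightarrow> psum (coeffs_of t) z = 0"
    using \<epsilon>(1) by (simp add: psum_def sum_neg_labels)
  have "qsum (coeffs_of t) z = (\<beta>0 / cnj \<beta>0) * (\<Sum>j<N. - (vec_index t j / p' j * e_fun (- \<gamma> j) z))"
    unfolding qsum_def sum_neg_labels
    by (intro arg_cong[where f = "(*) (\<beta>0 / cnj \<beta>0)"] sum.cong refl)
       (use slope_special(1)[OF label_in] in \<open>simp add: co\<close>)
  hence "qsum (coeffs_of t) z = 0 \<longleftrightarrow> proj_class ?u \<in> Theta_infty N s"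
    unfolding inf using beta_nonzero by (simp add: sum_negf)
  thus ?thesis
    unfolding branch_point_fam psum_scale qsum_scale using zero c by auto
qed

lemma spectral_data_image: "spec ` HSL = spectra"
proof (intro equalityI subsetI)
  fix d assume "d \<in> spec ` HSL"
  then obtain f where f: "f \<in> HSL" "d = spec f" by blast
  obtain A where "\<exists>x\<in>Fr. A x \<noteq> 0" "f = fam A" using HSL_is_fam[OF f(1)] by blast
  thus "d \<in> spectra" using spectral_data_fam_in_space f(2) by blast
next
  fix d assume "d \<in> spectra"
  then obtain A where "\<exists>x\<in>Fr. A x \<noteq> 0" "spec (fam A) = d"
    using spectral_space_realised by (metis prod.collapse)
  thus "d \<in> spec ` HSL" using fam_in_HSL by blast
qed

lemma Phi_eq_imp_equiv:
  assumes f: "f \<in> HSL" and f': "f' \<in> HSL"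
    and eq: "Phi \<beta>0 N \<gamma> (spec f) = Phi \<beta>0 N \<gamma> (spec f')"
  shows "dilation_T0_equiv f f'"
proof -
  obtain A where A: "\<exists>x\<in>Fr. A x \<noteq> 0" "f = fam A" using HSL_is_fam[OF f] by blast
  obtain B where B: "\<exists>x\<in>Fr. B x \<noteq> 0" "f' = fam B" using HSL_is_fam[OF f'] by blast
  obtain c where "c \<noteq> 0" "fam B = fam (\<lambda>x. c * A x)"
    using Phi_eqD[OF B(1) A(1)] eq unfolding A(2) B(2) by metis
  thus ?thesis using equiv_scale unfolding A(2) B(2) by metis
qed

lemma spectral_data_eq_iff:
  assumes "f \<in> HSL" "f' \<in> HSL"
  shows "spec f = spec f' \<longleftrightarrow> dilation_T0_equiv f f'"
proof
  assume "spec f = spec f'"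
  thus "dilation_T0_equiv f f'" using Phi_eq_imp_equiv[OF assms] by simp
next
  assume e: "dilation_T0_equiv f f'"
  obtain A where A: "f = fam A" using HSL_is_fam[OF assms(1)] by blast
  obtain c where "c \<noteq> 0" "f' = fam (\<lambda>x. c * A x)"
    using equiv_imp_scale e unfolding A by blast
  thus "spec f = spec f'" using spectral_data_scale A by metis
qed

lemma f_of_in_HSL:
  assumes "t \<in> carrier_vec N - {0\<^sub>v N}"
  shows "f_of \<beta>0 N \<gamma> t \<in> HSL"
    and "Phi \<beta>0 N \<gamma> (spec (f_of \<beta>0 N \<gamma> t)) = proj_class t"
    and "branch_point (f_of \<beta>0 N \<gamma> t) z \<longleftrightarrow> proj_class (t_at N \<gamma> t z) \<in> Theta_0 N s \<inter> Theta_infty N s"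
proof -
  obtain c where c: "c \<noteq> 0" "\<And>t. f_of \<beta>0 N \<gamma> t = fam (\<lambda>x. c * coeffs_of t x)"
    using f_of_fam by blast
  have "\<exists>x\<in>Fr. c * coeffs_of t x \<noteq> 0" using coeffs_of_nonzero[OF assms] c(1) by simp
  thus "f_of \<beta>0 N \<gamma> t \<in> HSL" unfolding c(2) by (rule fam_in_HSL)
  show "Phi \<beta>0 N \<gamma> (spec (f_of \<beta>0 N \<gamma> t)) = proj_class t"
    unfolding c(2) spectral_data_scale[OF c(1)] by (rule Phi_coeffs_of[OF assms])
  show "branch_point (f_of \<beta>0 N \<gamma> t) z \<longleftrightarrow> proj_class (t_at N \<gamma> t z) \<in> Theta_0 N s \<inter> Theta_infty N s"
    unfolding c(2) by (rule branch_point_hyperplanes[OF c(1) assms])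
qed

end

theorem proposition5p4:
  fixes \<Gamma> :: "complex set" and \<beta>0 :: complex and N :: nat and \<gamma> :: "nat \<Rightarrow> complex"
  assumes "is_lattice \<Gamma>"
    and "\<beta>0 \<in> dual_lattice \<Gamma>"
    and "freqs \<Gamma> \<beta>0 \<noteq> {}"
    and "N = card (freqs \<Gamma> \<beta>0)"
    and "is_labelling \<Gamma> \<beta>0 N \<gamma>"
  shows
    (* the spectral data identifies the maps modulo dilations and T0 with the spectral space *)
    "spectral_data \<Gamma> \<beta>0 ` based_HSL \<Gamma> \<beta>0 = spectral_space \<Gamma> \<beta>0 \<and>
     (\<forall>f \<in> based_HSL \<Gamma> \<beta>0. \<forall>f' \<in> based_HSL \<Gamma> \<beta>0.
        spectral_data \<Gamma> \<beta>0 f = spectral_data \<Gamma> \<beta>0 f' \<longleftrightarrow> dilation_T0_equiv f f') \<and>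
     bij_betw (Phi \<beta>0 N \<gamma>) (spectral_space \<Gamma> \<beta>0) (complex_proj (N - 1)) \<and>
     (\<forall>t \<in> carrier_vec N - {0\<^sub>v N}.
        f_of \<beta>0 N \<gamma> t \<in> based_HSL \<Gamma> \<beta>0 \<and>
        Phi \<beta>0 N \<gamma> (spectral_data \<Gamma> \<beta>0 (f_of \<beta>0 N \<gamma> t)) = proj_class t) \<and>
     (\<forall>f \<in> based_HSL \<Gamma> \<beta>0. \<forall>t \<in> carrier_vec N - {0\<^sub>v N}.
        Phi \<beta>0 N \<gamma> (spectral_data \<Gamma> \<beta>0 f) = proj_class t \<longrightarrow>
        dilation_T0_equiv (f_of \<beta>0 N \<gamma> t) f) \<and>
     (\<forall>t \<in> carrier_vec N - {0\<^sub>v N}. \<forall>z.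
        branch_point (f_of \<beta>0 N \<gamma> t) z \<longleftrightarrow>
        proj_class (t_at N \<gamma> t z)
          \<in> Theta_0 N (\<lambda>j. slope \<beta>0 (\<gamma> j)) \<inter> Theta_infty N (\<lambda>j. slope \<beta>0 (\<gamma> j)))"
proof -
  obtain \<omega>1 \<omega>2 where \<omega>: "(SOME (\<omega>1, \<omega>2). lattice_basis \<Gamma> \<omega>1 \<omega>2) = (\<omega>1, \<omega>2)" by fastforce
  have "\<exists>p. case p of (\<omega>1, \<omega>2) \<Rightarrow> lattice_basis \<Gamma> \<omega>1 \<omega>2"
    using assms(1) unfolding is_lattice_def by auto
  from someI_ex[OF this] have basis: "lattice_basis \<Gamma> \<omega>1 \<omega>2" unfolding \<omega> by simp
  have fin: "finite (freqs \<Gamma> \<beta>0)"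
    using assms(5) bij_betw_finite[of \<gamma> "{..<N}"] unfolding is_labelling_def by blast
  interpret hsl_labelled \<Gamma> \<omega>1 \<omega>2 \<beta>0 N \<gamma>
    by unfold_locales (use basis \<omega> fin assms in auto)
  show ?thesis
    using spectral_data_image spectral_data_eq_iff Phi_bij f_of_in_HSL Phi_eq_imp_equiv[OF f_of_in_HSL(1)]
    by (intro conjI ballI impI allI) auto
qed

end
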